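(* Let $n\ge4$. Up to isomorphism there are four (parametrized families of) solvable indecomposable left Leibniz algebras over $\mathbb{C}$ of dimension $n+2$ whose nilradical is $\mathcal{L}^4$ (a nilradical of codimension two): the algebra (i) for $n\ge5$, and the algebras (ii), (iii), (iv) for $n=4$. That is, each algebra listed below is such an algebra, and every such algebra is isomorphic to one of those listed, for some admissible complex values of the parameters. In (ii)–(iv) the parameters are in addition such that no nontrivial linear combination of the restrictions to $\mathcal{L}^4$ of the left multiplications $x\mapsto[e_5,x]$ and $x\mapsto[e_6,x]$ is nilpotent. In each item the brackets are those of $\mathcal{L}^4$ on $e_1,\dots,e_n$ together with the ones displayed. (i) $l_{n+2,1}$ $(n\ge5)$: $[e_1,e_{n+1}]=e_1+e_3$, $[e_3,e_{n+1}]=2e_3$, $[e_4,e_{n+1}]=3(e_4-e_2)$, $[e_i,e_{n+1}]=(i-1)e_i$, $[e_{n+1},e_1]=-e_1-e_3$, $[e_{n+1},e_2]=-4e_2$, $[e_{n+1},e_3]=-2e_3$, $[e_{n+1},e_4]=-e_2-3e_4$, $[e_{n+1},e_i]=(1-i)e_i$, $[e_1,e_{n+2}]=e_1$, $[e_3,e_{n+2}]=e_3$, $[e_4,e_{n+2}]=2(e_4-e_2)$, $[e_i,e_{n+2}]=(i-2)e_i$ $(5\le i\le n)$, $[e_{n+2},e_1]=-e_1$, $[e_{n+2},e_2]=-2e_2$, $[e_{n+2},e_j]=(2-j)e_j$ $(3\le j\le n)$. (ii) $l_{6,2}$ $(n=4)$: $[e_1,e_5]=e_1$, $[e_3,e_5]=e_3$,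 $[e_4,e_5]=2(e_4-e_2)$, $[e_5,e_1]=-e_1$, $[e_5,e_2]=-2e_2$, $[e_5,e_3]=-e_3$, $[e_5,e_4]=-2e_4$, $[e_1,e_6]=e_1+be_3$, $[e_3,e_6]=e_1+be_3$, $[e_4,e_6]=(b+1)e_4-(b+1)e_2$, $[e_6,e_1]=-e_1-be_3$, $[e_6,e_2]=-2(b+1)e_2$, $[e_6,e_3]=-e_1-be_3$, $[e_6,e_4]=-(b+1)(e_2+e_4)$, where $b\ne-1$. (iii) $l_{6,3}$ $(n=4)$: $[e_1,e_5]=e_1+(c+1)e_3$, $[e_3,e_5]=ce_1+2e_3$, $[e_4,e_5]=3(e_4-e_2)$, $[e_5,e_1]=-e_1-(c+1)e_3$, $[e_5,e_2]=-2(c+2)e_2$, $[e_5,e_3]=-ce_1-2e_3$, $[e_5,e_4]=(-2c-1)e_2-3e_4$, $[e_1,e_6]=e_1$, $[e_3,e_6]=e_3$, $[e_4,e_6]=2(e_4-e_2)$, $[e_6,e_1]=-e_1$, $[e_6,e_2]=-2e_2$, $[e_6,e_3]=-e_3$, $[e_6,e_4]=-2e_4$, where $c\ne-2$. (iv) $l_{6,4}$ $(n=4)$: $[e_1,e_5]=e_1$, $[e_3,e_5]=e_3$, $[e_4,e_5]=2(e_4-e_2)$, $[e_5,e_1]=-e_1$, $[e_5,e_2]=-2e_2$, $[e_5,e_3]=-e_3$, $[e_5,e_4]=-2e_4$, $[e_1,e_6]=be_1+(1-b)e_3$, $[e_3,e_6]=e_1$, $[e_4,e_6]=b(e_4-e_2)$,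 $[e_6,e_1]=-be_1+(b-1)e_3$, $[e_6,e_2]=-2e_2$, $[e_6,e_3]=-e_1$, $[e_6,e_4]=(b-2)e_2-be_4$, where $b\ne0$.
   Context: All algebras are finite dimensional over $\mathbb{C}$. A left Leibniz algebra is a vector space $L$ with a bilinear bracket satisfying $[[x,y],z]=[x,[y,z]]-[y,[x,z]]$ for all $x,y,z\in L$. $L$ is nilpotent (solvable) if the series $L^0=L$, $L^{k+1}=[L^k,L]$ (resp. $L^{(0)}=L$, $L^{(k+1)}=[L^{(k)},L^{(k)}]$) reaches $0$ (for left Leibniz algebras, the lower central series may be taken as $L^{k+1}=[L,L^k]$). The nilradical of a solvable Leibniz algebra is its unique maximal nilpotent (two-sided) ideal. An algebra is indecomposable if it is not a direct sum of two nonzero ideals. For $n\ge4$, $\mathcal{L}^4$ is the $n$-dimensional nilpotent (left and right) Leibniz algebra with basis $e_1,\dots,e_n$ and only nonzero brackets $[e_1,e_1]=e_2$, $[e_i,e_1]=e_{i+1}$ $(3\le i\le n-1)$, $[e_1,e_3]=2e_2-e_4$, $[e_3,e_3]=e_2$, $[e_1,e_j]=-e_{j+1}$ $(4\le j\le n-1)$. The extended algebra has basis $e_1,\dots,e_n,e_{n+1},e_{n+2}$. Brackets of basis elements that are neither displayed nor among those of $\mathcal{L}^4$ are zero. *)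

theory Defs
  imports Complex_Main "HOL-Library.Function_Algebras"
begin

section \<open>Finite-dimensional algebras over the complex numbers\<close>

text \<open>
  The underlying vector space of an algebra is a subspace of an ambient complex vector space, namely
  a type with the scalar multiplication given in the record. Ideals are then again algebras, by
  restriction of the carrier.
\<close>

record 'a calgebra =
  carr :: "'a set"
  smul :: "complex \<Rightarrow> 'a \<Rightarrow> 'a"
  bracket :: "'a \<Rightarrow> 'a \<Rightarrow> 'a"

locale fd_algebra = vector_space "smul A" for A :: "'a::ab_group_add calgebra" +
  assumes subspace_carr: "subspace (carr A)"
    and finite_dim: "\<exists>B. finite B \<and> carr A \<subseteq> span B"
    and bracket_closed: "\<lbrakk>x \<in> carr A; y \<in> carr A\<rbrakk> \<Longrightarrow> bracket A x y \<in> carr A"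
    and bracket_add_left: "\<lbrakk>x \<in> carr A; y \<in> carr A; z \<in> carr A\<rbrakk>
          \<Longrightarrow> bracket A (x + y) z = bracket A x z + bracket A y z"
    and bracket_add_right: "\<lbrakk>x \<in> carr A; y \<in> carr A; z \<in> carr A\<rbrakk>
          \<Longrightarrow> bracket A x (y + z) = bracket A x y + bracket A x z"
    and bracket_smul_left: "\<lbrakk>x \<in> carr A; y \<in> carr A\<rbrakk>
          \<Longrightarrow> bracket A (smul A c x) y = smul A c (bracket A x y)"
    and bracket_smul_right: "\<lbrakk>x \<in> carr A; y \<in> carr A\<rbrakk>
          \<Longrightarrow> bracket A x (smul A c y) = smul A c (bracket A x y)"

locale left_leibniz_algebra = fd_algebra +
  assumes left_leibniz: "\<lbrakk>x \<in> carr A; y \<in> carr A; z \<in> carr A\<rbrakk>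
          \<Longrightarrow> bracket A (bracket A x y) z
              = bracket A x (bracket A y z) - bracket A y (bracket A x z)"

definition alg_dim :: "'a::ab_group_add calgebra \<Rightarrow> nat" where
  "alg_dim A = vector_space.dim (smul A) (carr A)"

definition bracket_span :: "'a::ab_group_add calgebra \<Rightarrow> 'a set \<Rightarrow> 'a set \<Rightarrow> 'a set" where
  "bracket_span A S T = module.span (smul A) {bracket A x y | x y. x \<in> S \<and> y \<in> T}"

text \<open>
  For left Leibniz algebras the lower central series has to multiply by the whole algebra from the
  left: for the algebra with basis t, x and only nonzero product [t,x] = x, the series with
  multiplication from the right reaches 0, although the left multiplication by t is not nilpotent.
\<close>

primrec lower_central :: "'a::ab_group_add calgebra \<Rightarrow> nat \<Rightarrow> 'a set" where
  "lower_central A 0 = carr A"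
| "lower_central A (Suc k) = bracket_span A (carr A) (lower_central A k)"

primrec derived_series :: "'a::ab_group_add calgebra \<Rightarrow> nat \<Rightarrow> 'a set" where
  "derived_series A 0 = carr A"
| "derived_series A (Suc k) = bracket_span A (derived_series A k) (derived_series A k)"

definition nilpotent_algebra :: "'a::ab_group_add calgebra \<Rightarrow> bool" where
  "nilpotent_algebra A \<longleftrightarrow> (\<exists>k. lower_central A k = {0})"

definition solvable_algebra :: "'a::ab_group_add calgebra \<Rightarrow> bool" where
  "solvable_algebra A \<longleftrightarrow> (\<exists>k. derived_series A k = {0})"

definition ideal :: "'a::ab_group_add calgebra \<Rightarrow> 'a set \<Rightarrow> bool" where
  "ideal A I \<longleftrightarrow> module.subspace (smul A) I \<and> I \<subseteq> carr A \<and>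
     (\<forall>x\<in>carr A. \<forall>y\<in>I. bracket A x y \<in> I \<and> bracket A y x \<in> I)"

definition restrict_alg :: "'a calgebra \<Rightarrow> 'a set \<Rightarrow> 'a calgebra" where
  "restrict_alg A I = A\<lparr>carr := I\<rparr>"

definition nilpotent_ideal :: "'a::ab_group_add calgebra \<Rightarrow> 'a set \<Rightarrow> bool" where
  "nilpotent_ideal A I \<longleftrightarrow> ideal A I \<and> nilpotent_algebra (restrict_alg A I)"

definition maximal_nilpotent_ideal :: "'a::ab_group_add calgebra \<Rightarrow> 'a set \<Rightarrow> bool" where
  "maximal_nilpotent_ideal A I \<longleftrightarrow>
     nilpotent_ideal A I \<and> (\<forall>J. nilpotent_ideal A J \<and> I \<subseteq> J \<longrightarrow> J = I)"

definition is_nilradical :: "'a::ab_group_add calgebra \<Rightarrow> 'a set \<Rightarrow> bool" where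
  "is_nilradical A N \<longleftrightarrow>
     maximal_nilpotent_ideal A N \<and> (\<forall>M. maximal_nilpotent_ideal A M \<longrightarrow> M = N)"

definition indecomposable :: "'a::ab_group_add calgebra \<Rightarrow> bool" where
  "indecomposable A \<longleftrightarrow>
     \<not> (\<exists>I J. ideal A I \<and> ideal A J \<and> I \<noteq> {0} \<and> J \<noteq> {0} \<and>
             I \<inter> J = {0} \<and> carr A = {x + y | x y. x \<in> I \<and> y \<in> J})"

definition isomorphic ::
  "'a::ab_group_add calgebra \<Rightarrow> 'b::ab_group_add calgebra \<Rightarrow> bool" (infix "\<cong>\<^sub>L" 50) where
  "A \<cong>\<^sub>L B \<longleftrightarrow> (\<exists>f. bij_betw f (carr A) (carr B) \<and>
     (\<forall>x\<in>carr A. \<forall>y\<in>carr A. f (x + y) = f x + f y) \<and>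
     (\<forall>c. \<forall>x\<in>carr A. f (smul A c x) = smul B c (f x)) \<and>
     (\<forall>x\<in>carr A. \<forall>y\<in>carr A. f (bracket A x y) = bracket B (f x) (f y)))"


section \<open>Algebras given by structure constants\<close>

text \<open>
  Vectors with coordinates indexed from 1 to m are functions on the natural numbers vanishing
  outside that range. A table gives the bracket of the i-th and the j-th basis vector.
\<close>

definition cscale :: "complex \<Rightarrow> (nat \<Rightarrow> complex) \<Rightarrow> nat \<Rightarrow> complex" (infixr "\<cdot>" 75) where
  "c \<cdot> v = (\<lambda>i. c * v i)"

definition bvec :: "nat \<Rightarrow> nat \<Rightarrow> complex" where
  "bvec i = (\<lambda>j. if j = i then 1 else 0)"

definition coord_space :: "nat \<Rightarrow> (nat \<Rightarrow> complex) set" where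
  "coord_space m = {v. \<forall>i. i \<notin> {1..m} \<longrightarrow> v i = 0}"

definition table_algebra ::
  "nat \<Rightarrow> (nat \<Rightarrow> nat \<Rightarrow> nat \<Rightarrow> complex) \<Rightarrow> (nat \<Rightarrow> complex) calgebra" where
  "table_algebra m T =
     \<lparr>carr = coord_space m, smul = cscale,
      bracket = (\<lambda>x y. \<Sum>i=1..m. \<Sum>j=1..m. (x i * y j) \<cdot> T i j)\<rparr>"

lemma vector_space_cscale: "vector_space cscale"
  by unfold_locales (auto simp: cscale_def fun_eq_iff algebra_simps)

lemma table_algebra_bracket_bvec:
  assumes "i \<in> {1..m}" "j \<in> {1..m}"
  shows "bracket (table_algebra m T) (bvec i) (bvec j) = T i j"
proof -
  have "(bvec i k * bvec j l) \<cdot> T k l = (if k = i then if l = j then T i j else 0 else 0)" for k l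
    by (simp add: bvec_def cscale_def fun_eq_iff)
  then have "bracket (table_algebra m T) (bvec i) (bvec j)
      = (\<Sum>k=1..m. \<Sum>l=1..m. if k = i then if l = j then T i j else 0 else 0)"
    by (simp add: table_algebra_def)
  also have "\<dots> = (\<Sum>k=1..m. if k = i then T i j else 0)"
    using assms by (intro sum.cong refl) auto
  finally show ?thesis using assms by simp
qed


section \<open>The nilpotent algebra and its solvable extensions\<close>

definition L4_table :: "nat \<Rightarrow> nat \<Rightarrow> nat \<Rightarrow> nat \<Rightarrow> complex" where
  "L4_table n i j =
    (if i = 1 \<and> j = 1 then bvec 2
     else if 3 \<le> i \<and> i + 1 \<le> n \<and> j = 1 then bvec (i + 1)
     else if i = 1 \<and> j = 3 then 2 \<cdot> bvec 2 - bvec 4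
     else if i = 3 \<and> j = 3 then bvec 2
     else if i = 1 \<and> 4 \<le> j \<and> j + 1 \<le> n then - bvec (j + 1)
     else 0)"

definition L4 :: "nat \<Rightarrow> (nat \<Rightarrow> complex) calgebra" where
  "L4 n = table_algebra n (L4_table n)"

definition l1_table :: "nat \<Rightarrow> nat \<Rightarrow> nat \<Rightarrow> nat \<Rightarrow> complex" where
  "l1_table n i j =
    (if j = n + 1 then
       (if i = 1 then bvec 1 + bvec 3
        else if i = 3 then 2 \<cdot> bvec 3
        else if i = 4 then 3 \<cdot> (bvec 4 - bvec 2)
        else if 5 \<le> i \<and> i \<le> n then (of_nat i - 1) \<cdot> bvec i
        else 0)
     else if i = n + 1 then
       (if j = 1 then - bvec 1 - bvec 3
        else if j = 2 then (-4) \<cdot> bvec 2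
        else if j = 3 then (-2) \<cdot> bvec 3
        else if j = 4 then - bvec 2 - 3 \<cdot> bvec 4
        else if 5 \<le> j \<and> j \<le> n then (1 - of_nat j) \<cdot> bvec j
        else 0)
     else if j = n + 2 then
       (if i = 1 then bvec 1
        else if i = 3 then bvec 3
        else if i = 4 then 2 \<cdot> (bvec 4 - bvec 2)
        else if 5 \<le> i \<and> i \<le> n then (of_nat i - 2) \<cdot> bvec i
        else 0)
     else if i = n + 2 then
       (if j = 1 then - bvec 1
        else if j = 2 then (-2) \<cdot> bvec 2
        else if 3 \<le> j \<and> j \<le> n then (2 - of_nat j) \<cdot> bvec j
        else 0)
     else L4_table n i j)"

definition l1 :: "nat \<Rightarrow> (nat \<Rightarrow> complex) calgebra" where
  "l1 n = table_algebra (n + 2) (l1_table n)"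

definition l2_table :: "complex \<Rightarrow> nat \<Rightarrow> nat \<Rightarrow> nat \<Rightarrow> complex" where
  "l2_table b i j =
    (if j = 5 then
       (if i = 1 then bvec 1
        else if i = 3 then bvec 3
        else if i = 4 then 2 \<cdot> (bvec 4 - bvec 2)
        else 0)
     else if i = 5 then
       (if j = 1 then - bvec 1
        else if j = 2 then (-2) \<cdot> bvec 2
        else if j = 3 then - bvec 3
        else if j = 4 then (-2) \<cdot> bvec 4
        else 0)
     else if j = 6 then
       (if i = 1 then bvec 1 + b \<cdot> bvec 3
        else if i = 3 then bvec 1 + b \<cdot> bvec 3
        else if i = 4 then (b + 1) \<cdot> bvec 4 - (b + 1) \<cdot> bvec 2
        else 0)
     else if i = 6 then
       (if j = 1 then - bvec 1 - b \<cdot> bvec 3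
        else if j = 2 then (- 2 * (b + 1)) \<cdot> bvec 2
        else if j = 3 then - bvec 1 - b \<cdot> bvec 3
        else if j = 4 then (- (b + 1)) \<cdot> (bvec 2 + bvec 4)
        else 0)
     else L4_table 4 i j)"

definition l2 :: "complex \<Rightarrow> (nat \<Rightarrow> complex) calgebra" where
  "l2 b = table_algebra 6 (l2_table b)"

definition l3_table :: "complex \<Rightarrow> nat \<Rightarrow> nat \<Rightarrow> nat \<Rightarrow> complex" where
  "l3_table c i j =
    (if j = 5 then
       (if i = 1 then bvec 1 + (c + 1) \<cdot> bvec 3
        else if i = 3 then c \<cdot> bvec 1 + 2 \<cdot> bvec 3
        else if i = 4 then 3 \<cdot> (bvec 4 - bvec 2)
        else 0)
     else if i = 5 then
       (if j = 1 then - bvec 1 - (c + 1) \<cdot> bvec 3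
        else if j = 2 then (- 2 * (c + 2)) \<cdot> bvec 2
        else if j = 3 then (- c) \<cdot> bvec 1 - 2 \<cdot> bvec 3
        else if j = 4 then (- 2 * c - 1) \<cdot> bvec 2 - 3 \<cdot> bvec 4
        else 0)
     else if j = 6 then
       (if i = 1 then bvec 1
        else if i = 3 then bvec 3
        else if i = 4 then 2 \<cdot> (bvec 4 - bvec 2)
        else 0)
     else if i = 6 then
       (if j = 1 then - bvec 1
        else if j = 2 then (-2) \<cdot> bvec 2
        else if j = 3 then - bvec 3
        else if j = 4 then (-2) \<cdot> bvec 4
        else 0)
     else L4_table 4 i j)"

definition l3 :: "complex \<Rightarrow> (nat \<Rightarrow> complex) calgebra" where
  "l3 c = table_algebra 6 (l3_table c)"

definition l4_table :: "complex \<Rightarrow> nat \<Rightarrow> nat \<Rightarrow> nat \<Rightarrow> complex" where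
  "l4_table b i j =
    (if j = 5 then
       (if i = 1 then bvec 1
        else if i = 3 then bvec 3
        else if i = 4 then 2 \<cdot> (bvec 4 - bvec 2)
        else 0)
     else if i = 5 then
       (if j = 1 then - bvec 1
        else if j = 2 then (-2) \<cdot> bvec 2
        else if j = 3 then - bvec 3
        else if j = 4 then (-2) \<cdot> bvec 4
        else 0)
     else if j = 6 then
       (if i = 1 then b \<cdot> bvec 1 + (1 - b) \<cdot> bvec 3
        else if i = 3 then bvec 1
        else if i = 4 then b \<cdot> (bvec 4 - bvec 2)
        else 0)
     else if i = 6 then
       (if j = 1 then (- b) \<cdot> bvec 1 + (b - 1) \<cdot> bvec 3
        else if j = 2 then (-2) \<cdot> bvec 2
        else if j = 3 then - bvec 1
        else if j = 4 then (b - 2) \<cdot> bvec 2 - b \<cdot> bvec 4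
        else 0)
     else L4_table 4 i j)"

definition l4 :: "complex \<Rightarrow> (nat \<Rightarrow> complex) calgebra" where
  "l4 b = table_algebra 6 (l4_table b)"

definition nil_independent :: "(nat \<Rightarrow> complex) calgebra \<Rightarrow> bool" where
  "nil_independent A \<longleftrightarrow>
     (\<forall>\<alpha> \<beta>. (\<exists>k. \<forall>x\<in>carr (L4 4).
        ((\<lambda>v. \<alpha> \<cdot> bracket A (bvec 5) v + \<beta> \<cdot> bracket A (bvec 6) v) ^^ k) x = 0)
      \<longrightarrow> \<alpha> = 0 \<and> \<beta> = 0)"

definition l2_admissible :: "complex \<Rightarrow> bool" where
  "l2_admissible b \<longleftrightarrow> b \<noteq> -1 \<and> nil_independent (l2 b)"

definition l3_admissible :: "complex \<Rightarrow> bool" where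
  "l3_admissible c \<longleftrightarrow> c \<noteq> -2 \<and> nil_independent (l3 c)"

definition l4_admissible :: "complex \<Rightarrow> bool" where
  "l4_admissible b \<longleftrightarrow> b \<noteq> 0 \<and> nil_independent (l4 b)"

definition solvable_extension_of_L4 :: "nat \<Rightarrow> 'a::ab_group_add calgebra \<Rightarrow> bool" where
  "solvable_extension_of_L4 n A \<longleftrightarrow>
     left_leibniz_algebra A \<and> solvable_algebra A \<and> indecomposable A \<and> alg_dim A = n + 2 \<and>
     (\<exists>N. is_nilradical A N \<and> restrict_alg A N \<cong>\<^sub>L L4 n)"

end

theory Submission
  imports Defs
begin

text \<open>
  In terms of \<open>w = e\<^sub>1 - e\<^sub>3\<close>, \<open>v = e\<^sub>3\<close>, \<open>z = e\<^sub>2\<close> and \<open>f = e\<^sub>4 - e\<^sub>2\<close>, the nilpotent algebra is a filiform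
  Lie algebra generated by \<open>v\<close> and \<open>w\<close> together with the Leibniz square \<open>[v, v] = z\<close>. A derivation is
  triangular, with weights \<open>\<lambda>\<close> on \<open>v\<close> and \<open>\<nu>\<close> on \<open>w\<close> that determine the remaining ones, \<open>\<lambda> + k\<nu>\<close> and \<open>2\<lambda>\<close>.
  In an extension \<open>A\<close> with nilradical \<open>N\<close> of codimension two, solvability and the maximality of \<open>N\<close> give \<open>[A, A] \<subseteq> N\<close> and make
  \<open>(\<lambda>, \<nu>)\<close> an isomorphism from \<open>A / N\<close> onto the plane. An element \<open>t\<close> of weights \<open>(1, 3)\<close> then acts on \<open>N\<close>
  with distinct nonzero eigenvalues; its eigenvectors and its centralizer provide a basis with
  uniquely determined brackets. Hence there is only one extension for each \<open>n\<close>, and every algebra in the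
  four families is isomorphic to it, in particular \<open>l2 0\<close> for \<open>n = 4\<close>.
\<close>

section \<open>Transport of structure along isomorphisms\<close>

text \<open>Only left multiplications are derivations of a left Leibniz algebra, so right
  multiplications have to be recovered from the identity \<open>(a b + b a) y = 0\<close>. The two
  sides do differ: an element of the centralizer acts on \<open>z\<close> with weight 2\<lambda>
  from the left and by zero from the right. The weights (1, 3) are chosen for their residues modulo
  3. The chain that \<open>w\<close> generates from \<open>v\<close> has weights congruent to 1, a
  bracket of two chain members has a weight congruent to 2 that equals 2 only for
  \<open>[v, v]\<close>, and 0 never occurs. A product with unknown coefficients therefore vanishes
  as soon as its weight is not an eigenvalue, and no coefficient has to be normalized by hand. For
  \<open>n = 4\<close> the chain is too short to notice a shift of \<open>v\<close> by a multiple of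
  \<open>w\<close>. This shift and the choice of a basis of the plane of weights absorb the
  parameters \<open>b\<close> and \<open>c\<close>. Nil-independence excludes
  \<open>c = -1/2\<close> in \<open>l3\<close> and \<open>b = 2\<close> in \<open>l4\<close>, where
  the weights of the last two basis vectors become proportional.\<close>

definition alg_iso :: "('a::ab_group_add \<Rightarrow> 'b::ab_group_add) \<Rightarrow> 'a calgebra \<Rightarrow> 'b calgebra \<Rightarrow> bool" where
  "alg_iso f A B \<longleftrightarrow> bij_betw f (carr A) (carr B) \<and>
     (\<forall>x\<in>carr A. \<forall>y\<in>carr A. f (x + y) = f x + f y) \<and>
     (\<forall>c. \<forall>x\<in>carr A. f (smul A c x) = smul B c (f x)) \<and>
     (\<forall>x\<in>carr A. \<forall>y\<in>carr A. f (bracket A x y) = bracket B (f x) (f y))"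

lemma isomorphic_iff_alg_iso: "A \<cong>\<^sub>L B \<longleftrightarrow> (\<exists>f. alg_iso f A B)"
  unfolding isomorphic_def alg_iso_def by simp

lemma restrict_alg_simps [simp]:
  "carr (restrict_alg A I) = I" "smul (restrict_alg A I) = smul A"
  "bracket (restrict_alg A I) = bracket A"
  by (simp_all add: restrict_alg_def)

section \<open>Bilinearity, series and ideals of an algebra\<close>

context fd_algebra
begin

lemma carr_zero: "0 \<in> carr A"
  using subspace_carr subspace_0 by blast

lemma carr_add: "x \<in> carr A \<Longrightarrow> y \<in> carr A \<Longrightarrow> x + y \<in> carr A"
  using subspace_carr subspace_add by blast

lemma carr_smul: "x \<in> carr A \<Longrightarrow> smul A c x \<in> carr A"
  using subspace_carr subspace_scale by blast

lemma carr_uminus: "x \<in> carr A \<Longrightarrow> - x \<in> carr A"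
  using subspace_carr subspace_neg by blast

lemma carr_diff: "x \<in> carr A \<Longrightarrow> y \<in> carr A \<Longrightarrow> x - y \<in> carr A"
  using subspace_carr subspace_diff by blast

lemma bracket_zero_left: "y \<in> carr A \<Longrightarrow> bracket A 0 y = 0"
  using bracket_smul_left[of 0 y 0] carr_zero by simp

lemma bracket_zero_right: "y \<in> carr A \<Longrightarrow> bracket A y 0 = 0"
  using bracket_smul_right[of y 0 0] carr_zero by simp

lemma bracket_uminus_left: "x \<in> carr A \<Longrightarrow> y \<in> carr A \<Longrightarrow> bracket A (- x) y = - bracket A x y"
  using bracket_smul_left[of x y "-1"] by simp

lemma bracket_uminus_right: "x \<in> carr A \<Longrightarrow> y \<in> carr A \<Longrightarrow> bracket A x (- y) = - bracket A x y"
  using bracket_smul_right[of x y "-1"] by simp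

lemma bracket_diff_left: "x \<in> carr A \<Longrightarrow> y \<in> carr A \<Longrightarrow> z \<in> carr A \<Longrightarrow>
    bracket A (x - y) z = bracket A x z - bracket A y z"
  using bracket_add_left[of x "-y" z] by (simp add: bracket_uminus_left carr_uminus)

lemma bracket_diff_right: "x \<in> carr A \<Longrightarrow> y \<in> carr A \<Longrightarrow> z \<in> carr A \<Longrightarrow>
    bracket A x (y - z) = bracket A x y - bracket A x z"
  using bracket_add_right[of x y "-z"] by (simp add: bracket_uminus_right carr_uminus)

lemma bracket_span_subset:
  assumes "subspace U" "\<And>x y. x \<in> S \<Longrightarrow> y \<in> T \<Longrightarrow> bracket A x y \<in> U"
  shows "bracket_span A S T \<subseteq> U"
  unfolding bracket_span_def by (rule span_minimal) (use assms in auto)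

lemma bracket_span_subset_carr:
  assumes "S \<subseteq> carr A" "T \<subseteq> carr A"
  shows "bracket_span A S T \<subseteq> carr A"
  by (rule bracket_span_subset) (use assms subspace_carr bracket_closed in auto)

lemma bracket_in_span: "x \<in> S \<Longrightarrow> y \<in> T \<Longrightarrow> bracket A x y \<in> bracket_span A S T"
  unfolding bracket_span_def by (rule span_base) auto

lemma subspace_bracket_span: "subspace (bracket_span A S T)"
  unfolding bracket_span_def by simp

lemma derived_series_subset_carr: "derived_series A k \<subseteq> carr A"
  by (induction k) (simp_all add: bracket_span_subset_carr)

lemma lower_central_subset_carr: "lower_central A k \<subseteq> carr A"
  by (induction k) (simp_all add: bracket_span_subset_carr)

lemma subspace_derived_series: "subspace (derived_series A k)"
  by (cases k) (simp_all add: subspace_carr subspace_bracket_span)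

lemma subspace_lower_central: "subspace (lower_central A k)"
  by (cases k) (simp_all add: subspace_carr subspace_bracket_span)

lemma ideal_fd_algebra:
  assumes "ideal A I"
  shows "fd_algebra (restrict_alg A I)"
proof -
  have I: "subspace I" "I \<subseteq> carr A" "\<And>x y. x \<in> I \<Longrightarrow> y \<in> I \<Longrightarrow> bracket A x y \<in> I"
    using assms unfolding ideal_def by auto
  show ?thesis
  proof unfold_locales
    show "\<exists>B. finite B \<and> carr (restrict_alg A I) \<subseteq> module.span (smul (restrict_alg A I)) B"
      using I(2) finite_dim by (simp, blast)
  qed (use I in \<open>simp_all add: subset_iff scale_right_distrib scale_left_distrib bracket_add_left
      bracket_add_right bracket_smul_left bracket_smul_right\<close>)
qed

lemma nilpotent_idealI:
  assumes "ideal A I" "lower_central (restrict_alg A I) k \<subseteq> {0}"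
  shows "nilpotent_ideal A I"
proof -
  interpret R: fd_algebra "restrict_alg A I" using assms(1) by (rule ideal_fd_algebra)
  have "0 \<in> lower_central (restrict_alg A I) k"
    using R.subspace_lower_central R.subspace_0 by blast
  then show ?thesis
    using assms unfolding nilpotent_ideal_def nilpotent_algebra_def by blast
qed

end

lemma alg_iso_sym:
  assumes "fd_algebra A" "fd_algebra B" "alg_iso f A B"
  shows "alg_iso (the_inv_into (carr A) f) B A"
proof -
  interpret A: fd_algebra A by fact
  interpret B: fd_algebra B by fact
  let ?g = "the_inv_into (carr A) f"
  have bij: "bij_betw f (carr A) (carr B)" using assms(3) by (simp add: alg_iso_def)
  then have inj: "inj_on f (carr A)" and im: "f ` carr A = carr B" by (auto simp: bij_betw_def)
  have gf: "?g (f x) = x" if "x \<in> carr A" for x using inj that by (rule the_inv_into_f_f)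
  have ex: "\<exists>x\<in>carr A. y = f x" if "y \<in> carr B" for y using im that by auto
  have hom: "f (x + y) = f x + f y" "f (smul A c x) = smul B c (f x)"
    "f (bracket A x y) = bracket B (f x) (f y)" if "x \<in> carr A" "y \<in> carr A" for x y c
    using assms(3) that unfolding alg_iso_def by auto
  show ?thesis unfolding alg_iso_def
  proof (intro conjI ballI allI)
    show "bij_betw ?g (carr B) (carr A)" using bij by (rule bij_betw_the_inv_into)
  next
    fix x y assume "x \<in> carr B" "y \<in> carr B"
    then obtain a b where "a \<in> carr A" "b \<in> carr A" "x = f a" "y = f b" using ex by blast
    then show "?g (x + y) = ?g x + ?g y"
      by (metis gf hom(1) A.carr_add)
  next
    fix c x assume "x \<in> carr B"
    then obtain a where "a \<in> carr A" "x = f a" using ex by blast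
    then show "?g (smul B c x) = smul A c (?g x)" by (metis gf hom(2) A.carr_smul)
  next
    fix x y assume "x \<in> carr B" "y \<in> carr B"
    then obtain a b where "a \<in> carr A" "b \<in> carr A" "x = f a" "y = f b" using ex by blast
    then show "?g (bracket B x y) = bracket A (?g x) (?g y)"
      by (metis gf hom(3) A.bracket_closed)
  qed
qed

lemma alg_iso_trans:
  assumes "alg_iso f A B" "alg_iso g B C"
  shows "alg_iso (g \<circ> f) A C"
proof -
  have "f x \<in> carr B" if "x \<in> carr A" for x
    using assms(1) that by (auto simp: alg_iso_def bij_betw_def)
  then show ?thesis
    using assms bij_betw_trans[of f "carr A" "carr B" g "carr C"] by (auto simp: alg_iso_def)
qed

lemma isomorphic_sym:
  "fd_algebra A \<Longrightarrow> fd_algebra B \<Longrightarrow> A \<cong>\<^sub>L B \<Longrightarrow> B \<cong>\<^sub>L A"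
  unfolding isomorphic_iff_alg_iso using alg_iso_sym by blast

lemma isomorphic_trans: "A \<cong>\<^sub>L B \<Longrightarrow> B \<cong>\<^sub>L C \<Longrightarrow> A \<cong>\<^sub>L C"
  unfolding isomorphic_iff_alg_iso using alg_iso_trans by blast

section \<open>Invariance of the structural properties under isomorphism\<close>

locale algebra_iso = A: fd_algebra A + B: fd_algebra B
  for A :: "'a::ab_group_add calgebra" and B :: "'b::ab_group_add calgebra" +
  fixes f :: "'a \<Rightarrow> 'b"
  assumes iso: "alg_iso f A B"
begin

lemma bij: "bij_betw f (carr A) (carr B)"
  and f_add: "x \<in> carr A \<Longrightarrow> y \<in> carr A \<Longrightarrow> f (x + y) = f x + f y"
  and f_smul: "x \<in> carr A \<Longrightarrow> f (smul A c x) = smul B c (f x)"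
  and f_bracket: "x \<in> carr A \<Longrightarrow> y \<in> carr A \<Longrightarrow> f (bracket A x y) = bracket B (f x) (f y)"
  using iso unfolding alg_iso_def by auto

lemma f_carr: "x \<in> carr A \<Longrightarrow> f x \<in> carr B"
  using bij by (auto simp: bij_betw_def)

lemma image_carr: "f ` carr A = carr B"
  using bij by (auto simp: bij_betw_def)

lemma f_inj: "x \<in> carr A \<Longrightarrow> y \<in> carr A \<Longrightarrow> f x = f y \<Longrightarrow> x = y"
  using bij by (auto simp: bij_betw_def inj_on_def)

lemma f_zero: "f 0 = 0"
  using f_add[of 0 0] A.carr_zero by simp

lemma f_diff: "x \<in> carr A \<Longrightarrow> y \<in> carr A \<Longrightarrow> f (x - y) = f x - f y"
  using f_add[of "x - y" y] A.carr_diff by simp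

lemma subspace_image:
  assumes "A.subspace S" "S \<subseteq> carr A"
  shows "B.subspace (f ` S)"
proof (rule B.subspaceI)
  have "f 0 \<in> f ` S" using A.subspace_0[OF assms(1)] by (rule imageI)
  then show "0 \<in> f ` S" by (simp add: f_zero)
next
  fix x y assume "x \<in> f ` S" "y \<in> f ` S"
  then obtain a b where ab: "a \<in> S" "b \<in> S" "x = f a" "y = f b" by auto
  then have "f (a + b) \<in> f ` S" using A.subspace_add[OF assms(1)] by blast
  then show "x + y \<in> f ` S" using ab assms(2) by (simp add: f_add subset_iff)
next
  fix c x assume "x \<in> f ` S"
  then obtain a where a: "a \<in> S" "x = f a" by auto
  then have "f (smul A c a) \<in> f ` S" using A.subspace_scale[OF assms(1)] by blast
  then show "smul B c x \<in> f ` S" using a assms(2) by (simp add: f_smul subset_iff)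
qed

lemma image_span:
  assumes "S \<subseteq> carr A"
  shows "f ` A.span S = B.span (f ` S)"
proof
  have sub: "A.span S \<subseteq> carr A" using assms A.subspace_carr by (rule A.span_minimal)
  show "B.span (f ` S) \<subseteq> f ` A.span S"
  proof (rule B.span_minimal)
    show "f ` S \<subseteq> f ` A.span S" using A.span_superset by (rule image_mono)
  qed (simp add: subspace_image sub)
  have "f x \<in> B.span (f ` S)" if "x \<in> A.span S" for x
  proof -
    have "x \<in> carr A \<and> f x \<in> B.span (f ` S)"
      using that
    proof (induction rule: A.span_induct_alt)
      case base
      then show ?case using A.carr_zero f_zero B.span_zero by simp
    next
      case (step c y z)
      moreover have "y \<in> carr A" using step assms by auto
      ultimately show ?case
        by (simp add: f_add f_smul A.carr_add A.carr_smul B.span_add B.span_scale B.span_base)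
    qed
    then show ?thesis by simp
  qed
  then show "f ` A.span S \<subseteq> B.span (f ` S)" by auto
qed

lemma image_bracket_span:
  assumes "S \<subseteq> carr A" "T \<subseteq> carr A"
  shows "f ` bracket_span A S T = bracket_span B (f ` S) (f ` T)"
proof -
  have "f ` {bracket A x y | x y. x \<in> S \<and> y \<in> T} = {bracket B x y | x y. x \<in> f ` S \<and> y \<in> f ` T}"
  proof (intro set_eqI iffI)
    fix u assume "u \<in> f ` {bracket A x y | x y. x \<in> S \<and> y \<in> T}"
    then obtain x y where "x \<in> S" "y \<in> T" "u = f (bracket A x y)" by blast
    moreover from this have "u = bracket B (f x) (f y)" using assms f_bracket by (simp add: subset_iff)
    ultimately show "u \<in> {bracket B x y | x y. x \<in> f ` S \<and> y \<in> f ` T}" by blast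
  next
    fix u assume "u \<in> {bracket B x y | x y. x \<in> f ` S \<and> y \<in> f ` T}"
    then obtain x y where "x \<in> S" "y \<in> T" "u = bracket B (f x) (f y)" by blast
    moreover from this have "u = f (bracket A x y)" using assms f_bracket by (simp add: subset_iff)
    ultimately show "u \<in> f ` {bracket A x y | x y. x \<in> S \<and> y \<in> T}" by blast
  qed
  moreover have "{bracket A x y | x y. x \<in> S \<and> y \<in> T} \<subseteq> carr A"
    using assms A.bracket_closed by auto
  ultimately show ?thesis unfolding bracket_span_def using image_span by simp
qed

lemma image_derived_series: "f ` derived_series A k = derived_series B k"
  by (induction k) (simp_all add: image_carr image_bracket_span A.derived_series_subset_carr)

lemma image_lower_central: "f ` lower_central A k = lower_central B k"
  by (induction k) (simp_all add: image_carr image_bracket_span A.lower_central_subset_carr)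

lemma solvable_transfer: "solvable_algebra A \<Longrightarrow> solvable_algebra B"
  unfolding solvable_algebra_def image_derived_series[symmetric] by (force simp: f_zero)

lemma nilpotent_transfer: "nilpotent_algebra A \<Longrightarrow> nilpotent_algebra B"
  unfolding nilpotent_algebra_def image_lower_central[symmetric] by (force simp: f_zero)

lemma left_leibniz_transfer:
  assumes "left_leibniz_algebra A"
  shows "left_leibniz_algebra B"
proof unfold_locales
  interpret L: left_leibniz_algebra A by fact
  fix x y z assume "x \<in> carr B" "y \<in> carr B" "z \<in> carr B"
  then obtain a b c where abc: "a \<in> carr A" "b \<in> carr A" "c \<in> carr A" "x = f a" "y = f b" "z = f c"
    using image_carr by blast
  have "f (bracket A (bracket A a b) c) = f (bracket A a (bracket A b c) - bracket A b (bracket A a c))"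
    using L.left_leibniz[OF abc(1-3)] by simp
  then show "bracket B (bracket B x y) z = bracket B x (bracket B y z) - bracket B y (bracket B x z)"
    using abc by (simp add: f_diff f_bracket A.bracket_closed)
qed

lemma ideal_image:
  assumes "ideal A I"
  shows "ideal B (f ` I)"
proof -
  have I: "A.subspace I" "I \<subseteq> carr A" using assms unfolding ideal_def by auto
  have "bracket B x y \<in> f ` I \<and> bracket B y x \<in> f ` I" if "x \<in> carr B" "y \<in> f ` I" for x y
  proof -
    obtain a b where ab: "a \<in> carr A" "b \<in> I" "x = f a" "y = f b"
      using \<open>x \<in> carr B\<close> \<open>y \<in> f ` I\<close> image_carr by blast
    then have "bracket A a b \<in> I" "bracket A b a \<in> I" using assms unfolding ideal_def by auto
    then have "f (bracket A a b) \<in> f ` I" "f (bracket A b a) \<in> f ` I" by blast+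
    then show ?thesis using ab I by (simp add: f_bracket subset_iff)
  qed
  then show ?thesis unfolding ideal_def using I subspace_image f_carr by auto
qed

lemma restrict_iso:
  assumes "ideal A I"
  shows "alg_iso f (restrict_alg A I) (restrict_alg B (f ` I))"
proof -
  have I: "A.subspace I" "I \<subseteq> carr A" using assms unfolding ideal_def by auto
  then have "inj_on f I" using bij inj_on_subset by (auto simp: bij_betw_def)
  then show ?thesis using I(2) f_add f_smul f_bracket by (simp add: alg_iso_def bij_betw_def subset_iff)
qed

lemma nilpotent_ideal_image:
  assumes "nilpotent_ideal A I"
  shows "nilpotent_ideal B (f ` I)"
proof -
  have I: "ideal A I" using assms by (simp add: nilpotent_ideal_def)
  have "algebra_iso (restrict_alg A I) (restrict_alg B (f ` I)) f"
    by (rule algebra_iso.intro[OF A.ideal_fd_algebra[OF I] B.ideal_fd_algebra[OF ideal_image[OF I]]])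
      (rule algebra_iso_axioms.intro[OF restrict_iso[OF I]])
  then have "nilpotent_algebra (restrict_alg B (f ` I))"
    using assms algebra_iso.nilpotent_transfer unfolding nilpotent_ideal_def by blast
  then show ?thesis
    using ideal_image[OF I] unfolding nilpotent_ideal_def by blast
qed

lemma independent_image:
  assumes S: "S \<subseteq> carr A" and ind: "A.independent S"
  shows "B.independent (f ` S)"
proof
  assume "B.dependent (f ` S)"
  then obtain y where y: "y \<in> f ` S" "y \<in> B.span (f ` S - {y})" unfolding B.dependent_def by blast
  then obtain x where x: "x \<in> S" "y = f x" by auto
  have "inj_on f S" using bij S inj_on_subset by (auto simp: bij_betw_def)
  then have "f ` S - {y} = f ` (S - {x})" using x by (auto simp: inj_on_def)
  moreover have "f ` A.span (S - {x}) = B.span (f ` (S - {x}))"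
    by (rule image_span) (use S in blast)
  ultimately have "f x \<in> f ` A.span (S - {x})" using y(2) x(2) by simp
  then obtain z where z: "z \<in> A.span (S - {x})" "f x = f z" by blast
  have "A.span (S - {x}) \<subseteq> carr A" using S A.subspace_carr by (intro A.span_minimal) auto
  then have "x = z" using f_inj[of x z] S x(1) z by blast
  then have "x \<in> A.span (S - {x})" using z by simp
  then show False using ind x A.dependent_def by blast
qed

lemma dim_transfer: "alg_dim B = alg_dim A"
proof -
  obtain S where S: "S \<subseteq> carr A" "A.independent S" "carr A \<subseteq> A.span S" "card S = A.dim (carr A)"
    using A.basis_exists by blast
  have spanS: "A.span S = carr A" using S A.subspace_carr A.span_minimal by blast
  have "B.span (f ` S) = carr B" using image_span[OF S(1)] spanS image_carr by simp
  then have "B.dim (carr B) = card (f ` S)"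
    using B.dim_span_eq_card_independent[OF independent_image[OF S(1,2)]] by simp
  also have "\<dots> = card S" using bij S(1) inj_on_subset by (intro card_image) (auto simp: bij_betw_def)
  finally show ?thesis using S(4) by (simp add: alg_dim_def)
qed

text \<open>Maximality, uniqueness of the nilradical and indecomposability quantify over ideals of
  \<open>B\<close>; the inverse pulls such ideals back to \<open>A\<close>, where the hypothesis
  applies.\<close>

lemma inverse_iso: "algebra_iso B A (the_inv_into (carr A) f)"
  by (rule algebra_iso.intro[OF B.fd_algebra_axioms A.fd_algebra_axioms])
    (rule algebra_iso_axioms.intro[OF alg_iso_sym[OF A.fd_algebra_axioms B.fd_algebra_axioms iso]])

lemma image_inv_image:
  assumes "I \<subseteq> carr A"
  shows "the_inv_into (carr A) f ` f ` I = I"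
proof -
  have "the_inv_into (carr A) f (f x) = x" if "x \<in> I" for x
    using bij assms that by (auto simp: bij_betw_def intro: the_inv_into_f_f)
  then show ?thesis by (force simp: image_image)
qed

lemma inv_image_image:
  assumes "I \<subseteq> carr B"
  shows "f ` the_inv_into (carr A) f ` I = I"
proof -
  have "f (the_inv_into (carr A) f x) = x" if "x \<in> I" for x
    by (rule f_the_inv_into_f_bij_betw[OF bij]) (use assms that in blast)
  then show ?thesis by (force simp: image_image)
qed

lemma maximal_nilpotent_ideal_image:
  assumes "maximal_nilpotent_ideal A I"
  shows "maximal_nilpotent_ideal B (f ` I)"
proof -
  interpret g: algebra_iso B A "the_inv_into (carr A) f" by (rule inverse_iso)
  have I: "nilpotent_ideal A I" "I \<subseteq> carr A"
    using assms unfolding maximal_nilpotent_ideal_def nilpotent_ideal_def ideal_def by auto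
  have "J = f ` I" if J: "nilpotent_ideal B J" "f ` I \<subseteq> J" for J
  proof -
    have "J \<subseteq> carr B" using J unfolding nilpotent_ideal_def ideal_def by auto
    have "I \<subseteq> the_inv_into (carr A) f ` J"
      using image_mono[OF J(2), of "the_inv_into (carr A) f"] image_inv_image[OF I(2)] by simp
    then have "the_inv_into (carr A) f ` J = I"
      using assms g.nilpotent_ideal_image[OF J(1)] unfolding maximal_nilpotent_ideal_def by blast
    then show ?thesis using inv_image_image[OF \<open>J \<subseteq> carr B\<close>] by simp
  qed
  then show ?thesis unfolding maximal_nilpotent_ideal_def using nilpotent_ideal_image[OF I(1)] by blast
qed

lemma nilradical_image:
  assumes "is_nilradical A I"
  shows "is_nilradical B (f ` I)"
proof -
  interpret g: algebra_iso B A "the_inv_into (carr A) f" by (rule inverse_iso)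
  have "M = f ` I" if M: "maximal_nilpotent_ideal B M" for M
  proof -
    have "M \<subseteq> carr B" using M unfolding maximal_nilpotent_ideal_def nilpotent_ideal_def ideal_def by auto
    moreover have "the_inv_into (carr A) f ` M = I"
      using g.maximal_nilpotent_ideal_image[OF M] assms unfolding is_nilradical_def by blast
    ultimately show ?thesis using inv_image_image[of M] by simp
  qed
  then show ?thesis
    using assms maximal_nilpotent_ideal_image unfolding is_nilradical_def by blast
qed

lemma indecomposable_transfer:
  assumes "indecomposable A"
  shows "indecomposable B"
  unfolding indecomposable_def
proof (rule notI, elim exE conjE)
  fix I J assume IJ: "ideal B I" "ideal B J" "I \<noteq> {0}" "J \<noteq> {0}" "I \<inter> J = {0}"
    "carr B = {x + y |x y. x \<in> I \<and> y \<in> J}"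
  interpret g: algebra_iso B A "the_inv_into (carr A) f" by (rule inverse_iso)
  let ?g = "the_inv_into (carr A) f"
  have sub: "I \<subseteq> carr B" "J \<subseteq> carr B" using IJ unfolding ideal_def by auto
  have "?g ` I \<noteq> {0}" "?g ` J \<noteq> {0}"
    using IJ(3,4) inv_image_image[OF sub(1)] inv_image_image[OF sub(2)] f_zero by auto
  moreover have "?g ` I \<inter> ?g ` J = {0}"
  proof -
    have "inj_on ?g (carr B)" using g.bij by (simp add: bij_betw_def)
    then have "?g ` I \<inter> ?g ` J = ?g ` (I \<inter> J)" using sub by (simp add: inj_on_image_Int)
    then show ?thesis using IJ(5) g.f_zero by simp
  qed
  moreover have "carr A = {x + y |x y. x \<in> ?g ` I \<and> y \<in> ?g ` J}"
  proof -
    have add: "?g (x + y) = ?g x + ?g y" if "x \<in> I" "y \<in> J" for x y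
      using g.f_add sub that by (simp add: subset_iff)
    show ?thesis
    proof (intro set_eqI iffI)
      fix u assume "u \<in> carr A"
      then obtain v where v: "v \<in> carr B" "u = ?g v" using g.image_carr by blast
      then obtain x y where "x \<in> I" "y \<in> J" "v = x + y" using IJ(6) by blast
      then show "u \<in> {x + y |x y. x \<in> ?g ` I \<and> y \<in> ?g ` J}" using add v by blast
    next
      fix u assume "u \<in> {x + y |x y. x \<in> ?g ` I \<and> y \<in> ?g ` J}"
      then obtain x y where xy: "x \<in> I" "y \<in> J" "u = ?g x + ?g y" by blast
      then have "?g x \<in> carr A" "?g y \<in> carr A" using sub g.f_carr by (simp_all add: subset_iff)
      then show "u \<in> carr A" using xy A.carr_add by simp
    qed
  qed
  ultimately show False
    using assms g.ideal_image[OF IJ(1)] g.ideal_image[OF IJ(2)] unfolding indecomposable_def by blast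
qed

end

text \<open>Each defining property is invariant under isomorphism, so all of them are verified in a
  single model, \<open>canon_ext n\<close>, and carried over to the four families.\<close>

lemma solvable_extension_transfer:
  assumes "solvable_extension_of_L4 n A" "fd_algebra B" "fd_algebra (L4 n)" "A \<cong>\<^sub>L B"
  shows "solvable_extension_of_L4 n B"
proof -
  have A: "left_leibniz_algebra A" using assms(1) by (simp add: solvable_extension_of_L4_def)
  then interpret A: left_leibniz_algebra A .
  obtain f where f: "alg_iso f A B" using assms(4) isomorphic_iff_alg_iso by blast
  interpret algebra_iso A B f
    by (rule algebra_iso.intro[OF A.fd_algebra_axioms assms(2)]) (rule algebra_iso_axioms.intro[OF f])
  obtain N where N: "is_nilradical A N" "restrict_alg A N \<cong>\<^sub>L L4 n"
    using assms(1) unfolding solvable_extension_of_L4_def by blast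
  have I: "ideal A N"
    using N(1) unfolding is_nilradical_def maximal_nilpotent_ideal_def nilpotent_ideal_def by blast
  have "restrict_alg A N \<cong>\<^sub>L restrict_alg B (f ` N)"
    using restrict_iso[OF I] isomorphic_iff_alg_iso by blast
  then have "restrict_alg B (f ` N) \<cong>\<^sub>L L4 n"
    using isomorphic_sym isomorphic_trans N(2) A.ideal_fd_algebra[OF I]
      B.ideal_fd_algebra[OF ideal_image[OF I]] by blast
  then show ?thesis
    using assms(1) nilradical_image[OF N(1)] left_leibniz_transfer solvable_transfer
      indecomposable_transfer dim_transfer
    unfolding solvable_extension_of_L4_def by auto
qed

section \<open>The canonical extension\<close>

text \<open>
  Coordinate 1 belongs to \<open>w\<close>, 2 to \<open>z\<close>, 3 to \<open>v\<close> and \<open>k \<ge> 4\<close> to the iterated brackets \<open>[[v, w], \<dots>, w]\<close>. The last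
  two basis vectors have the weights \<open>(\<lambda>, \<nu>) = (0, 1)\<close> and \<open>(1, 0)\<close>.
\<close>

definition canon_br :: "nat \<Rightarrow> (nat \<Rightarrow> complex) \<Rightarrow> (nat \<Rightarrow> complex) \<Rightarrow> nat \<Rightarrow> complex" where
  "canon_br n x y k =
    (if k = 1 then x (n + 1) * y 1 - x 1 * y (n + 1)
     else if k = 2 then x 3 * y 3 + 2 * x (n + 2) * y 2
     else if 3 \<le> k \<and> k \<le> n then
       (if 4 \<le> k then x (k - 1) * y 1 - x 1 * y (k - 1) else 0)
       + of_nat (k - 3) * (x (n + 1) * y k - x k * y (n + 1))
       + (x (n + 2) * y k - x k * y (n + 2))
     else 0)"

definition canon_ext :: "nat \<Rightarrow> (nat \<Rightarrow> complex) calgebra" where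
  "canon_ext n = \<lparr>carr = coord_space (n + 2), smul = cscale, bracket = canon_br n\<rparr>"

lemma canon_ext_simps [simp]:
  "carr (canon_ext n) = coord_space (n + 2)" "smul (canon_ext n) = cscale" "bracket (canon_ext n) = canon_br n"
  by (simp_all add: canon_ext_def)

section \<open>Coordinate spaces and algebras given by tables\<close>

interpretation cs: vector_space cscale by (rule vector_space_cscale)

lemma cscale_apply [simp]: "(c \<cdot> v) i = c * v i"
  by (simp add: cscale_def)

lemma coord_spaceD: "x \<in> coord_space m \<Longrightarrow> i = 0 \<or> m < i \<Longrightarrow> x i = 0"
  by (auto simp: coord_space_def)

lemma coord_spaceI: "(\<And>i. i = 0 \<or> m < i \<Longrightarrow> x i = 0) \<Longrightarrow> x \<in> coord_space m"
proof -
  assume x: "\<And>i. i = 0 \<or> m < i \<Longrightarrow> x i = 0"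
  have "x i = 0" if "i \<notin> {1..m}" for i using that by (intro x) (simp, linarith)
  then show ?thesis by (simp add: coord_space_def)
qed

lemma bvec_in_coord_space: "i \<in> {1..m} \<Longrightarrow> bvec i \<in> coord_space m"
  by (auto simp: coord_space_def bvec_def)

lemma subspace_coord_space: "cs.subspace (coord_space m)"
  by (rule cs.subspaceI) (auto simp: coord_space_def)

lemma coord_space_zero: "0 \<in> coord_space m" by (simp add: coord_space_def)

lemma coord_space_add: "x \<in> coord_space m \<Longrightarrow> y \<in> coord_space m \<Longrightarrow> x + y \<in> coord_space m"
  by (simp add: coord_space_def)

lemma coord_space_diff: "x \<in> coord_space m \<Longrightarrow> y \<in> coord_space m \<Longrightarrow> x - y \<in> coord_space m"
  by (simp add: coord_space_def)

lemma coord_space_uminus: "x \<in> coord_space m \<Longrightarrow> - x \<in> coord_space m"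
  by (simp add: coord_space_def)

lemma coord_space_cscale: "x \<in> coord_space m \<Longrightarrow> c \<cdot> x \<in> coord_space m"
  by (simp add: coord_space_def)

lemma coord_space_mono: "m \<le> k \<Longrightarrow> coord_space m \<subseteq> coord_space k"
  by (auto simp: coord_space_def)

lemma coord_space_trunc:
  assumes "x (n + 1) = 0" "x (n + 2) = 0" "x \<in> coord_space (n + 2)"
  shows "x \<in> coord_space n"
proof (rule coord_spaceI)
  fix i assume "i = 0 \<or> n < i"
  then consider "i = n + 1" | "i = n + 2" | "i = 0 \<or> n + 2 < i" by linarith
  then show "x i = 0" using assms(1,2) coord_spaceD[OF assms(3)] by cases auto
qed

lemma sum_fun_apply: "sum g I i = (\<Sum>j\<in>I. g j i)" for g :: "'c \<Rightarrow> nat \<Rightarrow> complex"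
  by (induction I rule: infinite_finite_induct) auto

lemma coord_space_expand:
  assumes "x \<in> coord_space m"
  shows "x = (\<Sum>i=1..m. x i \<cdot> bvec i)"
proof
  fix j
  have "(\<Sum>i=1..m. x i \<cdot> bvec i) j = (\<Sum>i=1..m. if i = j then x j else 0)"
    unfolding sum_fun_apply by (rule sum.cong) (auto simp: bvec_def)
  then show "x j = (\<Sum>i=1..m. x i \<cdot> bvec i) j"
    using assms by (auto simp: coord_space_def)
qed

lemma coord_space_eq_span: "coord_space m = cs.span (bvec ` {1..m})"
proof
  show "cs.span (bvec ` {1..m}) \<subseteq> coord_space m"
    using bvec_in_coord_space subspace_coord_space by (intro cs.span_minimal) auto
  show "coord_space m \<subseteq> cs.span (bvec ` {1..m})"
  proof
    fix x assume "x \<in> coord_space m"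
    moreover have "(\<Sum>i=1..m. x i \<cdot> bvec i) \<in> cs.span (bvec ` {1..m})"
      by (intro cs.span_sum cs.span_scale cs.span_base imageI)
    ultimately show "x \<in> cs.span (bvec ` {1..m})" using coord_space_expand[of x m] by simp
  qed
qed

lemma inj_bvec: "inj_on bvec S"
  by (rule inj_onI) (metis bvec_def zero_neq_one)

lemma independent_bvec: "cs.independent (bvec ` {1..m})"
proof
  assume "cs.dependent (bvec ` {1..m})"
  then obtain i where i: "i \<in> {1..m}" "bvec i \<in> cs.span (bvec ` {1..m} - {bvec i})"
    unfolding cs.dependent_def by auto
  have "cs.span (bvec ` {1..m} - {bvec i}) \<subseteq> {x. x i = 0}"
    by (rule cs.span_minimal) (auto simp: bvec_def cs.subspace_def)
  then show False using i(2) by (auto simp: bvec_def)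
qed

lemma dim_coord_space: "cs.dim (coord_space m) = m"
  using cs.dim_span_eq_card_independent[OF independent_bvec] card_image[OF inj_bvec]
  by (simp add: coord_space_eq_span)

lemma coord_space_finite_dim: "\<exists>B. finite B \<and> coord_space m \<subseteq> cs.span B"
  using coord_space_eq_span by (intro exI[of _ "bvec ` {1..m}"]) auto

lemma fd_algebra_table_algebra:
  assumes "\<And>i j. i \<in> {1..m} \<Longrightarrow> j \<in> {1..m} \<Longrightarrow> T i j \<in> coord_space m"
  shows "fd_algebra (table_algebra m T)"
proof (unfold_locales, goal_cases)
  case 7
  then show ?case using assms unfolding table_algebra_def
    by (auto intro!: cs.subspace_sum[OF subspace_coord_space] coord_space_cscale)
qed (auto simp: table_algebra_def fun_eq_iff sum_fun_apply algebra_simps sum.distrib sum_distrib_left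
    subspace_coord_space coord_space_finite_dim)

section \<open>The Leibniz identity of the canonical bracket\<close>

lemma canon_br_eqs:
  "canon_br n x y (Suc 0) = x (n + 1) * y 1 - x 1 * y (n + 1)"
  "canon_br n x y 2 = x 3 * y 3 + 2 * x (n + 2) * y 2"
  "3 \<le> n \<Longrightarrow> canon_br n x y 3 = x (n + 2) * y 3 - x 3 * y (n + 2)"
  "4 \<le> k \<Longrightarrow> k \<le> n \<Longrightarrow> canon_br n x y k = x (k - 1) * y 1 - x 1 * y (k - 1)
    + of_nat (k - 3) * (x (n + 1) * y k - x k * y (n + 1)) + (x (n + 2) * y k - x k * y (n + 2))"
  "n < k \<Longrightarrow> 2 \<le> n \<Longrightarrow> canon_br n x y k = 0"
  "canon_br n x y 0 = 0"
  by (auto simp: canon_br_def)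

lemma canon_br_in_coord_space: "2 \<le> n \<Longrightarrow> canon_br n x y \<in> coord_space n"
  by (rule coord_spaceI) (auto simp: canon_br_def)

lemma canon_br_bilinear:
  "canon_br n (x + y) z = canon_br n x z + canon_br n y z"
  "canon_br n x (y + z) = canon_br n x y + canon_br n x z"
  "canon_br n (c \<cdot> x) y = c \<cdot> canon_br n x y"
  "canon_br n x (c \<cdot> y) = c \<cdot> canon_br n x y"
  by (auto simp: canon_br_def fun_eq_iff algebra_simps)

lemma fd_algebra_canon_ext:
  assumes "2 \<le> n"
  shows "fd_algebra (canon_ext n)"
proof (unfold_locales, goal_cases)
  case 7
  then show ?case using canon_br_in_coord_space[OF assms] coord_space_mono[of n "n + 2"] by auto
qed (auto simp: subspace_coord_space[simplified] coord_space_finite_dim[simplified] canon_br_bilinear fun_eq_iff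
   algebra_simps)

text \<open>A polynomial identity in each coordinate. Coordinate \<open>k\<close> of a double
  bracket reaches down to \<open>k - 2\<close>, so the uniform formula starts at 5; coordinates 3
  and 4, at the bottom of the chain, are separate cases.\<close>

lemma canon_br_left_leibniz:
  assumes "4 \<le> n"
  shows "canon_br n (canon_br n x y) z = canon_br n x (canon_br n y z) - canon_br n y (canon_br n x z)"
proof
  fix k
  consider "k = 0" | "n < k" | "k = 1" | "k = 2" | "k = 3" | "k = 4" | "5 \<le> k" "k \<le> n" by linarith
  then show "canon_br n (canon_br n x y) z k = (canon_br n x (canon_br n y z) - canon_br n y (canon_br n x z)) k"
  proof cases
    case 7
    \<comment> \<open>The shift by 5 turns every truncated subtraction into an addition.\<close>
    then obtain m where k: "k = m + 5" by (metis add.commute le_Suc_ex)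
    have [simp]: "of_nat (m + 5 - 4) = (of_nat m + 1 :: complex)" "of_nat (m + 5 - 3) = (of_nat m + 2 :: complex)"
      by (simp_all add: of_nat_diff)
    have s: "m + 5 - 1 = m + 4" "m + 4 - 1 = m + 3" "m + 5 - 3 = m + 2" "m + 4 - 3 = m + 1" by simp_all
    have "4 \<le> m + 5" "m + 5 \<le> n" "4 \<le> m + 4" "m + 4 \<le> n" using 7 k by simp_all
    then show ?thesis unfolding k
      using assms by (simp add: canon_br_eqs s) (simp add: algebra_simps)
  qed (use assms in \<open>simp_all add: canon_br_eqs algebra_simps\<close>)
qed

lemma left_leibniz_canon_ext: "4 \<le> n \<Longrightarrow> left_leibniz_algebra (canon_ext n)"
  by (rule left_leibniz_algebra.intro[OF fd_algebra_canon_ext])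
    (auto simp: left_leibniz_algebra_axioms_def canon_br_left_leibniz)

section \<open>Solvability and nilradical of the canonical algebra\<close>

lemma subspace_vanishing: "cs.subspace {x \<in> coord_space m. \<forall>i\<in>S. x i = 0}"
  by (rule cs.subspaceI) (auto simp: coord_space_def)

text \<open>Three steps suffice: the first removes the two elements outside the nilradical, the
  second removes \<open>w\<close> and \<open>v\<close>, and the vectors that remain have zero
  products.\<close>

lemma solvable_canon_ext:
  assumes "4 \<le> n"
  shows "solvable_algebra (canon_ext n)"
proof -
  interpret K: fd_algebra "canon_ext n" using assms by (intro fd_algebra_canon_ext) simp
  let ?U = "\<lambda>S. {x \<in> coord_space n. \<forall>i\<in>S. x i = 0}"
  have br: "canon_br n x y \<in> coord_space n" for x y using assms by (simp add: canon_br_in_coord_space)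
  have "derived_series (canon_ext n) 1 \<subseteq> coord_space n"
    using K.bracket_span_subset[of "coord_space n"] subspace_coord_space br by auto
  then have 1: "derived_series (canon_ext n) 1 \<subseteq> ?U {}" by auto
  have "derived_series (canon_ext n) 2 \<subseteq> ?U {1,3}"
    unfolding numeral_2_eq_2 derived_series.simps(2)[of _ "Suc 0"]
  proof (rule K.bracket_span_subset)
    fix x y assume "x \<in> derived_series (canon_ext n) (Suc 0)" "y \<in> derived_series (canon_ext n) (Suc 0)"
    then have "x \<in> coord_space n" "y \<in> coord_space n" using 1 by auto
    then show "bracket (canon_ext n) x y \<in> ?U {1,3}"
      using br assms by (simp add: canon_br_eqs coord_spaceD)
  qed (simp only: canon_ext_simps subspace_vanishing)
  then have 2: "x 1 = 0 \<and> x 3 = 0 \<and> x \<in> coord_space n" if "x \<in> derived_series (canon_ext n) 2" for x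
    using that by auto
  have "derived_series (canon_ext n) 3 \<subseteq> {0}"
    unfolding numeral_3_eq_3 derived_series.simps(2)[of _ "Suc (Suc 0)"]
  proof (rule K.bracket_span_subset)
    fix x y assume "x \<in> derived_series (canon_ext n) (Suc (Suc 0))" "y \<in> derived_series (canon_ext n) (Suc (Suc 0))"
    then have xy: "x 1 = 0" "x 3 = 0" "x \<in> coord_space n" "y 1 = 0" "y 3 = 0" "y \<in> coord_space n"
      using 2 by (auto simp: numeral_2_eq_2)
    then have "canon_br n x y = 0" by (auto simp: canon_br_def fun_eq_iff coord_spaceD)
    then show "bracket (canon_ext n) x y \<in> {0}" by simp
  qed (use cs.subspace_single_0 in simp)
  then have "derived_series (canon_ext n) 3 = {0}"
    using K.subspace_derived_series[of 3] K.subspace_0 by blast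
  then show ?thesis unfolding solvable_algebra_def by blast
qed

lemma ideal_coord_space_canon_ext:
  assumes "2 \<le> n"
  shows "ideal (canon_ext n) (coord_space n)"
  unfolding ideal_def
  using subspace_coord_space coord_space_mono[of n "n + 2"] canon_br_in_coord_space[OF assms] by auto

lemma nilpotent_ideal_coord_space_canon_ext:
  assumes "4 \<le> n"
  shows "nilpotent_ideal (canon_ext n) (coord_space n)"
proof -
  interpret K: fd_algebra "canon_ext n" using assms by (intro fd_algebra_canon_ext) simp
  let ?N = "restrict_alg (canon_ext n) (coord_space n)"
  have I: "ideal (canon_ext n) (coord_space n)" using assms by (intro ideal_coord_space_canon_ext) simp
  interpret N: fd_algebra ?N using I by (rule K.ideal_fd_algebra)
  have br: "canon_br n x y \<in> coord_space n" for x y using assms by (simp add: canon_br_in_coord_space)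
  \<comment> \<open>One product removes \<open>w\<close> and \<open>v\<close>. Coordinate 2
    disappears one step later, because \<open>z\<close> arises only as \<open>[v, v]\<close>; from
    then on each step removes one more member of the chain.\<close>
  let ?U = "\<lambda>j. {x \<in> coord_space n. \<forall>i\<in>{i. i = 1 \<or> i = 2 \<and> 1 \<le> j \<or> 3 \<le> i \<and> i \<le> j + 3}. x i = 0}"
  have U: "cs.subspace (?U j)" for j by (rule subspace_vanishing)
  have LC: "lower_central ?N (Suc j) \<subseteq> ?U j" for j
  proof (induction j)
    case 0
    show ?case unfolding lower_central.simps
    proof (rule N.bracket_span_subset)
      fix x y assume "x \<in> carr ?N" "y \<in> carr ?N"
      then have xy: "x \<in> coord_space n" "y \<in> coord_space n" by simp_all
      have "canon_br n x y 1 = 0" "canon_br n x y 3 = 0"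
        using xy assms by (simp_all add: canon_br_eqs coord_spaceD)
      then have "canon_br n x y i = 0" if "i = 1 \<or> 3 \<le> i \<and> i \<le> 3" for i
        using that by (metis le_antisym)
      then show "bracket ?N x y \<in> ?U 0" using br by auto
    qed (simp only: restrict_alg_simps canon_ext_simps U)
  next
    case (Suc j)
    show ?case unfolding lower_central.simps(2)[of _ "Suc j"]
    proof (rule N.bracket_span_subset)
      fix x y assume "x \<in> carr ?N" "y \<in> lower_central ?N (Suc j)"
      then have xy: "x \<in> coord_space n" "y \<in> ?U j" using Suc by auto
      then have y: "y \<in> coord_space n" "y 1 = 0" "y 3 = 0" "\<And>i. 3 \<le> i \<Longrightarrow> i \<le> j + 3 \<Longrightarrow> y i = 0" by auto
      have "canon_br n x y i = 0" if "i = 1 \<or> i = 2 \<or> 3 \<le> i \<and> i \<le> Suc j + 3" for i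
      proof -
        have "i = 1 \<or> i = 2 \<or> i = 3 \<or> 4 \<le> i \<and> i \<le> n \<and> i \<le> j + 4 \<or> n < i"
          using that by presburger
        then consider "i = 1" | "i = 2" | "i = 3" | "4 \<le> i" "i \<le> n" "i \<le> j + 4" | "n < i"
          by blast
        then show ?thesis
        proof cases
          case 4
          then have "y (i - 1) = 0" by (intro y) auto
          then show ?thesis using 4 xy(1) y by (simp add: canon_br_eqs coord_spaceD)
        qed (use assms xy(1) y in \<open>simp_all add: canon_br_eqs coord_spaceD\<close>)
      qed
      then show "bracket ?N x y \<in> ?U (Suc j)" using br by auto
    qed (simp only: restrict_alg_simps canon_ext_simps U)
  qed
  have "?U n \<subseteq> {0}"
  proof
    fix x assume x: "x \<in> ?U n"
    have "x i = 0" for i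
    proof -
      consider "i = 0 \<or> n < i" | "i = 1 \<or> i = 2 \<and> 1 \<le> n \<or> 3 \<le> i \<and> i \<le> n + 3" using assms by linarith
      then show ?thesis using x by cases (auto simp: coord_spaceD)
    qed
    then show "x \<in> {0}" by auto
  qed
  then have "lower_central ?N (Suc n) \<subseteq> {0}" using LC[of n] by (rule order_trans[rotated])
  then show ?thesis using I by (rule K.nilpotent_idealI[rotated])
qed

text \<open>An element of a nilpotent ideal acts nilpotently, so the weights of its action vanish.\<close>

lemma nilpotent_ideal_canon_ext_subset:
  assumes "4 \<le> n" "nilpotent_ideal (canon_ext n) J"
  shows "J \<subseteq> coord_space n"
proof
  interpret K: fd_algebra "canon_ext n" using assms by (intro fd_algebra_canon_ext) simp
  have J: "ideal (canon_ext n) J" using assms by (simp add: nilpotent_ideal_def)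
  interpret J: fd_algebra "restrict_alg (canon_ext n) J" using J by (rule K.ideal_fd_algebra)
  obtain k where k: "lower_central (restrict_alg (canon_ext n) J) k = {0}"
    using assms unfolding nilpotent_ideal_def nilpotent_algebra_def by blast
  fix x assume x: "x \<in> J"
  then have xc: "x \<in> coord_space (n + 2)" using J unfolding ideal_def by auto
  \<comment> \<open>The exponent is one larger than the index: the first application only moves an
    arbitrary vector into \<open>J\<close>, which is term 0 of the series.\<close>
  have iter: "(canon_br n x ^^ Suc j) a \<in> lower_central (restrict_alg (canon_ext n) J) j"
    if "a \<in> coord_space (n + 2)" for a j
  proof (induction j)
    case 0
    show ?case using J x that unfolding ideal_def by auto
  next
    case (Suc j)
    then show ?case using J.bracket_in_span[of x "carr (restrict_alg (canon_ext n) J)"] x by simp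
  qed
  have "x (n + 1) = 0"
  proof -
    \<comment> \<open>Coordinate \<open>n + 1\<close> is tracked as well: as long as it is zero,
      coordinate 1 is simply multiplied by \<open>x (n + 1)\<close>.\<close>
    have "(canon_br n x ^^ j) (bvec 1) 1 = x (n + 1) ^ j \<and> (canon_br n x ^^ j) (bvec 1) (n + 1) = 0" for j
      using assms by (induction j) (auto simp: canon_br_eqs bvec_def)
    moreover have "(canon_br n x ^^ Suc k) (bvec 1) = 0"
      using iter[of "bvec 1" k] k by (simp add: bvec_in_coord_space)
    ultimately have "x (n + 1) ^ Suc k = 0" by (metis zero_fun_apply)
    then show ?thesis by (metis power_eq_0_iff)
  qed
  moreover have "x (n + 2) = 0"
  proof -
    have "(canon_br n x ^^ j) (bvec 3) 3 = x (n + 2) ^ j \<and> (canon_br n x ^^ j) (bvec 3) (n + 2) = 0" for j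
      using assms by (induction j) (auto simp: canon_br_eqs bvec_def)
    moreover have "(canon_br n x ^^ Suc k) (bvec 3) = 0"
      using iter[of "bvec 3" k] k assms by (simp add: bvec_in_coord_space)
    ultimately have "x (n + 2) ^ Suc k = 0" by (metis zero_fun_apply)
    then show ?thesis by (metis power_eq_0_iff)
  qed
  ultimately show "x \<in> coord_space n"
    by (rule coord_space_trunc[OF _ _ xc])
qed

text \<open>The nilpotent ideal \<open>coord_space n\<close> contains every nilpotent ideal, which
  yields maximality and uniqueness at once.\<close>

lemma nilradical_canon_ext:
  assumes "4 \<le> n"
  shows "is_nilradical (canon_ext n) (coord_space n)"
  using nilpotent_ideal_coord_space_canon_ext[OF assms] nilpotent_ideal_canon_ext_subset[OF assms]
  unfolding is_nilradical_def maximal_nilpotent_ideal_def by blast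

text \<open>Since \<open>w\<close> is in \<open>I\<close>, so is \<open>[v, w]\<close>; if
  \<open>v\<close> were in \<open>J\<close>, this bracket would lie in both ideals. Hence
  \<open>I\<close> contains both generators and with them all of \<open>coord_space n\<close>. An
  element of \<open>J\<close> brackets trivially with \<open>w\<close> and \<open>v\<close>, which
  forces it into \<open>coord_space n\<close>, hence into \<open>I\<close>.\<close>

lemma ideal_canon_ext_meets_trivially:
  assumes n: "4 \<le> n" and I: "ideal (canon_ext n) I" and J: "ideal (canon_ext n) J" and IJ: "I \<inter> J = {0}"
    and 1: "bvec 1 \<in> I" and 3: "bvec 3 \<in> I \<or> bvec 3 \<in> J"
  shows "J = {0}"
proof -
  have br: "canon_br n x y \<in> I" "canon_br n y x \<in> I" if "x \<in> I" "y \<in> coord_space (n + 2)" for x y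
    using I that unfolding ideal_def by auto
  have brJ: "canon_br n x y \<in> J" "canon_br n y x \<in> J" if "x \<in> J" "y \<in> coord_space (n + 2)" for x y
    using J that unfolding ideal_def by auto
  have b: "bvec i \<in> coord_space (n + 2)" if "i \<in> {1..n}" for i using that by (simp add: bvec_in_coord_space)
  have "canon_br n (bvec i) (bvec 1) = bvec (i + 1)" if "3 \<le> i" "i < n" for i
    using that n by (auto simp: canon_br_def bvec_def fun_eq_iff)
  then have Suc: "bvec (i + 1) \<in> I" if "3 \<le> i" "i < n" for i
    using br(2)[OF 1 b[of i]] that by auto
  have 3: "bvec 3 \<in> I"
  proof (rule ccontr)
    assume "bvec 3 \<notin> I"
    then have "canon_br n (bvec 3) (bvec 1) \<in> J" using 3 brJ b n by auto
    moreover have "canon_br n (bvec 3) (bvec 1) = bvec 4" using n by (auto simp: canon_br_def bvec_def fun_eq_iff)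
    moreover have "bvec 4 \<in> I" using Suc[of 3] n by simp
    ultimately have "bvec 4 \<in> I \<inter> J" by auto
    then have "bvec 4 = 0" using IJ by simp
    then show False by (metis bvec_def zero_fun_apply zero_neq_one)
  qed
  have "J \<subseteq> {0}"
  proof
    fix x assume x: "x \<in> J"
    then have xc: "x \<in> coord_space (n + 2)" using J unfolding ideal_def by auto
    \<comment> \<open>Products of an element of \<open>J\<close> with elements of \<open>I\<close>
      lie in the intersection.\<close>
    have 0: "canon_br n x (bvec 1) = 0" "canon_br n x (bvec 3) = 0"
      using br brJ x xc 1 3 b[of 1] b[of 3] n IJ by (auto 0 3)
    have "x (n + 1) = 0" using fun_cong[OF 0(1), of 1] n by (simp add: canon_br_eqs bvec_def)
    moreover have "x (n + 2) = 0" using fun_cong[OF 0(2), of 3] n by (simp add: canon_br_eqs bvec_def)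
    ultimately have xn: "x \<in> coord_space n"
      by (rule coord_space_trunc[OF _ _ xc])
    have "x 1 = 0" using fun_cong[OF 0(2), of 4] n xn by (simp add: canon_br_eqs bvec_def coord_spaceD)
    have mem: "bvec i \<in> I" if "3 \<le> i" "i \<le> n" for i
      using that by (induction i rule: dec_induct) (use 3 Suc in auto)
    have "canon_br n (bvec 3) (bvec 3) = bvec 2" using n by (auto simp: canon_br_def bvec_def fun_eq_iff)
    then have mem2: "bvec 2 \<in> I" using br(1)[OF 3 b[of 3]] n by auto
    have "x = (\<Sum>i=1..n. x i \<cdot> bvec i)" using xn by (rule coord_space_expand)
    also have "\<dots> \<in> I"
    proof (rule cs.subspace_sum)
      show sub: "cs.subspace I" using I unfolding ideal_def by simp
      fix i assume "i \<in> {1..n}"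
      then consider "i = 1" | "i = 2" | "3 \<le> i" "i \<le> n" by fastforce
      then have "bvec i \<in> I" using 1 mem mem2 by cases auto
      then show "x i \<cdot> bvec i \<in> I" using sub by (rule cs.subspace_scale[rotated])
    qed
    finally show "x \<in> {0}" using IJ x by auto
  qed
  then show ?thesis using J cs.subspace_0 unfolding ideal_def by auto
qed

text \<open>The element with coordinates 3 and 1 outside the nilradical acts with distinct weights, so its
  eigenvectors split along a decomposition only trivially.\<close>

lemma indecomposable_canon_ext:
  assumes n: "4 \<le> n"
  shows "indecomposable (canon_ext n)"
  unfolding indecomposable_def
proof (rule notI, elim exE conjE)
  fix I J assume I: "ideal (canon_ext n) I" and J: "ideal (canon_ext n) J" and ne: "I \<noteq> {0}" "J \<noteq> {0}"
    and IJ: "I \<inter> J = {0}" and dec: "carr (canon_ext n) = {x + y |x y. x \<in> I \<and> y \<in> J}"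
  \<comment> \<open>This element has weight 3 on \<open>w\<close>, 1 on \<open>v\<close>, 2 on
    \<open>z\<close> and \<open>1 + 3 (k - 3)\<close> on coordinate \<open>k\<close>, so the weights
    of \<open>w\<close> and \<open>v\<close> are simple.\<close>
  define t where "t = 3 \<cdot> bvec (n + 1) + bvec (n + 2)"
  have tc: "t \<in> coord_space (n + 2)" unfolding t_def
    by (intro coord_space_add coord_space_cscale bvec_in_coord_space) auto
  have [simp]: "t (Suc n) = 3" "t (Suc (Suc n)) = 1"
    by (auto simp: t_def bvec_def)
  have [simp]: "t i = 0" if "i \<le> n" for i
    using that by (auto simp: t_def bvec_def)
  have split: "bvec i \<in> I \<or> bvec i \<in> J" if i: "i \<in> {1, 3}" for i
  proof -
    define \<mu> :: complex where "\<mu> = (if i = 1 then 3 else 1)"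
    \<comment> \<open>Coordinates beyond \<open>n\<close> are included: the bracket has none there,
      and the eigenvalue is not zero.\<close>
    have eig: "x = x i \<cdot> bvec i" if "canon_br n t x = \<mu> \<cdot> x" "x \<in> coord_space (n + 2)" for x
    proof
      fix k
      have k: "canon_br n t x k = \<mu> * x k" using that by simp
      consider "k = 0" | "k = 1" | "k = 2" | "k = 3" | m where "k = m + 4" "k \<le> n" | "n < k"
      proof -
        have "k = 0 \<or> k = 1 \<or> k = 2 \<or> k = 3 \<or> k = (k - 4) + 4 \<and> k \<le> n \<or> n < k" by presburger
        then show ?thesis using that by blast
      qed
      then show "x k = (x i \<cdot> bvec i) k"
      proof cases
        case 5
        then have "(1 + 3 * (1 + of_nat m) - \<mu>) * x k = 0"
          using k n by (simp add: canon_br_eqs algebra_simps)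
        moreover have "1 + 3 * (1 + of_nat m) - \<mu> \<noteq> 0"
        proof
          assume *: "1 + 3 * (1 + of_nat m) - \<mu> = 0"
          show False
          proof (cases "i = 1")
            case True
            then have "of_nat (1 + 3 * m) = (of_nat 0 :: complex)" using * by (simp add: \<mu>_def)
            then show False unfolding of_nat_eq_iff by simp
          next
            case False
            then have "of_nat (3 + 3 * m) = (of_nat 0 :: complex)" using * by (simp add: \<mu>_def)
            then show False unfolding of_nat_eq_iff by simp
          qed
        qed
        ultimately show ?thesis using 5 i by (auto simp: bvec_def)
      next
        case 1
        then show ?thesis using i coord_spaceD[OF that(2)] by (auto simp: bvec_def)
      qed (use k n i in \<open>auto simp: canon_br_eqs bvec_def \<mu>_def split: if_splits\<close>)
    qed
    have "bvec i \<in> coord_space (n + 2)" using i n by (auto intro: bvec_in_coord_space)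
    then obtain p q where pq: "p \<in> I" "q \<in> J" "bvec i = p + q" using dec by auto
    have c: "p \<in> coord_space (n + 2)" "q \<in> coord_space (n + 2)"
      using pq I J unfolding ideal_def by auto
    have "canon_br n t (bvec i) = \<mu> \<cdot> bvec i"
      using i n by (auto simp: canon_br_def fun_eq_iff bvec_def \<mu>_def t_def)
    \<comment> \<open>The defects of the two components cancel. One lies in \<open>I\<close> and the
      other in \<open>J\<close>, so both vanish and each component is an eigenvector itself.\<close>
    then have *: "canon_br n t p - \<mu> \<cdot> p = \<mu> \<cdot> q - canon_br n t q"
      unfolding pq(3) canon_br_bilinear cs.scale_right_distrib by (simp add: algebra_simps)
    have "canon_br n t p - \<mu> \<cdot> p \<in> I" "\<mu> \<cdot> q - canon_br n t q \<in> J"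
      using I J pq tc unfolding ideal_def by (auto intro: cs.subspace_diff cs.subspace_scale)
    then have "canon_br n t p - \<mu> \<cdot> p \<in> I \<inter> J" using * by simp
    then have "canon_br n t p = \<mu> \<cdot> p" using IJ by simp
    moreover from this * have "canon_br n t q = \<mu> \<cdot> q" by simp
    ultimately have e: "p = p i \<cdot> bvec i" "q = q i \<cdot> bvec i" using eig c by blast+
    have inv: "bvec i \<in> L" if "x \<in> L" "x = c \<cdot> bvec i" "c \<noteq> 0" "ideal (canon_ext n) L" for L x c
    proof -
      have "cs.subspace L" using that(4) unfolding ideal_def by simp
      then have "inverse c \<cdot> x \<in> L" using that(1) by (rule cs.subspace_scale)
      then show ?thesis using that(2,3) by simp
    qed
    show ?thesis
    proof (cases "p i = 0")
      case True
      then have "p = 0" using e(1) by simp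
      then have "bvec i = q" using pq(3) by simp
      then show ?thesis using pq(2) by simp
    next
      case False
      then show ?thesis using inv[OF pq(1) e(1)] I by simp
    qed
  qed
  have JI: "J \<inter> I = {0}" using IJ by auto
  from split[of 1] show False
    using ideal_canon_ext_meets_trivially[OF n I J IJ] ideal_canon_ext_meets_trivially[OF n J I JI] split[of 3] ne by auto
qed

lemma solvable_extension_canon_ext:
  assumes "4 \<le> n" "restrict_alg (canon_ext n) (coord_space n) \<cong>\<^sub>L L4 n"
  shows "solvable_extension_of_L4 n (canon_ext n)"
  unfolding solvable_extension_of_L4_def
proof (intro conjI)
  show "alg_dim (canon_ext n) = n + 2" unfolding alg_dim_def by (simp only: canon_ext_simps dim_coord_space)
  show "\<exists>N. is_nilradical (canon_ext n) N \<and> restrict_alg (canon_ext n) N \<cong>\<^sub>L L4 n"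
    using nilradical_canon_ext assms by blast
qed (use left_leibniz_canon_ext solvable_canon_ext indecomposable_canon_ext assms in auto)

section \<open>Changes of basis\<close>

lemma canon_br_bvec:
  assumes "4 \<le> n" "i \<in> {1..n+2}" "j \<in> {1..n+2}"
  shows "canon_br n (bvec i) (bvec j) =
    (if i = 1 \<and> 3 \<le> j \<and> j < n then - bvec (j + 1)
     else if 3 \<le> i \<and> i < n \<and> j = 1 then bvec (i + 1)
     else if i = 3 \<and> j = 3 then bvec 2
     else if i = n + 1 \<and> j = 1 then bvec 1
     else if i = n + 1 \<and> 3 \<le> j \<and> j \<le> n then of_nat (j - 3) \<cdot> bvec j
     else if i = 1 \<and> j = n + 1 then - bvec 1
     else if 3 \<le> i \<and> i \<le> n \<and> j = n + 1 then - (of_nat (i - 3) \<cdot> bvec i)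
     else if i = n + 2 \<and> j = 2 then 2 \<cdot> bvec 2
     else if i = n + 2 \<and> 3 \<le> j \<and> j \<le> n then bvec j
     else if 3 \<le> i \<and> i \<le> n \<and> j = n + 2 then - bvec i
     else 0)"
proof
  fix k
  consider "i = 1" | "i = 2" | "3 \<le> i" "i \<le> n" | "i = n + 1" | "i = n + 2" using assms(2) by fastforce
  then show "canon_br n (bvec i) (bvec j) k =
    (if i = 1 \<and> 3 \<le> j \<and> j < n then - bvec (j + 1)
     else if 3 \<le> i \<and> i < n \<and> j = 1 then bvec (i + 1)
     else if i = 3 \<and> j = 3 then bvec 2
     else if i = n + 1 \<and> j = 1 then bvec 1
     else if i = n + 1 \<and> 3 \<le> j \<and> j \<le> n then of_nat (j - 3) \<cdot> bvec j
     else if i = 1 \<and> j = n + 1 then - bvec 1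
     else if 3 \<le> i \<and> i \<le> n \<and> j = n + 1 then - (of_nat (i - 3) \<cdot> bvec i)
     else if i = n + 2 \<and> j = 2 then 2 \<cdot> bvec 2
     else if i = n + 2 \<and> 3 \<le> j \<and> j \<le> n then bvec j
     else if 3 \<le> i \<and> i \<le> n \<and> j = n + 2 then - bvec i
     else 0) k"
    by cases (use assms in \<open>auto simp: canon_br_def bvec_def\<close>)
qed

text \<open>The vectors satisfying the homomorphism equation against a fixed partner form a
  subspace; the left argument is freed from the basis first, then the right one.\<close>

lemma hom_from_basis:
  assumes S: "fd_algebra S" "carr S = coord_space m" "smul S = cscale" and A: "fd_algebra A"
    and gc: "\<And>x. x \<in> coord_space m \<Longrightarrow> g x \<in> carr A"
    and g_add: "\<And>x y. x \<in> coord_space m \<Longrightarrow> y \<in> coord_space m \<Longrightarrow> g (x + y) = g x + g y"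
    and g_smul: "\<And>c x. x \<in> coord_space m \<Longrightarrow> g (c \<cdot> x) = smul A c (g x)"
    and basis: "\<And>i j. i \<in> {1..m} \<Longrightarrow> j \<in> {1..m} \<Longrightarrow>
          g (bracket S (bvec i) (bvec j)) = bracket A (g (bvec i)) (g (bvec j))"
    and xy: "x \<in> coord_space m" "y \<in> coord_space m"
  shows "g (bracket S x y) = bracket A (g x) (g y)"
proof -
  interpret S: fd_algebra S by fact
  interpret A: fd_algebra A by fact
  have [simp]: "g 0 = 0" using g_add[OF coord_space_zero coord_space_zero] by simp
  note lin = S.bracket_add_left S.bracket_add_right S.bracket_smul_left S.bracket_smul_right
    S.bracket_closed S.bracket_zero_left S.bracket_zero_right
  note lin = lin[unfolded S(2,3)]
  note linA = A.bracket_add_left A.bracket_add_right A.bracket_smul_left A.bracket_smul_right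
    A.bracket_zero_left A.bracket_zero_right
  have b: "bvec j \<in> coord_space m" if "j \<in> {1..m}" for j using that by (rule bvec_in_coord_space)
  have *: "g (bracket S x (bvec j)) = bracket A (g x) (g (bvec j))" if j: "j \<in> {1..m}"
    and x: "x \<in> coord_space m" for j x
  proof -
    have "cs.span (bvec ` {1..m}) \<subseteq>
      {x \<in> coord_space m. g (bracket S x (bvec j)) = bracket A (g x) (g (bvec j))}"
    proof (rule cs.span_minimal)
      show "cs.subspace {x \<in> coord_space m. g (bracket S x (bvec j)) = bracket A (g x) (g (bvec j))}"
        by (rule cs.subspaceI)
          (simp_all add: lin linA b[OF j] gc g_add g_smul coord_space_zero coord_space_add coord_space_cscale)
    qed (use basis j b in auto)
    then show ?thesis using x by (auto simp: coord_space_eq_span)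
  qed
  have "cs.span (bvec ` {1..m}) \<subseteq>
    {y \<in> coord_space m. g (bracket S x y) = bracket A (g x) (g y)}"
  proof (rule cs.span_minimal)
    show "cs.subspace {y \<in> coord_space m. g (bracket S x y) = bracket A (g x) (g y)}"
      by (rule cs.subspaceI)
        (simp_all add: lin linA xy(1) gc g_add g_smul coord_space_zero coord_space_add coord_space_cscale)
  qed (use * xy(1) b in auto)
  then show ?thesis using xy(2) by (auto simp: coord_space_eq_span)
qed

lemma isomorphic_from_basis:
  assumes "fd_algebra S" "carr S = coord_space m" "smul S = cscale" "fd_algebra A"
    and bij: "bij_betw g (coord_space m) (carr A)"
    and g_add: "\<And>x y. x \<in> coord_space m \<Longrightarrow> y \<in> coord_space m \<Longrightarrow> g (x + y) = g x + g y"
    and g_smul: "\<And>c x. x \<in> coord_space m \<Longrightarrow> g (c \<cdot> x) = smul A c (g x)"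
    and basis: "\<And>i j. i \<in> {1..m} \<Longrightarrow> j \<in> {1..m} \<Longrightarrow>
          g (bracket S (bvec i) (bvec j)) = bracket A (g (bvec i)) (g (bvec j))"
  shows "S \<cong>\<^sub>L A"
proof -
  have gc: "g x \<in> carr A" if "x \<in> coord_space m" for x using bij that by (auto simp: bij_betw_def)
  have "g (bracket S x y) = bracket A (g x) (g y)" if "x \<in> coord_space m" "y \<in> coord_space m" for x y
    using hom_from_basis[of S m A g x y, OF assms(1-4) gc g_add g_smul basis that] by simp
  then show ?thesis
    unfolding isomorphic_def using bij g_add g_smul assms(2,3) by (intro exI[of _ g]) simp
qed

text \<open>The images of the first basis vectors are \<open>e\<^sub>1 \<mapsto> p w + v\<close>, \<open>e\<^sub>3 \<mapsto> (p - 1) w + v\<close>,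
  \<open>e\<^sub>2 \<mapsto> z\<close> and \<open>e\<^sub>4 \<mapsto> z + [v, w]\<close>, where \<open>w\<close>, \<open>z\<close>, \<open>v\<close> are the first three basis vectors of the
  canonical algebra; for \<open>n \<ge> 5\<close> this preserves brackets only if \<open>p = 1\<close>. The last two basis
  vectors are sent to elements acting on \<open>v\<close>, \<open>w\<close> with the weights \<open>(a, b)\<close> and \<open>(c, d)\<close>.\<close>

definition basis_map ::
  "nat \<Rightarrow> complex \<Rightarrow> complex \<Rightarrow> complex \<Rightarrow> complex \<Rightarrow> complex \<Rightarrow> (nat \<Rightarrow> complex) \<Rightarrow> nat \<Rightarrow> complex" where
  "basis_map n p a b c d x i =
    (if i = 1 then p * x 1 + (p - 1) * x 3
     else if i = 2 then x 2 + x 4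
     else if i = 3 then x 1 + x 3
     else if 4 \<le> i \<and> i \<le> n then x i
     else if i = n + 1 then b * x (n + 1) + d * x (n + 2)
     else if i = n + 2 then a * x (n + 1) + c * x (n + 2)
     else 0)"

definition basis_map_inv ::
  "nat \<Rightarrow> complex \<Rightarrow> complex \<Rightarrow> complex \<Rightarrow> complex \<Rightarrow> complex \<Rightarrow> (nat \<Rightarrow> complex) \<Rightarrow> nat \<Rightarrow> complex" where
  "basis_map_inv n p a b c d y i =
    (if i = 1 then y 1 - (p - 1) * y 3
     else if i = 2 then y 2 - y 4
     else if i = 3 then p * y 3 - y 1
     else if 4 \<le> i \<and> i \<le> n then y i
     else if i = n + 1 then (c * y (n + 1) - d * y (n + 2)) / (b * c - a * d)
     else if i = n + 2 then (b * y (n + 2) - a * y (n + 1)) / (b * c - a * d)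
     else 0)"

lemma basis_map_linear:
  "basis_map n p a b c d (x + y) = basis_map n p a b c d x + basis_map n p a b c d y"
  "basis_map n p a b c d (x - y) = basis_map n p a b c d x - basis_map n p a b c d y"
  "basis_map n p a b c d (- x) = - basis_map n p a b c d x"
  "basis_map n p a b c d (s \<cdot> x) = s \<cdot> basis_map n p a b c d x"
  "basis_map n p a b c d 0 = 0"
  by (auto simp: basis_map_def fun_eq_iff algebra_simps)

lemma bij_basis_map:
  assumes "4 \<le> n" "b * c - a * d \<noteq> 0"
  shows "bij_betw (basis_map n p a b c d) (coord_space (n + 2)) (coord_space (n + 2))"
proof (rule bij_betw_byWitness[where f' = "basis_map_inv n p a b c d"])
  \<comment> \<open>Cramer's rule for the two-by-two matrix of weights with determinant
    \<open>b * c - a * d\<close>.\<close>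
  have 1: "b * (c * x - d * y) + d * (b * y - a * x) = x * (b * c - a * d)"
    "a * (c * x - d * y) + c * (b * y - a * x) = y * (b * c - a * d)"
    "c * (b * x + d * y) - d * (a * x + c * y) = x * (b * c - a * d)"
    "b * (a * x + c * y) - a * (b * x + d * y) = y * (b * c - a * d)" for x y
    by (simp_all add: algebra_simps)
  have 2: "b * ((c * x - d * y) / (b * c - a * d)) + d * ((b * y - a * x) / (b * c - a * d)) = x"
    "a * ((c * x - d * y) / (b * c - a * d)) + c * ((b * y - a * x) / (b * c - a * d)) = y" for x y
    using assms(2) by (simp_all add: 1 times_divide_eq_right add_divide_distrib[symmetric])
  have 3: "(c * (b * x + d * y) - d * (a * x + c * y)) / (b * c - a * d) = x"
    "(b * (a * x + c * y) - a * (b * x + d * y)) / (b * c - a * d) = y" for x y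
    using assms(2) by (simp_all add: 1)
  show "\<forall>x\<in>coord_space (n + 2). basis_map_inv n p a b c d (basis_map n p a b c d x) = x"
  proof (intro ballI ext)
    fix x i assume x: "x \<in> coord_space (n + 2)"
    have "i = 1 \<or> i = 2 \<or> i = 3 \<or> 4 \<le> i \<and> i \<le> n \<or> i = n + 1 \<or> i = n + 2 \<or> i = 0 \<or> n + 2 < i" by presburger
    then consider "i = 1" | "i = 2" | "i = 3" | "4 \<le> i" "i \<le> n" | "i = n + 1" | "i = n + 2" | "i = 0 \<or> n + 2 < i"
      by blast
    then show "basis_map_inv n p a b c d (basis_map n p a b c d x) i = x i"
      by (cases; use assms x in \<open>auto simp: basis_map_inv_def basis_map_def 3 coord_spaceD\<close>;
          simp add: algebra_simps)
  qed
  show "\<forall>x\<in>coord_space (n + 2). basis_map n p a b c d (basis_map_inv n p a b c d x) = x"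
  proof (intro ballI ext)
    fix x i assume x: "x \<in> coord_space (n + 2)"
    have "i = 1 \<or> i = 2 \<or> i = 3 \<or> 4 \<le> i \<and> i \<le> n \<or> i = n + 1 \<or> i = n + 2 \<or> i = 0 \<or> n + 2 < i" by presburger
    then consider "i = 1" | "i = 2" | "i = 3" | "4 \<le> i" "i \<le> n" | "i = n + 1" | "i = n + 2" | "i = 0 \<or> n + 2 < i"
      by blast
    then show "basis_map n p a b c d (basis_map_inv n p a b c d x) i = x i"
      by (cases; use assms x in \<open>auto simp: basis_map_inv_def basis_map_def 2 2[unfolded times_divide_eq_right] coord_spaceD\<close>;
          simp add: algebra_simps)
  qed
qed (use assms in \<open>auto simp: basis_map_def basis_map_inv_def coord_space_def\<close>)

lemma basis_map_image_coord_space: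
  assumes "4 \<le> n" "x \<in> coord_space n"
  shows "basis_map n p a b c d x \<in> coord_space n"
  using assms by (auto simp: basis_map_def coord_space_def)

lemma bij_basis_map_coord_space:
  assumes "4 \<le> n"
  shows "bij_betw (basis_map n 1 1 0 0 1) (coord_space n) (coord_space n)"
proof -
  have bij: "bij_betw (basis_map n 1 1 0 0 1) (coord_space (n + 2)) (coord_space (n + 2))"
    using assms by (rule bij_basis_map) simp
  \<comment> \<open>With these parameters the map exchanges the last two coordinates, hence the
    crossed indices below.\<close>
  have in_cs: "x \<in> coord_space n" if "x \<in> coord_space (n + 2)" "basis_map n 1 1 0 0 1 x \<in> coord_space n" for x
  proof (rule coord_space_trunc[OF _ _ that(1)])
    show "x (n + 1) = 0" using coord_spaceD[OF that(2), of "n + 2"] assms by (simp add: basis_map_def)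
    show "x (n + 2) = 0" using coord_spaceD[OF that(2), of "n + 1"] assms by (simp add: basis_map_def)
  qed
  have sub: "coord_space n \<subseteq> coord_space (n + 2)" by (rule coord_space_mono) simp
  show ?thesis
  proof (rule bij_betw_imageI)
    show "inj_on (basis_map n 1 1 0 0 1) (coord_space n)"
      using bij sub by (meson bij_betw_def inj_on_subset)
    have "y \<in> basis_map n 1 1 0 0 1 ` coord_space n" if "y \<in> coord_space n" for y
    proof -
      have "y \<in> basis_map n 1 1 0 0 1 ` coord_space (n + 2)"
        using that sub bij unfolding bij_betw_def by blast
      then show ?thesis using in_cs that by blast
    qed
    then show "basis_map n 1 1 0 0 1 ` coord_space n = coord_space n"
      using basis_map_image_coord_space[OF assms] by blast
  qed
qed

lemma basis_map_bvec:
  assumes "4 \<le> n"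
  shows "basis_map n p a b c d (bvec 1) = p \<cdot> bvec 1 + bvec 3"
    "basis_map n p a b c d (bvec 2) = bvec 2"
    "basis_map n p a b c d (bvec 3) = (p - 1) \<cdot> bvec 1 + bvec 3"
    "basis_map n p a b c d (bvec 4) = bvec 2 + bvec 4"
    "5 \<le> i \<Longrightarrow> i \<le> n \<Longrightarrow> basis_map n p a b c d (bvec i) = bvec i"
    "basis_map n p a b c d (bvec (n + 1)) = b \<cdot> bvec (n + 1) + a \<cdot> bvec (n + 2)"
    "basis_map n p a b c d (bvec (n + 2)) = d \<cdot> bvec (n + 1) + c \<cdot> bvec (n + 2)"
  using assms by (auto simp: basis_map_def fun_eq_iff bvec_def)

lemma canon_br_uminus: "canon_br n (- x) y = - canon_br n x y" "canon_br n x (- y) = - canon_br n x y"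
  "canon_br n 0 y = 0" "canon_br n y 0 = 0"
  "canon_br n (x - y) z = canon_br n x z - canon_br n y z" "canon_br n z (x - y) = canon_br n z x - canon_br n z y"
  by (auto simp: canon_br_def fun_eq_iff algebra_simps)

text \<open>As \<open>[w, v] = - [v, w]\<close>, the parameter \<open>p\<close> cancels from all
  products of the images of \<open>e\<^sub>1\<close> and \<open>e\<^sub>3\<close>. For
  \<open>n \<ge> 5\<close> the relation \<open>[e\<^sub>3, e\<^sub>4] = 0\<close> detects the
  component \<open>(p - 1) w\<close> of the image of \<open>e\<^sub>3\<close>, since
  \<open>w\<close> no longer annihilates the image of \<open>e\<^sub>4\<close>; this forces
  \<open>p = 1\<close>.\<close>

lemma basis_map_L4_table:
  assumes n: "4 \<le> n" and p: "5 \<le> n \<Longrightarrow> p = 1" and ij: "i \<in> {1..n}" "j \<in> {1..n}"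
  shows "basis_map n p a b c d (L4_table n i j) = canon_br n (basis_map n p a b c d (bvec i)) (basis_map n p a b c d (bvec j))"
proof -
  have cases: "i = 1 \<or> i = 2 \<or> i = 3 \<or> i = 4 \<or> 5 \<le> i \<and> i \<le> n" if "i \<in> {1..n}" for i :: nat
    using that by (auto; presburger)
  show ?thesis
    using cases[OF ij(1)] cases[OF ij(2)] n p
    by (elim disjE) (simp_all add: L4_table_def basis_map_linear basis_map_bvec basis_map_bvec[unfolded One_nat_def]
       canon_br_bilinear canon_br_uminus canon_br_bvec fun_eq_iff algebra_simps)
qed

lemma L4_table_in_coord_space: "4 \<le> n \<Longrightarrow> n \<le> m \<Longrightarrow> L4_table n i j \<in> coord_space m"
  unfolding L4_table_def
  by (auto intro!: coord_space_zero coord_space_add coord_space_diff coord_space_uminus coord_space_cscale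
      bvec_in_coord_space)

lemma fd_algebra_L4: "4 \<le> n \<Longrightarrow> fd_algebra (L4 n)"
  unfolding L4_def by (rule fd_algebra_table_algebra) (simp add: L4_table_in_coord_space)

lemma restrict_canon_ext_isomorphic_L4:
  assumes n: "4 \<le> n"
  shows "restrict_alg (canon_ext n) (coord_space n) \<cong>\<^sub>L L4 n"
proof -
  interpret K: fd_algebra "canon_ext n" using n by (intro fd_algebra_canon_ext) simp
  have R: "fd_algebra (restrict_alg (canon_ext n) (coord_space n))"
    using n by (intro K.ideal_fd_algebra ideal_coord_space_canon_ext) simp
  have "L4 n \<cong>\<^sub>L restrict_alg (canon_ext n) (coord_space n)"
  proof (rule isomorphic_from_basis[where g = "basis_map n 1 1 0 0 1", OF fd_algebra_L4[OF n] _ _ R])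
    fix i j assume "i \<in> {1..n}" "j \<in> {1..n}"
    then show "basis_map n 1 1 0 0 1 (bracket (L4 n) (bvec i) (bvec j)) =
      bracket (restrict_alg (canon_ext n) (coord_space n)) (basis_map n 1 1 0 0 1 (bvec i)) (basis_map n 1 1 0 0 1 (bvec j))"
      by (simp add: L4_def table_algebra_bracket_bvec basis_map_L4_table n)
  qed (use bij_basis_map_coord_space[OF n] in \<open>simp_all add: L4_def table_algebra_def basis_map_linear\<close>)
  then show ?thesis using fd_algebra_L4[OF n] R by (rule isomorphic_sym[rotated 2])
qed

text \<open>Reduces each family to the products that involve one of the last two basis vectors. The
  determinant expresses that their weights are linearly independent.\<close>

lemma table_algebra_isomorphic_canon_ext:
  assumes n: "4 \<le> n" and p: "5 \<le> n \<Longrightarrow> p = 1" and det: "b * c - a * d \<noteq> 0"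
    and T: "\<And>i j. T i j \<in> coord_space (n + 2)"
    and L4: "\<And>i j. i \<in> {1..n} \<Longrightarrow> j \<in> {1..n} \<Longrightarrow> T i j = L4_table n i j"
    and T': "\<And>i j. i \<in> {1..n+2} \<Longrightarrow> j \<in> {n+1, n+2} \<Longrightarrow>
        basis_map n p a b c d (T i j) = canon_br n (basis_map n p a b c d (bvec i)) (basis_map n p a b c d (bvec j)) \<and>
        basis_map n p a b c d (T j i) = canon_br n (basis_map n p a b c d (bvec j)) (basis_map n p a b c d (bvec i))"
  shows "fd_algebra (table_algebra (n + 2) T)" "table_algebra (n + 2) T \<cong>\<^sub>L canon_ext n"
proof -
  show fd: "fd_algebra (table_algebra (n + 2) T)" using T by (rule fd_algebra_table_algebra)
  have K: "fd_algebra (canon_ext n)" using n by (intro fd_algebra_canon_ext) simp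
  show "table_algebra (n + 2) T \<cong>\<^sub>L canon_ext n"
  proof (rule isomorphic_from_basis[where g = "basis_map n p a b c d", OF fd _ _ K])
    fix i j assume ij: "i \<in> {1..n+2}" "j \<in> {1..n+2}"
    then consider "i \<in> {1..n}" "j \<in> {1..n}" | "j \<in> {n+1, n+2}" | "i \<in> {n+1, n+2}" by fastforce
    then have "basis_map n p a b c d (T i j) = canon_br n (basis_map n p a b c d (bvec i)) (basis_map n p a b c d (bvec j))"
    proof cases
      case 1
      then show ?thesis using L4 basis_map_L4_table[OF n p] by simp
    qed (use T'[of i j] T'[of j i] ij in blast)+
    then show "basis_map n p a b c d (bracket (table_algebra (n + 2) T) (bvec i) (bvec j)) =
      bracket (canon_ext n) (basis_map n p a b c d (bvec i)) (basis_map n p a b c d (bvec j))"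
      using ij by (simp only: table_algebra_bracket_bvec canon_ext_simps)
  qed (use bij_basis_map[OF n det] in \<open>simp_all add: table_algebra_def basis_map_linear\<close>)
qed

section \<open>The four families as changes of basis of the canonical algebra\<close>

lemmas coord_space_intros = coord_space_zero coord_space_add coord_space_diff coord_space_uminus
  coord_space_cscale bvec_in_coord_space L4_table_in_coord_space

lemma l1_isomorphic_canon_ext:
  assumes n: "4 \<le> n"
  shows "fd_algebra (l1 n)" "l1 n \<cong>\<^sub>L canon_ext n"
proof -
  have T: "l1_table n i j \<in> coord_space (n + 2)" for i j
    unfolding l1_table_def using n by (auto intro!: coord_space_intros)
  have L4: "l1_table n i j = L4_table n i j" if "i \<in> {1..n}" "j \<in> {1..n}" for i j
    using that by (auto simp: l1_table_def)
  \<comment> \<open>The weights on \<open>e\<^sub>3\<close> and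
    \<open>e\<^sub>1 - e\<^sub>3\<close>, read off the table, are (-2, -1) for the first new basis
    vector and (-1, -1) for the second.\<close>
  have T': "basis_map n 1 (-2) (-1) (-1) (-1) (l1_table n i j) =
      canon_br n (basis_map n 1 (-2) (-1) (-1) (-1) (bvec i)) (basis_map n 1 (-2) (-1) (-1) (-1) (bvec j)) \<and>
    basis_map n 1 (-2) (-1) (-1) (-1) (l1_table n j i) =
      canon_br n (basis_map n 1 (-2) (-1) (-1) (-1) (bvec j)) (basis_map n 1 (-2) (-1) (-1) (-1) (bvec i))"
    if i: "i \<in> {1..n+2}" and j: "j \<in> {n+1, n+2}" for i j
  proof -
    have "i = 1 \<or> i = 2 \<or> i = 3 \<or> i = 4 \<or> 5 \<le> i \<and> i \<le> n \<or> i = n + 1 \<or> i = n + 2"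
      using i by (auto; presburger)
    then consider "i = 1" | "i = 2" | "i = 3" | "i = 4" | "5 \<le> i" "i \<le> n" | "i = n + 1" | "i = n + 2" by blast
    then show ?thesis using j
      by cases (use n in \<open>auto simp: l1_table_def basis_map_linear basis_map_bvec[simplified] canon_br_bilinear canon_br_uminus
        canon_br_bvec L4_table_def fun_eq_iff algebra_simps of_nat_diff\<close>)
  qed
  show "fd_algebra (l1 n)" "l1 n \<cong>\<^sub>L canon_ext n"
    unfolding l1_def by (rule table_algebra_isomorphic_canon_ext[OF n _ _ T L4 T']; simp)+
qed

lemma basis_map_bvec_4:
  "basis_map 4 p a b c d (bvec (Suc 0)) = p \<cdot> bvec (Suc 0) + bvec 3"
  "basis_map 4 p a b c d (bvec 2) = bvec 2"
  "basis_map 4 p a b c d (bvec 3) = (p - 1) \<cdot> bvec (Suc 0) + bvec 3"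
  "basis_map 4 p a b c d (bvec 4) = bvec 2 + bvec 4"
  "basis_map 4 p a b c d (bvec 5) = b \<cdot> bvec 5 + a \<cdot> bvec 6"
  "basis_map 4 p a b c d (bvec 6) = d \<cdot> bvec 5 + c \<cdot> bvec 6"
  using basis_map_bvec[of 4] by simp_all

text \<open>The weights are (-1, -1) for \<open>e\<^sub>5\<close> and (-(b + 1), 0) for
  \<open>e\<^sub>6\<close>, with determinant \<open>b + 1\<close>.\<close>

lemma l2_isomorphic_canon_ext:
  assumes b: "b \<noteq> -1"
  shows "fd_algebra (l2 b)" "l2 b \<cong>\<^sub>L canon_ext 4"
proof -
  \<comment> \<open>The preimage of \<open>v\<close> is
    \<open>e\<^sub>3 + (1 - p) (e\<^sub>1 - e\<^sub>3)\<close>; this \<open>p\<close> makes it an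
    eigenvector of \<open>e\<^sub>6\<close>. The vector \<open>e\<^sub>1 - e\<^sub>3\<close> is an
    eigenvector already. The other two families for \<open>n = 4\<close> determine \<open>p\<close>
    in the same way.\<close>
  define p where "p = b / (b + 1)"
  have "b + 1 \<noteq> 0" using b by (simp add: add_eq_0_iff2)
  then have "(p * (b + 1)) * t = b * t" for t by (simp add: p_def)
  note p0 = this
  have p: "p * t + b * (p * t) = b * t" for t
    using p0[of t] by (simp add: algebra_simps)
  have T: "l2_table b i j \<in> coord_space (4 + 2)" for i j
    unfolding l2_table_def by (auto intro!: coord_space_intros)
  have L4: "l2_table b i j = L4_table 4 i j" if "i \<in> {1..4}" "j \<in> {1..4}" for i j
    using that by (auto simp: l2_table_def)
  have T': "basis_map 4 p (-1) (-1) (-(b+1)) 0 (l2_table b i j) =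
      canon_br 4 (basis_map 4 p (-1) (-1) (-(b+1)) 0 (bvec i)) (basis_map 4 p (-1) (-1) (-(b+1)) 0 (bvec j)) \<and>
    basis_map 4 p (-1) (-1) (-(b+1)) 0 (l2_table b j i) =
      canon_br 4 (basis_map 4 p (-1) (-1) (-(b+1)) 0 (bvec j)) (basis_map 4 p (-1) (-1) (-(b+1)) 0 (bvec i))"
    if i: "i \<in> {1..4+2}" and j: "j \<in> {4+1, 4+2}" for i j
  proof -
    consider "i = 1" | "i = 2" | "i = 3" | "i = 4" | "i = 5" | "i = 6"
      using i by fastforce
    then show ?thesis using j
      by cases (auto simp: l2_table_def basis_map_linear basis_map_bvec_4 canon_br_bilinear canon_br_uminus
        canon_br_bvec L4_table_def fun_eq_iff algebra_simps p)
  qed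
  have det: "(- 1) * (- (b + 1)) - (- 1) * 0 \<noteq> 0"
    using \<open>b + 1 \<noteq> 0\<close> by (simp only: mult_zero_right mult_minus_left mult_minus_right minus_minus mult_1 diff_zero not_False_eq_True)
  have "table_algebra 6 = table_algebra (4 + 2)" by simp
  then show "fd_algebra (l2 b)" "l2 b \<cong>\<^sub>L canon_ext 4"
    unfolding l2_def
    by (simp_all only:) (rule table_algebra_isomorphic_canon_ext[OF _ _ det T L4 T']; simp)+
qed

text \<open>Here \<open>e\<^sub>5\<close> has the weights (-(c + 2), c - 1) and
  \<open>e\<^sub>6\<close> has (-1, -1). Up to sign, both the determinant and the gap between the
  weights of \<open>e\<^sub>5\<close> equal \<open>2 * c + 1\<close>; the gap is what allows solving
  for \<open>p\<close>.\<close>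

lemma l3_isomorphic_canon_ext:
  assumes c: "2 * c + 1 \<noteq> 0"
  shows "fd_algebra (l3 c)" "l3 c \<cong>\<^sub>L canon_ext 4"
proof -
  define p where "p = (c + 1) / (2 * c + 1)"
  have "(p * (2 * c + 1)) * t = (c + 1) * t" for t using c by (simp add: p_def)
  note p0 = this
  have p: "p * t + c * (p * (2 * t)) = t + c * t" for t
    using p0[of t] by (simp add: algebra_simps)
  have T: "l3_table c i j \<in> coord_space (4 + 2)" for i j
    unfolding l3_table_def by (auto intro!: coord_space_intros)
  have L4: "l3_table c i j = L4_table 4 i j" if "i \<in> {1..4}" "j \<in> {1..4}" for i j
    using that by (auto simp: l3_table_def)
  have T': "basis_map 4 p (-(c+2)) (c-1) (-1) (-1) (l3_table c i j) =
      canon_br 4 (basis_map 4 p (-(c+2)) (c-1) (-1) (-1) (bvec i)) (basis_map 4 p (-(c+2)) (c-1) (-1) (-1) (bvec j)) \<and>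
    basis_map 4 p (-(c+2)) (c-1) (-1) (-1) (l3_table c j i) =
      canon_br 4 (basis_map 4 p (-(c+2)) (c-1) (-1) (-1) (bvec j)) (basis_map 4 p (-(c+2)) (c-1) (-1) (-1) (bvec i))"
    if i: "i \<in> {1..4+2}" and j: "j \<in> {4+1, 4+2}" for i j
  proof -
    consider "i = 1" | "i = 2" | "i = 3" | "i = 4" | "i = 5" | "i = 6"
      using i by fastforce
    then show ?thesis using j
      by cases (auto simp: l3_table_def basis_map_linear basis_map_bvec_4 canon_br_bilinear canon_br_uminus
        canon_br_bvec L4_table_def fun_eq_iff algebra_simps
        intro: p p[symmetric])
  qed
  have det: "(c - 1) * (- 1) - (- (c + 2)) * (- 1) \<noteq> 0"
    using c by (simp add: algebra_simps) (metis add.commute add_eq_0_iff2 mult_2_right)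
  have "table_algebra 6 = table_algebra (4 + 2)" by simp
  then show "fd_algebra (l3 c)" "l3 c \<cong>\<^sub>L canon_ext 4"
    unfolding l3_def
    by (simp_all only:) (rule table_algebra_isomorphic_canon_ext[OF _ _ det T L4 T']; simp)+
qed

text \<open>Here \<open>e\<^sub>5\<close> has the weights (-1, -1) and \<open>e\<^sub>6\<close> has
  (-1, 1 - b), with determinant \<open>2 - b\<close>.\<close>

lemma l4_isomorphic_canon_ext:
  assumes b: "b \<noteq> 2"
  shows "fd_algebra (l4 b)" "l4 b \<cong>\<^sub>L canon_ext 4"
proof -
  define p where "p = (1 - b) / (2 - b)"
  have "(p * (2 - b)) * t = (1 - b) * t" for t using b by (simp add: p_def)
  note p0 = this
  have p: "b * t + p * (2 * t) = t + b * (p * t)" for t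
    using p0[of t] by (simp add: algebra_simps)
  have T: "l4_table b i j \<in> coord_space (4 + 2)" for i j
    unfolding l4_table_def by (auto intro!: coord_space_intros)
  have L4: "l4_table b i j = L4_table 4 i j" if "i \<in> {1..4}" "j \<in> {1..4}" for i j
    using that by (auto simp: l4_table_def)
  have T': "basis_map 4 p (-1) (-1) (-1) (1-b) (l4_table b i j) =
      canon_br 4 (basis_map 4 p (-1) (-1) (-1) (1-b) (bvec i)) (basis_map 4 p (-1) (-1) (-1) (1-b) (bvec j)) \<and>
    basis_map 4 p (-1) (-1) (-1) (1-b) (l4_table b j i) =
      canon_br 4 (basis_map 4 p (-1) (-1) (-1) (1-b) (bvec j)) (basis_map 4 p (-1) (-1) (-1) (1-b) (bvec i))"
    if i: "i \<in> {1..4+2}" and j: "j \<in> {4+1, 4+2}" for i j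
  proof -
    consider "i = 1" | "i = 2" | "i = 3" | "i = 4" | "i = 5" | "i = 6"
      using i by fastforce
    then show ?thesis using j
      by cases (auto simp: l4_table_def basis_map_linear basis_map_bvec_4 canon_br_bilinear canon_br_uminus
        canon_br_bvec L4_table_def fun_eq_iff algebra_simps
        intro: p p[symmetric])
  qed
  have det: "(- 1) * (- 1) - (- 1) * (1 - b) \<noteq> 0"
    using b by simp
  have "table_algebra 6 = table_algebra (4 + 2)" by simp
  then show "fd_algebra (l4 b)" "l4 b \<cong>\<^sub>L canon_ext 4"
    unfolding l4_def
    by (simp_all only:) (rule table_algebra_isomorphic_canon_ext[OF _ _ det T L4 T']; simp)+
qed

section \<open>Nil-independence and the excluded parameter values\<close>

lemma table_algebra_bracket_bvec_left:
  assumes "i \<in> {1..m}"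
  shows "bracket (table_algebra m T) (bvec i) y = (\<Sum>j=1..m. y j \<cdot> T i j)"
proof -
  have "(\<Sum>j=1..m. (bvec i k * y j) \<cdot> T k j) = (if k = i then \<Sum>j=1..m. y j \<cdot> T i j else 0)" for k
    by (simp add: bvec_def)
  then have "bracket (table_algebra m T) (bvec i) y
      = (\<Sum>k=1..m. if k = i then \<Sum>j=1..m. y j \<cdot> T i j else 0)"
    unfolding table_algebra_def by simp
  then show ?thesis using assms by simp
qed

lemma atLeastAtMost_1_6: "{1..6::nat} = {1,2,3,4,5,6}"
  by auto

lemma nil_independentD:
  assumes "nil_independent A" "\<And>v. \<alpha> \<cdot> bracket A (bvec 5) v + \<beta> \<cdot> bracket A (bvec 6) v = T v"
    "\<And>x. (T ^^ k) x = 0"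
  shows "\<alpha> = 0 \<and> \<beta> = 0"
proof -
  have "T = (\<lambda>v. \<alpha> \<cdot> bracket A (bvec 5) v + \<beta> \<cdot> bracket A (bvec 6) v)" using assms(2) by auto
  then have "\<forall>x\<in>carr (L4 4). ((\<lambda>v. \<alpha> \<cdot> bracket A (bvec 5) v + \<beta> \<cdot> bracket A (bvec 6) v) ^^ k) x = 0"
    using assms(3) by simp
  then show ?thesis using assms(1) unfolding nil_independent_def by blast
qed

text \<open>At \<open>c = -1/2\<close> both weights of \<open>e\<^sub>5\<close> are -3/2 and it acts
  on \<open>e\<^sub>1\<close>, \<open>e\<^sub>3\<close> by a Jordan block. Adding -3/2 times
  \<open>e\<^sub>6\<close> removes the weights and leaves an operator of rank one with square
  zero.\<close>

lemma l3_admissible_imp: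
  assumes "l3_admissible c"
  shows "2 * c + 1 \<noteq> 0"
proof
  assume "2 * c + 1 = 0"
  then have c: "c = - (1/2)" by (simp add: add_eq_0_iff2 divide_simps mult.commute)
  have L: "bracket (l3 c) (bvec 5) v = (\<Sum>j=1..6. v j \<cdot> l3_table c 5 j)"
    "bracket (l3 c) (bvec 6) v = (\<Sum>j=1..6. v j \<cdot> l3_table c 6 j)" for v
    unfolding l3_def by (rule table_algebra_bracket_bvec_left; simp)+
  have "1 \<cdot> bracket (l3 c) (bvec 5) v + (- (3/2)) \<cdot> bracket (l3 c) (bvec 6) v
      = ((v 1 + v 3) / 2) \<cdot> (bvec 1 - bvec 3)" for v
    unfolding L atLeastAtMost_1_6
    by (auto simp: l3_table_def fun_eq_iff bvec_def c algebra_simps)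
  moreover have "((\<lambda>v::nat \<Rightarrow> complex. ((v 1 + v 3) / 2) \<cdot> (bvec 1 - bvec 3)) ^^ 2) x = 0" for x
    by (simp add: numeral_2_eq_2 bvec_def)
  moreover have "nil_independent (l3 c)" using assms by (simp add: l3_admissible_def)
  ultimately have "(1::complex) = 0 \<and> (- (3/2)) = (0::complex)" by (rule nil_independentD[rotated])
  then show False by simp
qed

text \<open>At \<open>b = 2\<close> both \<open>e\<^sub>5\<close> and \<open>e\<^sub>6\<close> have
  the weights (-1, -1), so their difference acts nilpotently.\<close>

lemma l4_admissible_imp:
  assumes "l4_admissible b"
  shows "b \<noteq> 2"
proof
  assume b: "b = 2"
  have L: "bracket (l4 b) (bvec 5) v = (\<Sum>j=1..6. v j \<cdot> l4_table b 5 j)"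
    "bracket (l4 b) (bvec 6) v = (\<Sum>j=1..6. v j \<cdot> l4_table b 6 j)" for v
    unfolding l4_def by (rule table_algebra_bracket_bvec_left; simp)+
  have "1 \<cdot> bracket (l4 b) (bvec 5) v + (- 1) \<cdot> bracket (l4 b) (bvec 6) v
      = (v 1 + v 3) \<cdot> (bvec 1 - bvec 3)" for v
    unfolding L atLeastAtMost_1_6
    by (auto simp: l4_table_def fun_eq_iff bvec_def b algebra_simps)
  moreover have "((\<lambda>v::nat \<Rightarrow> complex. (v 1 + v 3) \<cdot> (bvec 1 - bvec 3)) ^^ 2) x = 0" for x
    by (simp add: numeral_2_eq_2 bvec_def)
  moreover have "nil_independent (l4 b)" using assms by (simp add: l4_admissible_def)
  ultimately have "(1::complex) = 0 \<and> (- 1) = (0::complex)" by (rule nil_independentD[rotated])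
  then show False by simp
qed

text \<open>Provides the representative of the classification for \<open>n = 4\<close>. On the
  coordinates 1 and 3 a combination acts triangularly with diagonal entries
  \<open>- (\<alpha> + \<beta>)\<close> and \<open>- \<alpha>\<close>, and nilpotency makes both
  vanish.\<close>

lemma l2_0_admissible: "l2_admissible 0"
proof -
  have "\<alpha> = 0 \<and> \<beta> = 0"
    if k: "\<forall>x\<in>carr (L4 4).
       ((\<lambda>v. \<alpha> \<cdot> bracket (l2 0) (bvec 5) v + \<beta> \<cdot> bracket (l2 0) (bvec 6) v) ^^ k) x = 0" for \<alpha> \<beta> k
  proof -
    define T where "T = (\<lambda>v. \<alpha> \<cdot> bracket (l2 0) (bvec 5) v + \<beta> \<cdot> bracket (l2 0) (bvec 6) v)"
    have carr: "carr (L4 4) = coord_space 4" by (simp add: L4_def table_algebra_def)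
    have L: "bracket (l2 0) (bvec 5) v = (\<Sum>j=1..6. v j \<cdot> l2_table 0 5 j)"
      "bracket (l2 0) (bvec 6) v = (\<Sum>j=1..6. v j \<cdot> l2_table 0 6 j)" for v
      unfolding l2_def by (rule table_algebra_bracket_bvec_left; simp)+
    have T: "T v (Suc 0) = - (\<alpha> + \<beta>) * v (Suc 0) - \<beta> * v 3" "T v 3 = - \<alpha> * v 3" for v
      unfolding T_def L atLeastAtMost_1_6
      by (simp_all add: l2_table_def bvec_def algebra_simps)
    have "(T ^^ j) (bvec 3) 3 = (- \<alpha>) ^ j" for j
      by (induction j) (simp_all add: T bvec_def)
    moreover have "(T ^^ k) (bvec 3) = 0" using k unfolding carr T_def by (simp add: bvec_in_coord_space)
    ultimately have "(- \<alpha>) ^ k = 0" by (metis zero_fun_apply)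
    then have "\<alpha> = 0" by (metis neg_equal_0_iff_equal power_eq_0_iff)
    have "(T ^^ j) (bvec 1) (Suc 0) = (- (\<alpha> + \<beta>)) ^ j \<and> (T ^^ j) (bvec 1) 3 = 0" for j
      by (induction j) (simp_all add: T bvec_def)
    moreover have "(T ^^ k) (bvec 1) = 0" using k unfolding carr T_def by (simp add: bvec_in_coord_space)
    ultimately have "(- (\<alpha> + \<beta>)) ^ k = 0" by (metis zero_fun_apply)
    then have "\<alpha> + \<beta> = 0" by (metis neg_equal_0_iff_equal power_eq_0_iff)
    then show ?thesis using \<open>\<alpha> = 0\<close> by simp
  qed
  then have "nil_independent (l2 0)" unfolding nil_independent_def by blast
  then show ?thesis by (simp add: l2_admissible_def)
qed

section \<open>Derivations of the nilradical\<close>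

lemma canon_br_coord_space:
  assumes "x \<in> coord_space n" "y \<in> coord_space n" "4 \<le> n"
  shows "canon_br n x y (Suc 0) = 0" "canon_br n x y 2 = x 3 * y 3" "canon_br n x y 3 = 0"
    "4 \<le> k \<Longrightarrow> k \<le> n \<Longrightarrow> canon_br n x y k = x (k - 1) * y 1 - x 1 * y (k - 1)"
  using assms by (simp_all add: canon_br_eqs coord_spaceD)

lemma bvec_apply: "bvec i j = (if j = i then 1 else 0)"
  by (simp add: bvec_def)

definition weight_v :: "((nat \<Rightarrow> complex) \<Rightarrow> nat \<Rightarrow> complex) \<Rightarrow> complex" where
  "weight_v D = D (bvec 3) 3"

definition weight_w :: "((nat \<Rightarrow> complex) \<Rightarrow> nat \<Rightarrow> complex) \<Rightarrow> complex" where
  "weight_w D = D (bvec 1) 1"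

text \<open>The flag and the weights on its successive quotients belong to the order 3, 1, 4, ..., n, 2 of
  the coordinates, in which derivations are triangular.\<close>

definition flag :: "nat \<Rightarrow> nat \<Rightarrow> (nat \<Rightarrow> complex) set" where
  "flag n i = {x \<in> coord_space n. \<forall>k\<in>{k. k = 3 \<and> 1 \<le> i \<or> k = 1 \<and> 2 \<le> i \<or> 4 \<le> k \<and> k \<le> i + 1 \<or> k = 2 \<and> n \<le> i}. x k = 0}"

definition flag_index :: "nat \<Rightarrow> nat \<Rightarrow> nat" where
  "flag_index n i = (if i = 0 then 3 else if i = 1 then 1 else if i = n - 1 then 2 else i + 2)"

definition flag_weight :: "nat \<Rightarrow> ((nat \<Rightarrow> complex) \<Rightarrow> nat \<Rightarrow> complex) \<Rightarrow> nat \<Rightarrow> complex" where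
  "flag_weight n D i = (if i = 0 then weight_v D else if i = 1 then weight_w D else if i = n - 1 then 2 * weight_v D
    else weight_v D + of_nat (i - 1) * weight_w D)"

text \<open>The laws are required only on \<open>coord_space n\<close>: the derivations that occur
  are left multiplications pulled back along an embedding, and they have a meaning only
  there.\<close>

locale coord_derivation =
  fixes n :: nat and D :: "(nat \<Rightarrow> complex) \<Rightarrow> nat \<Rightarrow> complex"
  assumes n: "4 \<le> n"
    and D_closed: "x \<in> coord_space n \<Longrightarrow> D x \<in> coord_space n"
    and D_add: "x \<in> coord_space n \<Longrightarrow> y \<in> coord_space n \<Longrightarrow> D (x + y) = D x + D y"
    and D_scale: "x \<in> coord_space n \<Longrightarrow> D (c \<cdot> x) = c \<cdot> D x"
    and D_canon_br: "x \<in> coord_space n \<Longrightarrow> y \<in> coord_space n \<Longrightarrow> D (canon_br n x y) = canon_br n (D x) y + canon_br n x (D y)"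
begin

lemma D_zero: "D 0 = 0"
  using D_scale[of 0 0] coord_space_zero by simp

lemma D_diff: "x \<in> coord_space n \<Longrightarrow> y \<in> coord_space n \<Longrightarrow> D (x - y) = D x - D y"
  using D_add[of "x - y" y] coord_space_diff by simp

lemma D_uminus: "x \<in> coord_space n \<Longrightarrow> D (- x) = - D x"
  using D_scale[of x "-1"] by simp

lemma D_sum: "(\<And>i. i \<in> I \<Longrightarrow> g i \<in> coord_space n) \<Longrightarrow> D (sum g I) = (\<Sum>i\<in>I. D (g i))"
proof (induction I rule: infinite_finite_induct)
  case (insert i I)
  then have "sum g I \<in> coord_space n" by (intro cs.subspace_sum[OF subspace_coord_space]) simp
  then have "D (g i + sum g I) = D (g i) + (\<Sum>i\<in>I. D (g i))"
    using insert.IH insert.prems D_add[of "g i" "sum g I"] by auto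
  then show ?case unfolding sum.insert[OF insert.hyps] .
qed (simp_all add: D_zero)

lemma D_expand:
  assumes "x \<in> coord_space n"
  shows "D x j = (\<Sum>k=1..n. x k * D (bvec k) j)"
proof -
  have bvec_mem: "bvec k \<in> coord_space n" if "k \<in> {1..n}" for k using that by (rule bvec_in_coord_space)
  have "D x = D (\<Sum>k=1..n. x k \<cdot> bvec k)" using coord_space_expand[OF assms] by simp
  also have "\<dots> = (\<Sum>k=1..n. x k \<cdot> D (bvec k))"
    by (subst D_sum) (auto simp: bvec_mem D_scale coord_space_cscale intro!: sum.cong)
  finally show ?thesis by (simp add: sum_fun_apply)
qed

lemma D_expand_single:
  assumes "x \<in> coord_space n" "m \<in> {1..n}"
    "\<And>k. k \<in> {1..n} \<Longrightarrow> k \<noteq> m \<Longrightarrow> x k * D (bvec k) j = 0"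
  shows "D x j = x m * D (bvec m) j"
proof -
  have "D x j = (\<Sum>k=1..n. if k = m then x m * D (bvec m) j else 0)"
    unfolding D_expand[OF assms(1)] using assms(3) by (intro sum.cong) auto
  then show ?thesis using assms(2) by simp
qed

lemma bvec_mem: "bvec 1 \<in> coord_space n" "bvec (Suc 0) \<in> coord_space n" "bvec 2 \<in> coord_space n"
  "bvec 3 \<in> coord_space n" "4 \<le> k \<Longrightarrow> k \<le> n \<Longrightarrow> bvec k \<in> coord_space n"
  using n by (simp_all add: bvec_in_coord_space)

lemma D_bvec_mem: "D (bvec 1) \<in> coord_space n" "D (bvec (Suc 0)) \<in> coord_space n" "D (bvec 2) \<in> coord_space n"
  "D (bvec 3) \<in> coord_space n" "4 \<le> k \<Longrightarrow> k \<le> n \<Longrightarrow> D (bvec k) \<in> coord_space n"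
  using bvec_mem D_closed by simp_all

lemma D_bvec_4: "D (bvec 4) = canon_br n (D (bvec 3)) (bvec 1) + canon_br n (bvec 3) (D (bvec 1))"
  using D_canon_br[OF bvec_mem(4) bvec_mem(1)] n by (simp add: canon_br_bvec)

lemma D_bvec_Suc:
  assumes "4 \<le> k" "k < n"
  shows "D (bvec (Suc k)) = canon_br n (D (bvec k)) (bvec 1) + canon_br n (bvec k) (D (bvec 1))"
  using D_canon_br[OF bvec_mem(5)[of k] bvec_mem(1)] assms by (simp add: canon_br_bvec)

text \<open>The brackets \<open>[v, w]\<close> and \<open>[w, v]\<close> are opposite, but a
  component of \<open>D w\<close> along \<open>v\<close> would add the same multiple of
  \<open>[v, v] = z\<close> to the derivative of each. That component equals its own
  negative.\<close>

lemma D_bvec_1_3: "D (bvec 1) 3 = 0"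
proof -
  have "- D (bvec 4) = canon_br n (D (bvec 1)) (bvec 3) + canon_br n (bvec 1) (D (bvec 3))"
    using D_canon_br[OF bvec_mem(1) bvec_mem(4)] D_uminus[OF bvec_mem(5)[of 4]] n by (simp add: canon_br_bvec)
  from fun_cong[OF this, of 2] fun_cong[OF D_bvec_4, of 2] show ?thesis
    using bvec_mem D_bvec_mem n by (simp add: canon_br_coord_space bvec_apply add_eq_0_iff2)
qed

lemma D_bvec_2: "D (bvec 2) = (2 * weight_v D) \<cdot> bvec 2"
proof
  fix j
  have *: "D (bvec 2) = canon_br n (D (bvec 3)) (bvec 3) + canon_br n (bvec 3) (D (bvec 3))"
    using D_canon_br[OF bvec_mem(4) bvec_mem(4)] n by (simp add: canon_br_bvec)
  have "j = 1 \<or> j = 2 \<or> j = 3 \<or> 4 \<le> j \<and> j \<le> n \<or> (j = 0 \<or> n < j)" by presburger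
  then consider "j = 1" | "j = 2" | "j = 3" | "4 \<le> j" "j \<le> n" | "j = 0 \<or> n < j" by blast
  then show "D (bvec 2) j = ((2 * weight_v D) \<cdot> bvec 2) j"
  proof cases
    case 5
    then show ?thesis using coord_spaceD[OF D_bvec_mem(3), of j] n by (auto simp: bvec_apply)
  qed (use bvec_mem D_bvec_mem n in \<open>simp_all add: * canon_br_coord_space bvec_apply weight_v_def\<close>)
qed

text \<open>Induction along the chain: bracketing with \<open>w\<close> moves the leading coordinate
  up by one and adds one \<open>weight_w D\<close>.\<close>

lemma D_bvec_ge_4:
  assumes "4 \<le> k" "k \<le> n"
  shows "D (bvec k) k = weight_v D + of_nat (k - 3) * weight_w D \<and> (\<forall>j<k. D (bvec k) j = 0)"
  using assms
proof (induction k rule: dec_induct)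
  case base
  have "D (bvec 4) j = 0" if "j < 4" for j
  proof -
    consider "j = 0" | "j = 1" | "j = 2" | "j = 3" using \<open>j < 4\<close> by linarith
    then show ?thesis
      by cases (use bvec_mem D_bvec_mem n coord_spaceD[OF D_bvec_mem(5)[of 4], of 0] in
        \<open>simp_all add: D_bvec_4 canon_br_coord_space bvec_apply D_bvec_1_3[simplified] canon_br_eqs(6)\<close>)
  qed
  moreover have "D (bvec 4) 4 = weight_v D + weight_w D"
    using bvec_mem D_bvec_mem n unfolding D_bvec_4 by (simp add: canon_br_coord_space bvec_apply weight_v_def weight_w_def)
  ultimately show ?case by simp
next
  case (step k)
  then have IH: "D (bvec k) k = weight_v D + of_nat (k - 3) * weight_w D" "\<And>j. j < k \<Longrightarrow> D (bvec k) j = 0" by auto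
  have k: "4 \<le> k" "k < n" using step by auto
  have "D (bvec (Suc k)) j = 0" if "j < Suc k" for j
  proof -
    have "j = 0 \<or> j = 1 \<or> j = 2 \<or> j = 3 \<or> 4 \<le> j \<and> j \<le> n"
      using \<open>j < Suc k\<close> k by presburger
    then consider "j = 0" | "j = 1" | "j = 2" | "j = 3" | "4 \<le> j" "j \<le> n" by blast
    then show ?thesis
    proof cases
      case 5
      then have "D (bvec k) (j - 1) = 0" "bvec k (j - 1) = 0" using IH(2) \<open>j < Suc k\<close> k by (auto simp: bvec_apply)
      then show ?thesis unfolding D_bvec_Suc[OF k] using IH(2)[of 1] 5 bvec_mem(1) bvec_mem(5)[of k] D_bvec_mem(1) D_bvec_mem(5)[of k] k n
        by (simp add: canon_br_coord_space bvec_apply)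
    qed (use bvec_mem bvec_mem(5)[of k] D_bvec_mem D_bvec_mem(5)[of k] n k IH(2) in \<open>simp_all add: D_bvec_Suc canon_br_coord_space bvec_apply canon_br_eqs(6)\<close>)
  qed
  moreover have "D (bvec (Suc k)) (Suc k) = weight_v D + of_nat (Suc k - 3) * weight_w D"
    unfolding D_bvec_Suc[OF k] using bvec_mem(1) bvec_mem(5)[of k] D_bvec_mem(1) D_bvec_mem(5)[of k] k n IH(1)
    by (simp add: canon_br_coord_space bvec_apply weight_w_def of_nat_diff algebra_simps)
  ultimately show ?case by simp
qed

lemma subspace_flag: "cs.subspace (flag n i)"
  unfolding flag_def by (rule subspace_vanishing)

lemma flag_coord_space: "x \<in> flag n i \<Longrightarrow> x \<in> coord_space n"
  by (simp add: flag_def)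

lemma flag_0: "flag n 0 = coord_space n"
  using n by (auto simp: flag_def)

lemma flag_n: "flag n n = {0}"
proof -
  have "x = 0" if x: "x \<in> flag n n" for x
  proof
    fix k
    have "k = 0 \<or> n < k \<or> (k = 3 \<or> k = 1 \<or> 4 \<le> k \<and> k \<le> n + 1 \<or> k = 2)" by presburger
    then show "x k = 0 k" using x n coord_spaceD[of x n k] by (auto simp: flag_def)
  qed
  then show ?thesis using cs.subspace_0[OF subspace_flag] by blast
qed

lemma flag_SucI:
  assumes x: "x \<in> flag n i" and 0: "x (flag_index n i) = 0" and i: "i < n"
  shows "x \<in> flag n (Suc i)"
proof -
  have old: "x k = 0" if "k = 3 \<and> 1 \<le> i \<or> k = 1 \<and> 2 \<le> i \<or> 4 \<le> k \<and> k \<le> i + 1 \<or> k = 2 \<and> n \<le> i" for k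
    using x that unfolding flag_def by blast
  have "x k = 0"
    if "k = 3 \<and> 1 \<le> Suc i \<or> k = 1 \<and> 2 \<le> Suc i \<or> 4 \<le> k \<and> k \<le> Suc i + 1 \<or> k = 2 \<and> n \<le> Suc i" for k
  proof -
    from that consider "k = 3" | "k = 1" "1 \<le> i" | "4 \<le> k" "k \<le> i + 1" | "4 \<le> k" "k = i + 2" | "k = 2" "i = n - 1"
      using i by fastforce
    then show ?thesis
    proof cases
      case 1
      then show ?thesis using old[of 3] 0 by (cases "i = 0") (simp_all add: flag_index_def)
    next
      case 2
      then show ?thesis using old[of 1] 0 by (cases "i = 1") (simp_all add: flag_index_def)
    next
      case 3
      then show ?thesis using old[of k] by simp
    next
      case 4
      then show ?thesis using 0 i coord_spaceD[OF flag_coord_space[OF x], of k]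
        by (cases "i = n - 1") (simp_all add: flag_index_def)
    next
      case 5
      moreover from this have "flag_index n i = 2" using n by (simp add: flag_index_def)
      ultimately show ?thesis using 0 by simp
    qed
  qed
  then show ?thesis using flag_coord_space[OF x] by (simp add: flag_def)
qed

text \<open>Triangularity: the only basis vectors whose images reach the coordinate in question come
  earlier in the order, and their coefficients vanish on \<open>flag n i\<close>, except for the
  diagonal term.\<close>

lemma D_flag:
  assumes x: "x \<in> flag n i" and i: "i < n"
  shows "D x - flag_weight n D i \<cdot> x \<in> flag n (Suc i)"
proof -
  have xc: "x \<in> coord_space n" using x by (rule flag_coord_space)
  have x0: "x k = 0" if "k = 3 \<and> 1 \<le> i \<or> k = 1 \<and> 2 \<le> i \<or> 4 \<le> k \<and> k \<le> i + 1 \<or> k = 2 \<and> n \<le> i" for k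
    using x that unfolding flag_def by blast
  have range: "k = 1 \<or> k = 2 \<or> k = 3 \<or> 4 \<le> k \<and> k \<le> n" if "k \<in> {1..n}" for k :: nat
    using that unfolding atLeastAtMost_iff by presburger
  have cases: thesis if "k \<in> {1..n}" "k = 1 \<Longrightarrow> thesis" "k = 2 \<Longrightarrow> thesis" "k = 3 \<Longrightarrow> thesis"
    "4 \<le> k \<Longrightarrow> k \<le> n \<Longrightarrow> thesis" for k thesis
    using range[OF that(1)] that by blast
  have "D x 3 = x 3 * D (bvec 3) 3"
  proof (rule D_expand_single[OF xc])
    fix j assume j: "j \<in> {1..n}" "j \<noteq> 3"
    from j(1) show "x j * D (bvec j) 3 = 0"
      by (rule cases) (use j(2) D_bvec_1_3 D_bvec_2 D_bvec_ge_4[of j] in \<open>simp_all add: bvec_apply\<close>)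
  qed (use n in simp)
  then have D3: "D x 3 = weight_v D * x 3" by (simp add: weight_v_def)
  have D1: "D x 1 = weight_w D * x 1" if "1 \<le> i"
  proof -
    have "D x 1 = x 1 * D (bvec 1) 1"
    proof (rule D_expand_single[OF xc])
      fix j assume j: "j \<in> {1..n}" "j \<noteq> 1"
      from j(1) show "x j * D (bvec j) 1 = 0"
        by (rule cases) (use j(2) x0[of 3] that D_bvec_2 D_bvec_ge_4[of j] in \<open>simp_all add: bvec_apply\<close>)
    qed (use n in simp)
    then show ?thesis by (simp add: weight_w_def)
  qed
  have D2: "D x 2 = (2 * weight_v D) * x 2" if "2 \<le> i"
  proof -
    have "D x 2 = x 2 * D (bvec 2) 2"
    proof (rule D_expand_single[OF xc])
      fix j assume j: "j \<in> {1..n}" "j \<noteq> 2"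
      from j(1) show "x j * D (bvec j) 2 = 0"
        by (rule cases) (use j(2) x0[of 3] x0[of 1] that D_bvec_ge_4[of j] in \<open>simp_all\<close>)
    qed (use n in simp)
    then show ?thesis by (simp add: D_bvec_2 bvec_apply)
  qed
  have Dk: "D x k = (weight_v D + of_nat (k - 3) * weight_w D) * x k" if "2 \<le> i" "4 \<le> k" "k \<le> i + 2" "k \<le> n" for k
  proof -
    have "D x k = x k * D (bvec k) k"
    proof (rule D_expand_single[OF xc])
      fix j assume j: "j \<in> {1..n}" "j \<noteq> k"
      from j(1) show "x j * D (bvec j) k = 0"
      proof (rule cases)
        assume "4 \<le> j" "j \<le> n"
        then show ?thesis using that j(2) x0[of j] D_bvec_ge_4[of j] by (cases "j < k") simp_all
      qed (use that x0[of 1] x0[of 3] D_bvec_2 in \<open>simp_all add: bvec_apply\<close>)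
    qed (use that in simp)
    then show ?thesis using D_bvec_ge_4[of k] that by simp
  qed
  have "D x k = flag_weight n D i * x k"
    if "k = 3 \<and> 1 \<le> Suc i \<or> k = 1 \<and> 2 \<le> Suc i \<or> 4 \<le> k \<and> k \<le> Suc i + 1 \<or> k = 2 \<and> n \<le> Suc i" for k
  proof -
    from that have "k = 3 \<or> k = 1 \<and> 1 \<le> i \<or> k = 2 \<and> i = n - 1 \<or> 4 \<le> k \<and> k \<le> i + 2"
      using i by (elim disjE) auto
    then consider "k = 3" | "k = 1" "1 \<le> i" | "k = 2" "i = n - 1" | "4 \<le> k" "k \<le> i + 2" by blast
    then consider "k = 3" | "k = 1" "1 \<le> i" | "k = 2" "i = n - 1" | "4 \<le> k" "k \<le> i + 1" "k \<le> n"
      | "k = i + 2" "4 \<le> k" "k \<le> n" | "4 \<le> k" "n < k"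
      by cases (blast, blast, blast, linarith)
    then show ?thesis
    proof cases
      case 1
      then show ?thesis using D3 x0[of 3] by (auto simp: flag_weight_def)
    next
      case 2
      then show ?thesis using D1 x0[of 1] by (cases "i = 1") (auto simp: flag_weight_def)
    next
      case 3
      then show ?thesis using D2 n by (auto simp: flag_weight_def)
    next
      case 4
      then show ?thesis using Dk[of k] x0[of k] by auto
    next
      case 5
      then show ?thesis using Dk[of k] n by (auto simp: flag_weight_def)
    next
      case 6
      then show ?thesis using coord_spaceD[OF xc, of k] coord_spaceD[OF D_closed[OF xc], of k] by simp
    qed
  qed
  moreover have "D x - flag_weight n D i \<cdot> x \<in> coord_space n"
    using xc by (intro coord_space_diff coord_space_cscale D_closed)
  ultimately show ?thesis unfolding flag_def by (simp only: mem_Collect_eq) (simp add: cscale_apply)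
qed

lemma D_flag_weight_zero:
  assumes "x \<in> flag n i" "i < n" "weight_v D = 0" "weight_w D = 0"
  shows "D x \<in> flag n (Suc i)"
  using D_flag[OF assms(1,2)] assms(3,4) by (simp add: flag_weight_def split: if_splits)

text \<open>Back substitution for a triangular operator. Only the weights from position
  \<open>i\<close> on must avoid \<mu>, so \<mu> may itself be a weight at an earlier
  position.\<close>

lemma solve_in_flag:
  assumes "r \<in> flag n i" "i \<le> n" "\<And>j. i \<le> j \<Longrightarrow> j < n \<Longrightarrow> flag_weight n D j \<noteq> \<mu>"
  shows "\<exists>u\<in>flag n i. D u - \<mu> \<cdot> u = r"
  using assms(2,1,3)
proof (induction i arbitrary: r rule: inc_induct)
  case base
  then have "r = 0" by (simp add: flag_n)
  then have "D 0 - \<mu> \<cdot> 0 = r" by (simp only: D_zero cs.scale_zero_right diff_self)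
  then show ?case using cs.subspace_0[OF subspace_flag] by (rule bexI)
next
  case (step i)
  have ne: "flag_weight n D i - \<mu> \<noteq> 0" using step by auto
  \<comment> \<open>This choice is correct up to an error in the next flag; \<open>w\<close>
    corrects the error.\<close>
  define u where "u = (1 / (flag_weight n D i - \<mu>)) \<cdot> r"
  have u: "u \<in> flag n i" unfolding u_def using step.prems(1) subspace_flag by (intro cs.subspace_scale)
  have r: "r = (flag_weight n D i - \<mu>) \<cdot> u" using ne by (simp add: u_def)
  have "D u - flag_weight n D i \<cdot> u \<in> flag n (Suc i)" using u step.hyps by (intro D_flag)
  then obtain w where w: "w \<in> flag n (Suc i)" "D w - \<mu> \<cdot> w = D u - flag_weight n D i \<cdot> u"
    using step.IH[of "D u - flag_weight n D i \<cdot> u"] step.prems by (metis Suc_leD)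
  have wi: "w \<in> flag n i" using w(1) by (auto simp: flag_def)
  have "D (u - w) = D u - D w" using u w(1) by (intro D_diff flag_coord_space)
  moreover have "D w = D u - flag_weight n D i \<cdot> u + \<mu> \<cdot> w" using w(2) by (metis diff_add_cancel)
  ultimately have "D (u - w) - \<mu> \<cdot> (u - w) = r"
    unfolding r cs.scale_right_diff_distrib cs.scale_left_diff_distrib by simp
  moreover have "u - w \<in> flag n i" using u wi subspace_flag by (intro cs.subspace_diff)
  ultimately show ?case by blast
qed

text \<open>The injective counterpart of \<open>solve_in_flag\<close>. Starting at position 1 or 2
  it shows that eigenvectors are unique up to scaling, after a multiple of a known one has been
  subtracted.\<close>

lemma eigenvector_in_flag:
  assumes "x \<in> flag n i" "i \<le> n" "\<And>j. i \<le> j \<Longrightarrow> j < n \<Longrightarrow> flag_weight n D j \<noteq> \<mu>" "D x = \<mu> \<cdot> x"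
  shows "x = 0"
  using assms(2,1,3,4)
proof (induction i rule: inc_induct)
  case base
  then show ?case by (simp add: flag_n)
next
  case (step i)
  have "D x - flag_weight n D i \<cdot> x \<in> flag n (Suc i)" using step by (intro D_flag)
  moreover have "D x - flag_weight n D i \<cdot> x = (\<mu> - flag_weight n D i) \<cdot> x"
    unfolding step.prems(3) by (simp add: cs.scale_left_diff_distrib)
  moreover have "\<mu> - flag_weight n D i \<noteq> 0" using step by auto
  ultimately have "(1 / (\<mu> - flag_weight n D i)) \<cdot> ((\<mu> - flag_weight n D i) \<cdot> x) \<in> flag n (Suc i)"
    using subspace_flag cs.subspace_scale by metis
  then have "x \<in> flag n (Suc i)" using \<open>\<mu> - flag_weight n D i \<noteq> 0\<close> by simp
  then show ?case using step by auto
qed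

lemma D_coord_3: "x \<in> coord_space n \<Longrightarrow> D x 3 = weight_v D * x 3"
  using D_flag[of x 0] n by (simp add: flag_0) (simp add: flag_def flag_weight_def)

lemma D_coord_1: "x \<in> coord_space n \<Longrightarrow> x 3 = 0 \<Longrightarrow> D x 1 = weight_w D * x 1"
proof -
  assume x: "x \<in> coord_space n" "x 3 = 0"
  have "x \<in> flag n 1"
    by (rule flag_SucI[of x 0, folded One_nat_def]) (use x n in \<open>simp_all add: flag_0 flag_index_def\<close>)
  then have "D x - flag_weight n D 1 \<cdot> x \<in> flag n 2" using D_flag[of x 1] n by (simp add: numeral_2_eq_2)
  then show "D x 1 = weight_w D * x 1" unfolding flag_def by (auto simp: flag_weight_def)
qed

end

section \<open>Extensions of the nilradical\<close>

lemma (in fd_algebra) independent_card_spans: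
  assumes "independent B" "B \<subseteq> carr A" "finite B" "card B = alg_dim A"
  shows "carr A \<subseteq> span B"
proof (rule subsetI, rule ccontr)
  fix x assume x: "x \<in> carr A" "x \<notin> span B"
  obtain S where S: "S \<subseteq> carr A" "independent S" "carr A \<subseteq> span S" "card S = dim (carr A)"
    using basis_exists by blast
  obtain F where "finite F" "carr A \<subseteq> span F" using finite_dim by blast
  then have "finite S" using S independent_span_bound by (meson order_trans)
  have "independent (insert x B)" using assms(1) x(2) by (rule independent_insertI[rotated])
  moreover have "insert x B \<subseteq> span S" using assms(2) x(1) S(3) by blast
  ultimately have "card (insert x B) \<le> card S" using independent_span_bound[OF \<open>finite S\<close>] by blast
  moreover have "x \<notin> B" using x(2) span_base by blast
  ultimately show False using assms(3,4) S(4) by (simp add: alg_dim_def)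
qed

text \<open>The nilradical is presented through an embedding \<phi> of the canonical coordinates, so
  that every element of \<open>A\<close> acts on it by an explicit operator
  \<open>act\<close>.\<close>

locale L4_extension = left_leibniz_algebra A
  for A :: "'a::ab_group_add calgebra" and n :: nat and \<phi> :: "(nat \<Rightarrow> complex) \<Rightarrow> 'a" +
  assumes n: "4 \<le> n"
    and phi_add: "x \<in> coord_space n \<Longrightarrow> y \<in> coord_space n \<Longrightarrow> \<phi> (x + y) = \<phi> x + \<phi> y"
    and phi_smul: "x \<in> coord_space n \<Longrightarrow> \<phi> (c \<cdot> x) = smul A c (\<phi> x)"
    and phi_inj: "inj_on \<phi> (coord_space n)"
    and phi_canon_br: "x \<in> coord_space n \<Longrightarrow> y \<in> coord_space n \<Longrightarrow> \<phi> (canon_br n x y) = bracket A (\<phi> x) (\<phi> y)"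
    and max_N: "maximal_nilpotent_ideal A (\<phi> ` coord_space n)"
    and solvable: "solvable_algebra A"
    and dim: "alg_dim A = n + 2"
begin

abbreviation N :: "'a set" where "N \<equiv> \<phi> ` coord_space n"
abbreviation br (infixl "\<bullet>" 70) where "x \<bullet> y \<equiv> bracket A x y"

definition act :: "'a \<Rightarrow> (nat \<Rightarrow> complex) \<Rightarrow> nat \<Rightarrow> complex" where
  "act a x = the_inv_into (coord_space n) \<phi> (a \<bullet> \<phi> x)"

lemma ideal_N: "ideal A N"
  using max_N by (simp add: maximal_nilpotent_ideal_def nilpotent_ideal_def)

lemma subspace_N: "subspace N"
  using ideal_N by (simp add: ideal_def)

lemma N_carr: "a \<in> N \<Longrightarrow> a \<in> carr A"
  using ideal_N by (auto simp: ideal_def)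

lemma phi_N: "x \<in> coord_space n \<Longrightarrow> \<phi> x \<in> N"
  by simp

lemma phi_carr: "x \<in> coord_space n \<Longrightarrow> \<phi> x \<in> carr A"
  using N_carr by simp

lemma N_bracket: "a \<in> carr A \<Longrightarrow> b \<in> N \<Longrightarrow> a \<bullet> b \<in> N" "a \<in> carr A \<Longrightarrow> b \<in> N \<Longrightarrow> b \<bullet> a \<in> N"
  using ideal_N unfolding ideal_def by blast+

lemma phi_eqD: "\<phi> x = \<phi> y \<Longrightarrow> x \<in> coord_space n \<Longrightarrow> y \<in> coord_space n \<Longrightarrow> x = y"
  using phi_inj by (simp add: inj_on_def)

lemma phi_zero: "\<phi> 0 = 0"
  using phi_add[of 0 0] coord_space_zero by simp

lemma phi_uminus: "x \<in> coord_space n \<Longrightarrow> \<phi> (- x) = - \<phi> x"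
  using phi_smul[of x "-1"] by simp

lemma phi_diff: "x \<in> coord_space n \<Longrightarrow> y \<in> coord_space n \<Longrightarrow> \<phi> (x - y) = \<phi> x - \<phi> y"
  using phi_add[of "x - y" y] coord_space_diff[of x n y] by simp

lemma act_closed: "a \<in> carr A \<Longrightarrow> x \<in> coord_space n \<Longrightarrow> act a x \<in> coord_space n"
  unfolding act_def using phi_inj N_bracket(1) by (intro the_inv_into_into) auto

lemma phi_act: "a \<in> carr A \<Longrightarrow> x \<in> coord_space n \<Longrightarrow> \<phi> (act a x) = a \<bullet> \<phi> x"
  unfolding act_def by (rule f_the_inv_into_f[OF phi_inj N_bracket(1)]) simp_all

lemma act_eqI: "a \<in> carr A \<Longrightarrow> x \<in> coord_space n \<Longrightarrow> y \<in> coord_space n \<Longrightarrow> a \<bullet> \<phi> x = \<phi> y \<Longrightarrow> act a x = y"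
  unfolding act_def using phi_inj by (simp add: the_inv_into_f_f)

lemma canon_br_closed: "canon_br n x y \<in> coord_space n"
  using n by (intro canon_br_in_coord_space) simp

lemma act_phi: "x \<in> coord_space n \<Longrightarrow> y \<in> coord_space n \<Longrightarrow> act (\<phi> x) y = canon_br n x y"
  by (intro act_eqI phi_carr canon_br_closed phi_canon_br[symmetric])

lemma act_derivation: "a \<in> carr A \<Longrightarrow> coord_derivation n (act a)"
proof unfold_locales
  assume a: "a \<in> carr A"
  show "4 \<le> n" by (rule n)
  fix x assume x: "x \<in> coord_space n"
  show "act a x \<in> coord_space n" using a x by (rule act_closed)
  show "act a (c \<cdot> x) = c \<cdot> act a x" for c
    by (intro act_eqI a coord_space_cscale act_closed x)
      (simp add: x a phi_smul phi_act act_closed bracket_smul_right phi_carr)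
  fix y assume y: "y \<in> coord_space n"
  show "act a (x + y) = act a x + act a y"
    by (intro act_eqI a coord_space_add act_closed x y)
      (simp add: x y a phi_add phi_act act_closed bracket_add_right phi_carr)
  show "act a (canon_br n x y) = canon_br n (act a x) y + canon_br n x (act a y)"
    by (intro act_eqI a coord_space_add act_closed x y canon_br_closed)
      (simp add: x y a phi_add phi_canon_br phi_act act_closed canon_br_closed left_leibniz phi_carr)
qed

lemma act_add: "a \<in> carr A \<Longrightarrow> b \<in> carr A \<Longrightarrow> x \<in> coord_space n \<Longrightarrow> act (a + b) x = act a x + act b x"
  by (intro act_eqI carr_add coord_space_add act_closed)
    (simp_all add: phi_add phi_act act_closed bracket_add_left phi_carr)

lemma act_smul: "a \<in> carr A \<Longrightarrow> x \<in> coord_space n \<Longrightarrow> act (smul A c a) x = c \<cdot> act a x"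
  by (intro act_eqI carr_smul coord_space_cscale act_closed)
    (simp_all add: phi_smul phi_act act_closed bracket_smul_left phi_carr)

lemma act_bracket: "a \<in> carr A \<Longrightarrow> b \<in> carr A \<Longrightarrow> x \<in> coord_space n \<Longrightarrow>
    act (a \<bullet> b) x = act a (act b x) - act b (act a x)"
  by (intro act_eqI bracket_closed coord_space_diff act_closed)
    (simp_all add: phi_diff phi_act act_closed left_leibniz phi_carr)

section \<open>The two weights as linear functionals on the extension\<close>

abbreviation L :: "'a \<Rightarrow> complex" where "L a \<equiv> weight_v (act a)"
abbreviation M :: "'a \<Rightarrow> complex" where "M a \<equiv> weight_w (act a)"

lemma bvec_mem: "bvec 1 \<in> coord_space n" "bvec 2 \<in> coord_space n" "bvec 3 \<in> coord_space n"
  "4 \<le> k \<Longrightarrow> k \<le> n \<Longrightarrow> bvec k \<in> coord_space n"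
  using n by (simp_all add: bvec_in_coord_space)

lemma weights_linear:
  "a \<in> carr A \<Longrightarrow> b \<in> carr A \<Longrightarrow> L (a + b) = L a + L b"
  "a \<in> carr A \<Longrightarrow> b \<in> carr A \<Longrightarrow> M (a + b) = M a + M b"
  "a \<in> carr A \<Longrightarrow> L (smul A c a) = c * L a"
  "a \<in> carr A \<Longrightarrow> M (smul A c a) = c * M a"
  by (simp_all add: weight_v_def weight_w_def act_add act_smul bvec_mem bvec_mem[unfolded One_nat_def])

lemma weights_diff:
  assumes "a \<in> carr A" "b \<in> carr A"
  shows "L (a - b) = L a - L b" "M (a - b) = M a - M b"
  using weights_linear(1,2)[of "a - b" b] assms carr_diff[of a b] by simp_all

text \<open>By the Leibniz identity \<open>a \<bullet> b\<close> acts as a commutator of two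
  triangular operators, whose diagonal entries cancel.\<close>

lemma weights_bracket:
  assumes a: "a \<in> carr A" and b': "b \<in> carr A"
  shows "L (a \<bullet> b) = 0" "M (a \<bullet> b) = 0"
proof -
  interpret a: coord_derivation n "act a" using a by (rule act_derivation)
  interpret b: coord_derivation n "act b" using b' by (rule act_derivation)
  show "L (a \<bullet> b) = 0"
    using a b' bvec_mem by (simp add: weight_v_def[of "act (a \<bullet> b)"] act_bracket a.D_coord_3 b.D_coord_3 act_closed bvec_apply)
  show "M (a \<bullet> b) = 0"
    using a b' bvec_mem bvec_mem[unfolded One_nat_def]
    by (simp add: weight_w_def[of "act (a \<bullet> b)"] act_bracket a.D_coord_1[simplified] b.D_coord_1[simplified]
      a.D_coord_3 b.D_coord_3 act_closed bvec_apply)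
qed

lemma weights_N:
  assumes "a \<in> N"
  shows "L a = 0" "M a = 0"
  using assms bvec_mem n by (auto simp: weight_v_def weight_w_def act_phi canon_br_coord_space[simplified])

lemma phi_flag_subspace: "subspace (\<phi> ` flag n i)"
proof (rule subspaceI)
  have F: "cs.subspace (flag n i)" and sub: "x \<in> flag n i \<Longrightarrow> x \<in> coord_space n" for x
    unfolding flag_def by (rule subspace_vanishing) simp
  show "0 \<in> \<phi> ` flag n i" using cs.subspace_0[OF F] phi_zero by (metis image_eqI)
  show "x + y \<in> \<phi> ` flag n i" if "x \<in> \<phi> ` flag n i" "y \<in> \<phi> ` flag n i" for x y
    using that cs.subspace_add[OF F] by (auto simp: phi_add[symmetric] sub)
  show "smul A c x \<in> \<phi> ` flag n i" if "x \<in> \<phi> ` flag n i" for x c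
    using that cs.subspace_scale[OF F] by (auto simp: phi_smul[symmetric] sub)
qed

text \<open>The last hypothesis takes the lower central series of \<open>J\<close> into
  \<open>N\<close> after one step. Operators of weight zero then push it down the flag to 0, so
  \<open>J\<close> is nilpotent and maximality applies.\<close>

lemma nilpotent_ideal_eq_N:
  assumes J: "ideal A J" and NJ: "N \<subseteq> J" and w: "\<And>a. a \<in> J \<Longrightarrow> L a = 0 \<and> M a = 0"
    and JJ: "\<And>a b. a \<in> J \<Longrightarrow> b \<in> J \<Longrightarrow> a \<bullet> b \<in> N"
  shows "J = N"
proof -
  interpret J: fd_algebra "restrict_alg A J" using J by (rule ideal_fd_algebra)
  have Jc: "a \<in> carr A" if "a \<in> J" for a using J that by (auto simp: ideal_def)
  \<comment> \<open>The shift by one accounts for the first product, which only reaches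
    \<open>N\<close>, that is \<open>flag n 0\<close>.\<close>
  have LC: "lower_central (restrict_alg A J) (Suc i) \<subseteq> \<phi> ` flag n i" if "i \<le> n" for i
    using that
  proof (induction i)
    case 0
    have "N = \<phi> ` flag n 0" using coord_derivation.flag_0[OF act_derivation[OF carr_zero]] by simp
    moreover have "lower_central (restrict_alg A J) (Suc 0) \<subseteq> N"
      unfolding lower_central.simps
      by (rule J.bracket_span_subset) (simp_all add: subspace_N JJ)
    ultimately show ?case by simp
  next
    case (Suc i)
    show ?case unfolding lower_central.simps(2)[of _ "Suc i"]
    proof (rule J.bracket_span_subset)
      fix a c assume a: "a \<in> carr (restrict_alg A J)" and "c \<in> lower_central (restrict_alg A J) (Suc i)"
      then obtain x where x: "x \<in> flag n i" "c = \<phi> x" using Suc by auto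
      have a: "a \<in> J" "a \<in> carr A" using a Jc by simp_all
      interpret a: coord_derivation n "act a" using a(2) by (rule act_derivation)
      have "act a x \<in> flag n (Suc i)" using x(1) Suc.prems w[OF a(1)] by (intro a.D_flag_weight_zero) auto
      moreover have "a \<bullet> c = \<phi> (act a x)" using phi_act a x a.flag_coord_space by simp
      ultimately show "bracket (restrict_alg A J) a c \<in> \<phi> ` flag n (Suc i)" by simp
    qed (simp add: phi_flag_subspace)
  qed
  have "flag n n = {0}" by (rule coord_derivation.flag_n[OF act_derivation[OF carr_zero]])
  then have "lower_central (restrict_alg A J) (Suc n) \<subseteq> {0}" using LC[of n] phi_zero by simp
  then have "nilpotent_ideal A J" using J by (rule nilpotent_idealI[rotated])
  then show ?thesis using max_N NJ unfolding maximal_nilpotent_ideal_def by blast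
qed

section \<open>Counting dimensions modulo the nilradical\<close>

lemma N_basis:
  "span ((\<lambda>i. \<phi> (bvec i)) ` {1..n}) = N" "independent ((\<lambda>i. \<phi> (bvec i)) ` {1..n})"
  "card ((\<lambda>i. \<phi> (bvec i)) ` {1..n}) = n"
proof -
  have K: "fd_algebra (canon_ext n)" using n by (intro fd_algebra_canon_ext) simp
  have R: "fd_algebra (restrict_alg (canon_ext n) (coord_space n))"
    using n by (intro fd_algebra.ideal_fd_algebra[OF K] ideal_coord_space_canon_ext) simp
  have S: "fd_algebra (restrict_alg A N)" using ideal_N by (rule ideal_fd_algebra)
  have "alg_iso \<phi> (restrict_alg (canon_ext n) (coord_space n)) (restrict_alg A N)"
    using phi_inj phi_add phi_smul phi_canon_br by (simp add: alg_iso_def bij_betw_def)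
  then interpret I: algebra_iso "restrict_alg (canon_ext n) (coord_space n)" "restrict_alg A N" \<phi>
    by (intro algebra_iso.intro R S algebra_iso_axioms.intro)
  have im: "(\<lambda>i. \<phi> (bvec i)) ` {1..n} = \<phi> ` bvec ` {1..n}" by (simp add: image_image)
  have sub: "bvec ` {1..n} \<subseteq> coord_space n" using bvec_in_coord_space by auto
  show sp: "span ((\<lambda>i. \<phi> (bvec i)) ` {1..n}) = N"
    using I.image_span[of "bvec ` {1..n}"] sub unfolding im by (simp add: coord_space_eq_span)
  have inj: "inj_on \<phi> (bvec ` {1..n})" using phi_inj sub by (rule inj_on_subset)
  show card: "card ((\<lambda>i. \<phi> (bvec i)) ` {1..n}) = n"
    unfolding im using card_image[OF inj] card_image[OF inj_bvec[of "{1..n}"]] by simp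
  show "independent ((\<lambda>i. \<phi> (bvec i)) ` {1..n})"
    using I.independent_image[of "bvec ` {1..n}"] sub independent_bvec unfolding im by simp
qed

lemma N_neq_carr: "N \<noteq> carr A"
proof
  assume "N = carr A"
  then have "alg_dim A = card ((\<lambda>i. \<phi> (bvec i)) ` {1..n})"
    using dim_span_eq_card_independent[OF N_basis(2), unfolded N_basis(1)] by (simp only: alg_dim_def)
  then show False using dim N_basis(3) by simp
qed

lemma carr_decompose:
  assumes p: "p \<in> carr A" "p \<notin> N"
    and q: "q \<in> carr A" "\<And>c. q - smul A c p \<notin> N"
    and a: "a \<in> carr A"
  obtains c d where "a - smul A c p - smul A d q \<in> N"
proof -
  define B where "B = (\<lambda>i. \<phi> (bvec i)) ` {1..n}"
  have B: "span B = N" "independent B" "card B = n" "finite B" using N_basis by (simp_all add: B_def)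
  have Bc: "B \<subseteq> carr A" using span_superset[of B] B(1) N_carr by blast
  have p': "p \<notin> span B" using p(2) B(1) by simp
  have q': "q \<notin> span (insert p B)" using q(2) B(1) by (simp add: span_breakdown_eq)
  have ind: "independent (insert q (insert p B))"
    using B(2) p' q' by (intro independent_insertI)
  have "p \<notin> B" "q \<notin> insert p B" using p' q' span_base by blast+
  then have "card (insert q (insert p B)) = alg_dim A" using B(3,4) dim by simp
  then have "carr A \<subseteq> span (insert q (insert p B))"
    using ind p(1) q(1) Bc B(4) by (intro independent_card_spans) auto
  then have "a \<in> span (insert q (insert p B))" using a by blast
  then obtain d where "a - smul A d q \<in> span (insert p B)"
    unfolding span_breakdown_eq[of a q "insert p B"] by blast
  then obtain c where "a - smul A d q - smul A c p \<in> N"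
    unfolding span_breakdown_eq[of _ p B] B(1) by blast
  then have "a - smul A c p - smul A d q \<in> N" by (simp add: algebra_simps)
  then show ?thesis by (rule that)
qed

text \<open>A proper subspace of the plane \<open>A / N\<close> is at most a line: if
  \<open>p\<close> and \<open>a\<close> were independent modulo \<open>N\<close>, then
  \<open>P\<close> would be all of \<open>A\<close>.\<close>

lemma N_add_notin_decompose:
  assumes P: "subspace P" "P \<subseteq> carr A" "N \<subseteq> P" "P \<noteq> carr A" and p: "p \<in> P" "p \<notin> N" and a: "a \<in> P"
  obtains c where "a - smul A c p \<in> N"
proof (rule ccontr)
  assume "\<not> thesis"
  then have a': "\<And>c. a - smul A c p \<notin> N" using that by blast
  have "x \<in> P" if x: "x \<in> carr A" for x
  proof -
    obtain c d where cd: "x - smul A c p - smul A d a \<in> N"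
      using carr_decompose[of p a x] p a a' x P(2) by blast
    have "x = (x - smul A c p - smul A d a) + smul A c p + smul A d a" by simp
    also have "\<dots> \<in> P" using P(1,3) cd p a by (intro subspace_add subspace_scale) auto
    finally show ?thesis .
  qed
  then show False using P(2,4) by blast
qed

text \<open>With equal first arguments the two terms on the right of the Leibniz identity
  cancel.\<close>

lemma left_bracket_square:
  assumes "p \<in> carr A" "y \<in> carr A"
  shows "(p \<bullet> p) \<bullet> y = 0"
  using left_leibniz[of p p y] assms by simp

text \<open>Let \<open>P = [A, A] + N\<close>. It is an ideal of weight zero, and solvability makes
  it proper. If it were larger than \<open>N\<close>, it would be a line modulo \<open>N\<close>,
  spanned by a bracket \<open>p\<close>; the vanishing of left multiplication by squares puts
  \<open>p \<bullet> p\<close> into \<open>N\<close>. Then \<open>P\<close> satisfies all hypotheses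
  of \<open>nilpotent_ideal_eq_N\<close> and equals \<open>N\<close> after all.\<close>

lemma bracket_in_N:
  assumes x: "x \<in> carr A" and y: "y \<in> carr A"
  shows "x \<bullet> y \<in> N"
proof (rule ccontr)
  assume notin: "x \<bullet> y \<notin> N"
  define P where "P = {d + m | d m. d \<in> bracket_span A (carr A) (carr A) \<and> m \<in> N}"
  have bs: "bracket_span A (carr A) (carr A) \<subseteq> carr A" by (rule bracket_span_subset_carr) auto
  have subP: "subspace P" unfolding P_def by (rule subspace_sums[OF subspace_bracket_span subspace_N])
  have Pc: "P \<subseteq> carr A" unfolding P_def using bs N_carr carr_add by blast
  have NP: "N \<subseteq> P"
  proof
    fix m assume "m \<in> N"
    then have "0 + m \<in> P" unfolding P_def using subspace_0[OF subspace_bracket_span] by blast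
    then show "m \<in> P" by simp
  qed
  have brP: "a \<bullet> c \<in> P" if "a \<in> carr A" "c \<in> carr A" for a c
  proof -
    have "a \<bullet> c + 0 \<in> P" unfolding P_def
      using bracket_in_span[OF that] subspace_0[OF subspace_N] by blast
    then show ?thesis by simp
  qed
  have idP: "ideal A P" unfolding ideal_def using subP Pc brP by (auto simp: subset_iff)
  have wP: "L a = 0 \<and> M a = 0" if "a \<in> P" for a
  proof -
    have "subspace {a \<in> carr A. L a = 0 \<and> M a = 0}"
      using carr_zero weights_N[OF subspace_0[OF subspace_N]]
      by (intro subspaceI) (auto simp: carr_add carr_smul weights_linear)
    then have "bracket_span A (carr A) (carr A) \<subseteq> {a \<in> carr A. L a = 0 \<and> M a = 0}"
      by (rule bracket_span_subset) (simp add: bracket_closed weights_bracket)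
    then show ?thesis using that weights_N N_carr weights_linear(1,2) unfolding P_def by fastforce
  qed
  have "P \<noteq> carr A"
  proof
    assume PA: "P = carr A"
    \<comment> \<open>If \<open>P\<close> were everything, each term of the derived series would
      still cover \<open>A\<close> modulo \<open>N\<close>, because products of representatives
      modulo \<open>N\<close> agree modulo \<open>N\<close>.\<close>
    have der: "\<exists>d\<in>derived_series A k. a - d \<in> N" if "a \<in> carr A" for a k
      using that
    proof (induction k arbitrary: a)
      case 0
      then show ?case using subspace_0[OF subspace_N] by (intro bexI[of _ a]) auto
    next
      case (Suc k)
      let ?U = "{a \<in> carr A. \<exists>d\<in>derived_series A (Suc k). a - d \<in> N}"
      have sD: "subspace (derived_series A (Suc k))" by (rule subspace_derived_series)
      have "subspace ?U"
      proof (rule subspaceI)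
        show "0 \<in> ?U" using carr_zero subspace_0[OF sD] subspace_0[OF subspace_N]
          by (intro CollectI conjI bexI[of _ 0]) simp_all
      next
        fix a c assume "a \<in> ?U" "c \<in> ?U"
        then obtain d e where *: "a \<in> carr A" "c \<in> carr A" "d \<in> derived_series A (Suc k)"
          "e \<in> derived_series A (Suc k)" "a - d \<in> N" "c - e \<in> N" by blast
        have "(a - d) + (c - e) \<in> N" using * by (intro subspace_add[OF subspace_N])
        then have "(a + c) - (d + e) \<in> N" by (simp add: algebra_simps)
        then show "a + c \<in> ?U" using * carr_add subspace_add[OF sD] by blast
      next
        fix s a assume "a \<in> ?U"
        then obtain d where *: "a \<in> carr A" "d \<in> derived_series A (Suc k)" "a - d \<in> N" by blast
        have "smul A s (a - d) \<in> N" using * by (intro subspace_scale[OF subspace_N])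
        then have "smul A s a - smul A s d \<in> N" by (simp add: scale_right_diff_distrib)
        then show "smul A s a \<in> ?U" using * carr_smul subspace_scale[OF sD] by blast
      qed
      then have sub: "bracket_span A (carr A) (carr A) \<subseteq> ?U"
      proof (rule bracket_span_subset)
        fix a c assume a: "a \<in> carr A" and c: "c \<in> carr A"
        obtain d e where de: "d \<in> derived_series A k" "e \<in> derived_series A k" "a - d \<in> N" "c - e \<in> N"
          using Suc.IH a c by meson
        have dc: "d \<in> carr A" "e \<in> carr A" using de derived_series_subset_carr by blast+
        have "a \<bullet> c - d \<bullet> e = (a - d) \<bullet> c + d \<bullet> (c - e)"
          using a c dc by (simp add: bracket_diff_left bracket_diff_right)
        also have "\<dots> \<in> N" using de a c dc by (intro subspace_add[OF subspace_N] N_bracket)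
        finally have "a \<bullet> c - d \<bullet> e \<in> N" .
        moreover have "d \<bullet> e \<in> derived_series A (Suc k)" using de by (simp add: bracket_in_span)
        ultimately show "a \<bullet> c \<in> ?U" using a c bracket_closed by blast
      qed
      from Suc.prems PA obtain d m where dm: "a = d + m" "d \<in> bracket_span A (carr A) (carr A)" "m \<in> N"
        unfolding P_def by blast
      then obtain e where e: "e \<in> derived_series A (Suc k)" "d - e \<in> N" using sub by blast
      have "(d - e) + m \<in> N" using e dm by (intro subspace_add[OF subspace_N])
      then have "a - e \<in> N" using dm(1) by (simp add: algebra_simps)
      then show ?case using e by blast
    qed
    obtain k where "derived_series A k = {0}" using solvable unfolding solvable_algebra_def by blast
    then have "carr A \<subseteq> N" using der[of _ k] by auto
    then show False using N_neq_carr N_carr by blast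
  qed
  have "a \<bullet> c \<in> N" if ac: "a \<in> P" "c \<in> P" for a c
  proof -
    let ?p = "x \<bullet> y"
    have p: "?p \<in> P" "?p \<in> carr A" using brP x y bracket_closed by auto
    obtain s where s: "a - smul A s ?p \<in> N"
      using N_add_notin_decompose[OF subP Pc NP \<open>P \<noteq> carr A\<close> p(1) notin ac(1)] .
    obtain r where r: "c - smul A r ?p \<in> N"
      using N_add_notin_decompose[OF subP Pc NP \<open>P \<noteq> carr A\<close> p(1) notin ac(2)] .
    obtain u where u: "?p \<bullet> ?p - smul A u ?p \<in> N"
      using N_add_notin_decompose[OF subP Pc NP \<open>P \<noteq> carr A\<close> p(1) notin brP[OF p(2) p(2)]] .
    have pp: "?p \<bullet> ?p \<in> N"
    proof (cases "u = 0")
      case True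
      then show ?thesis using u by simp
    next
      case False
      \<comment> \<open>Multiplying the element of \<open>N\<close> by \<open>?p\<close> on the
        right kills the square and leaves \<open>- u\<close> times \<open>?p \<bullet> ?p\<close>,
        again in \<open>N\<close>.\<close>
      have "(?p \<bullet> ?p - smul A u ?p) \<bullet> ?p = - smul A u (?p \<bullet> ?p)"
        using p(2) left_bracket_square[OF p(2) p(2)]
        by (simp add: bracket_diff_left bracket_closed carr_smul bracket_smul_left)
      moreover have "(?p \<bullet> ?p - smul A u ?p) \<bullet> ?p \<in> N" using u p(2) by (intro N_bracket)
      ultimately have "- smul A u (?p \<bullet> ?p) \<in> N" by simp
      then have "smul A (- 1 / u) (- smul A u (?p \<bullet> ?p)) \<in> N" by (rule subspace_scale[OF subspace_N])
      then show ?thesis using False by simp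
    qed
    have acc: "a \<in> carr A" "c \<in> carr A" using ac Pc by auto
    have "a \<bullet> c = (a - smul A s ?p) \<bullet> c + smul A s ?p \<bullet> (c - smul A r ?p) + smul A (s * r) (?p \<bullet> ?p)"
      using acc p(2) by (simp add: bracket_diff_left bracket_diff_right carr_smul bracket_smul_left
        bracket_smul_right)
    also have "\<dots> \<in> N"
      using N_bracket(2)[OF acc(2) s] N_bracket(1)[OF carr_smul[OF p(2)] r] subspace_scale[OF subspace_N pp]
      by (intro subspace_add[OF subspace_N])
    finally show ?thesis .
  qed
  then have "P = N" using nilpotent_ideal_eq_N[OF idP NP wP] by blast
  then show False using notin brP x y by blast
qed

text \<open>The common kernel of the two weights is an ideal containing \<open>N\<close>, and
  \<open>bracket_in_N\<close> supplies the condition on its products that maximality needs.\<close>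

lemma N_eq_weights_zero:
  assumes "a \<in> carr A" "L a = 0" "M a = 0"
  shows "a \<in> N"
proof -
  let ?J = "{a \<in> carr A. L a = 0 \<and> M a = 0}"
  have "subspace ?J"
    using carr_zero weights_N[OF subspace_0[OF subspace_N]]
    by (intro subspaceI) (auto simp: carr_add carr_smul weights_linear)
  then have "ideal A ?J" unfolding ideal_def by (auto simp: bracket_closed weights_bracket)
  moreover have "N \<subseteq> ?J" using N_carr weights_N by blast
  ultimately have "?J = N" by (rule nilpotent_ideal_eq_N) (auto intro: bracket_in_N)
  then show ?thesis using assms by blast
qed

text \<open>By \<open>N_eq_weights_zero\<close> the pair of weights is injective on
  \<open>A / N\<close>, which has dimension two; the preimage is given by Cramer's rule.\<close>

lemma weights_surj: "\<exists>a\<in>carr A. L a = l \<and> M a = m"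
proof -
  obtain p where p: "p \<in> carr A" "p \<notin> N" using N_neq_carr N_carr by blast
  have "\<exists>q\<in>carr A. \<forall>c. q - smul A c p \<notin> N"
  proof (rule ccontr)
    assume *: "\<not> (\<exists>q\<in>carr A. \<forall>c. q - smul A c p \<notin> N)"
    define B where "B = (\<lambda>i. \<phi> (bvec i)) ` {1..n}"
    have B: "span B = N" "card B = n" "finite B" using N_basis by (simp_all add: B_def)
    have "carr A \<subseteq> span (insert p B)" using * B(1) by (auto simp: span_breakdown_eq)
    then have "dim (carr A) \<le> card (insert p B)" using B(3) by (intro dim_le_card) auto
    also have "\<dots> \<le> n + 1" using B(2,3) by (simp add: card_insert_if)
    finally show False using dim by (simp add: alg_dim_def)
  qed
  then obtain q where q: "q \<in> carr A" "\<And>c. q - smul A c p \<notin> N" by blast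
  have comb: "L (smul A s p + smul A r q) = s * L p + r * L q"
    "M (smul A s p + smul A r q) = s * M p + r * M q" "smul A s p + smul A r q \<in> carr A" for s r
    using p q by (simp_all add: weights_linear carr_smul carr_add)
  have indep: "s = 0 \<and> r = 0" if sr: "s * L p + r * L q = 0" "s * M p + r * M q = 0" for s r
  proof -
    have mem: "smul A s p + smul A r q \<in> N" using sr comb by (intro N_eq_weights_zero) simp_all
    have "r = 0"
    proof (rule ccontr)
      assume r: "r \<noteq> 0"
      have "smul A (1 / r) (smul A s p + smul A r q) \<in> N" using mem by (rule subspace_scale[OF subspace_N])
      then have "q - smul A (- (s / r)) p \<in> N" using r by (simp add: scale_right_distrib algebra_simps)
      then show False using q(2) by blast
    qed
    have "s = 0"
    proof (rule ccontr)
      assume s: "s \<noteq> 0"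
      have "smul A (1 / s) (smul A s p + smul A r q) \<in> N" using mem by (rule subspace_scale[OF subspace_N])
      then show False using s \<open>r = 0\<close> p(2) by simp
    qed
    then show ?thesis using \<open>r = 0\<close> by simp
  qed
  define \<Delta> where "\<Delta> = L p * M q - L q * M p"
  have "\<Delta> \<noteq> 0"
  proof
    assume "\<Delta> = 0"
    then have d: "L p * M q = L q * M p" by (simp add: \<Delta>_def)
    \<comment> \<open>A zero determinant makes (L q, - L p) and (M q, - M p) coefficients of linear
      relations. Both are trivial by \<open>indep\<close>, so all four weights vanish; then (1, 1)
      is a relation as well, which is absurd.\<close>
    have "L q = 0 \<and> - L p = 0" by (rule indep) (use d in \<open>simp_all add: algebra_simps\<close>)
    moreover have "M q = 0 \<and> - M p = 0" by (rule indep) (use d in \<open>simp_all add: algebra_simps\<close>)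
    ultimately have "(1::complex) = 0 \<and> (1::complex) = 0" by (intro indep) simp_all
    then show False by simp
  qed
  define s r where "s = (l * M q - m * L q) / \<Delta>" and "r = (m * L p - l * M p) / \<Delta>"
  have "(l * M q - m * L q) * L p + (m * L p - l * M p) * L q = l * \<Delta>"
    "(l * M q - m * L q) * M p + (m * L p - l * M p) * M q = m * \<Delta>"
    by (simp_all add: \<Delta>_def algebra_simps)
  then have "s * L p + r * L q = l" "s * M p + r * M q = m"
    using \<open>\<Delta> \<noteq> 0\<close> by (simp_all add: s_def r_def add_divide_distrib[symmetric])
  then show ?thesis using comb[of s r] by metis
qed

end

section \<open>The weight basis\<close>

text \<open>On the nilradical \<open>t\<close> has the weights 3, 2 and \<open>1 + 3k\<close>, which are distinct and nonzero.\<close>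

locale L4_extension_torus = L4_extension +
  fixes t
  assumes t: "t \<in> carr A" "L t = 1" "M t = 3"
begin

sublocale T: coord_derivation n "act t"
  using t(1) by (rule act_derivation)

lemma flag_weight_t: "flag_weight n (act t) i = of_nat (if i = 0 then 1 else if i = 1 then 3 else if i = n - 1 then 2 else 1 + 3 * (i - 1))"
  by (simp add: flag_weight_def t)

text \<open>Chain weights and the weight of \<open>v\<close> are 1 modulo 3, and the weights of
  \<open>z\<close> and \<open>w\<close> are 2 and 3. The values ruled out later are 0 and
  \<open>2 + 3 * m\<close> with \<open>m \<noteq> 0\<close>.\<close>

lemma flag_weight_t_neq:
  assumes "m \<noteq> 2" "m \<noteq> 3" "m mod 3 \<noteq> 1"
  shows "flag_weight n (act t) i \<noteq> of_nat m"
proof -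
  have "m \<noteq> 1 + 3 * (i - 1)" "m \<noteq> 1" using assms(3) by auto
  then show ?thesis unfolding flag_weight_t of_nat_eq_iff using assms by auto
qed

lemma no_eigenvector:
  assumes "x \<in> coord_space n" "act t x = of_nat m \<cdot> x" "m \<noteq> 2" "m \<noteq> 3" "m mod 3 \<noteq> 1"
  shows "x = 0"
  using assms flag_weight_t_neq[of m] by (intro T.eigenvector_in_flag[of x 0 "of_nat m"]) (simp_all add: T.flag_0)

lemma in_flag_1: "x \<in> coord_space n \<Longrightarrow> x 3 = 0 \<Longrightarrow> x \<in> flag n 1"
  using n by (auto simp: flag_def)

lemma in_flag_2: "x \<in> coord_space n \<Longrightarrow> x 3 = 0 \<Longrightarrow> x 1 = 0 \<Longrightarrow> x \<in> flag n 2"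
  using n by (auto simp: flag_def)

lemma flag_weight_neq_1: "1 \<le> j \<Longrightarrow> flag_weight n (act t) j \<noteq> 1"
proof -
  assume "1 \<le> j"
  then have "flag_weight n (act t) j \<noteq> of_nat 1" unfolding flag_weight_t of_nat_eq_iff by auto
  then show ?thesis by simp
qed

lemma flag_weight_neq_3: "2 \<le> j \<Longrightarrow> flag_weight n (act t) j \<noteq> 3"
proof -
  assume "2 \<le> j"
  moreover have "3 \<noteq> 1 + 3 * (j - 1)" by presburger
  ultimately have "flag_weight n (act t) j \<noteq> of_nat 3" unfolding flag_weight_t of_nat_eq_iff by auto
  then show ?thesis by simp
qed

text \<open>The vector \<open>bvec 3\<close> is an eigenvector up to an error in
  \<open>flag n 1\<close>. The weight 1 does not recur from there on, so the error can be solved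
  away without touching coordinate 3.\<close>

lemma ex_V: "\<exists>V. V \<in> coord_space n \<and> act t V = V \<and> V 3 = 1"
proof -
  have "act t (bvec 3) - flag_weight n (act t) 0 \<cdot> bvec 3 \<in> flag n (Suc 0)"
    using n bvec_mem by (intro T.D_flag) (simp_all add: T.flag_0)
  then have "act t (bvec 3) - bvec 3 \<in> flag n 1" by (simp add: flag_weight_t)
  then obtain u where u: "u \<in> flag n 1" "act t u - 1 \<cdot> u = act t (bvec 3) - bvec 3"
    using T.solve_in_flag[of "act t (bvec 3) - bvec 3" 1 1] flag_weight_neq_1 n by auto
  have uc: "u \<in> coord_space n" using u(1) by (rule T.flag_coord_space)
  have "act t (bvec 3 - u) = act t (bvec 3) - act t u" using bvec_mem uc by (intro T.D_diff)
  also have "\<dots> = bvec 3 - u" using u(2) by (simp add: algebra_simps)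
  finally have "act t (bvec 3 - u) = bvec 3 - u" .
  moreover have "bvec 3 - u \<in> coord_space n" using bvec_mem uc by (intro coord_space_diff)
  moreover have "(bvec 3 - u) 3 = 1" using u(1) by (simp add: flag_def bvec_apply)
  ultimately show ?thesis by blast
qed

lemma ex_W: "\<exists>W. W \<in> coord_space n \<and> act t W = 3 \<cdot> W \<and> W 1 = 1 \<and> W 3 = 0"
proof -
  have w1: "bvec 1 \<in> flag n 1" using bvec_mem by (intro in_flag_1) (simp_all add: bvec_apply)
  then have "act t (bvec 1) - flag_weight n (act t) 1 \<cdot> bvec 1 \<in> flag n (Suc 1)"
    using n by (intro T.D_flag) simp_all
  then have "act t (bvec 1) - 3 \<cdot> bvec 1 \<in> flag n 2" by (simp add: flag_weight_t numeral_2_eq_2)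
  then obtain u where u: "u \<in> flag n 2" "act t u - 3 \<cdot> u = act t (bvec 1) - 3 \<cdot> bvec 1"
    using T.solve_in_flag[of "act t (bvec 1) - 3 \<cdot> bvec 1" 2 3] flag_weight_neq_3 n by auto
  have uc: "u \<in> coord_space n" using u(1) by (rule T.flag_coord_space)
  have "act t (bvec 1 - u) = act t (bvec 1) - act t u" using bvec_mem uc by (intro T.D_diff)
  also have "\<dots> = 3 \<cdot> (bvec 1 - u)" using u(2) unfolding cs.scale_right_diff_distrib by (simp add: algebra_simps)
  finally have "act t (bvec 1 - u) = 3 \<cdot> (bvec 1 - u)" .
  moreover have "bvec 1 - u \<in> coord_space n" using bvec_mem uc by (intro coord_space_diff)
  moreover have "u 1 = 0" "u 3 = 0" using u(1) unfolding flag_def by auto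
  ultimately show ?thesis by (intro exI[of _ "bvec 1 - u"]) (simp add: bvec_apply)
qed

section \<open>Multiplication table of the eigenvectors in the nilradical\<close>

definition V where "V = (SOME V. V \<in> coord_space n \<and> act t V = V \<and> V 3 = 1)"
definition W where "W = (SOME W. W \<in> coord_space n \<and> act t W = 3 \<cdot> W \<and> W 1 = 1 \<and> W 3 = 0)"
definition F where "F k = ((\<lambda>x. canon_br n x W) ^^ (k - 3)) V"

lemma V: "V \<in> coord_space n" "act t V = V" "V 3 = 1"
  using someI_ex[OF ex_V] unfolding V_def by blast+

lemma W: "W \<in> coord_space n" "act t W = 3 \<cdot> W" "W 1 = 1" "W (Suc 0) = 1" "W 3 = 0"
  using someI_ex[OF ex_W] unfolding W_def by auto

lemma F_3: "F 3 = V"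
  by (simp add: F_def)

lemma F_Suc: "3 \<le> k \<Longrightarrow> F (Suc k) = canon_br n (F k) W"
  unfolding F_def by (subst Suc_diff_le) simp_all

lemma F_closed: "3 \<le> k \<Longrightarrow> F k \<in> coord_space n"
  by (induction k rule: dec_induct) (simp_all add: F_3 F_Suc V canon_br_closed)

text \<open>Each \<open>F k\<close> has leading coordinate \<open>k\<close> with coefficient 1.
  Coordinate 2 is absent because \<open>W\<close> has no component along \<open>v\<close>.\<close>

lemma F_coord:
  assumes "4 \<le> k"
  shows "F k (Suc 0) = 0 \<and> F k 2 = 0 \<and> F k 3 = 0 \<and> (\<forall>j. 4 \<le> j \<and> j < k \<longrightarrow> F k j = 0) \<and> (k \<le> n \<longrightarrow> F k k = 1)"
  using assms
proof (induction k rule: dec_induct)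
  case base
  have "F 4 = canon_br n V W" using F_Suc[of 3] by (simp add: F_3)
  then show ?case using V W n by (auto simp: canon_br_coord_space)
next
  case (step k)
  have *: "F (Suc k) = canon_br n (F k) W" "F k \<in> coord_space n" using step F_Suc F_closed by auto
  have "F (Suc k) j = 0" if "4 \<le> j" "j < Suc k" for j
  proof (cases "j \<le> n")
    case True
    have "j - 1 = 3 \<or> 4 \<le> j - 1 \<and> j - 1 < k" using that by auto
    then have "F k (j - 1) = 0" using step.IH by metis
    then show ?thesis using * W step.IH True that n by (simp add: canon_br_coord_space)
  next
    case False
    then show ?thesis unfolding *(1) using coord_spaceD[OF canon_br_closed] by simp
  qed
  then show ?case using * W step n by (simp add: canon_br_coord_space)
qed

lemma F_Suc_n: "F (Suc n) = 0"
proof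
  fix j
  have c: "F (Suc n) \<in> coord_space n" using n by (intro F_closed) simp
  have "j = 1 \<or> j = 2 \<or> j = 3 \<or> 4 \<le> j \<and> j < Suc n \<or> (j = 0 \<or> n < j)" by presburger
  then show "F (Suc n) j = 0 j"
    using F_coord[of "Suc n"] coord_spaceD[OF c, of j] n by auto
qed

lemma act_F:
  assumes a: "a \<in> carr A" "act a V = l \<cdot> V" "act a W = m \<cdot> W" and k: "3 \<le> k"
  shows "act a (F k) = (l + of_nat (k - 3) * m) \<cdot> F k"
  using k
proof (induction k rule: dec_induct)
  case base
  then show ?case by (simp add: F_3 a)
next
  case (step k)
  interpret a: coord_derivation n "act a" using a(1) by (rule act_derivation)
  have "act a (F (Suc k)) = canon_br n (act a (F k)) W + canon_br n (F k) (act a W)"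
    using step F_closed W by (simp add: F_Suc a.D_canon_br)
  also have "\<dots> = (l + of_nat (k - 3) * m + m) \<cdot> F (Suc k)"
    using step unfolding step.IH a(3) canon_br_bilinear by (simp add: F_Suc cs.scale_left_distrib)
  also have "l + of_nat (k - 3) * m + m = l + of_nat (Suc k - 3) * m"
    using step by (subst Suc_diff_le) (simp_all add: algebra_simps)
  finally show ?case .
qed

lemma act_t_F: "3 \<le> k \<Longrightarrow> act t (F k) = of_nat (1 + 3 * (k - 3)) \<cdot> F k"
  using act_F[of t 1 3 k] t V W by (simp add: mult.commute)

text \<open>\<open>V\<close> may have components beyond its leading one, so the vanishing cannot be
  read off coordinates. The bracket has weight \<open>2 + 3 * m\<close> with
  \<open>m \<noteq> 0\<close>, which is no eigenvalue of \<open>act t\<close>.\<close>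

lemma canon_br_F_F:
  assumes "3 \<le> j" "3 \<le> k" "j \<noteq> 3 \<or> k \<noteq> 3"
  shows "canon_br n (F j) (F k) = 0"
proof -
  define m where "m = (j - 3) + (k - 3)"
  have "act t (canon_br n (F j) (F k)) = canon_br n (act t (F j)) (F k) + canon_br n (F j) (act t (F k))"
    using assms F_closed by (intro T.D_canon_br)
  also have "\<dots> = (of_nat (1 + 3 * (j - 3)) + of_nat (1 + 3 * (k - 3))) \<cdot> canon_br n (F j) (F k)"
    unfolding act_t_F[OF assms(1)] act_t_F[OF assms(2)] canon_br_bilinear cs.scale_left_distrib ..
  also have "of_nat (1 + 3 * (j - 3)) + of_nat (1 + 3 * (k - 3)) = (of_nat (2 + 3 * m) :: complex)"
    by (simp add: m_def)
  finally have "act t (canon_br n (F j) (F k)) = of_nat (2 + 3 * m) \<cdot> canon_br n (F j) (F k)" .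
  moreover have "m \<noteq> 0" using assms by (auto simp: m_def)
  moreover have "2 + 3 * m \<noteq> 3" "(2 + 3 * m) mod 3 \<noteq> 1" by presburger+
  ultimately show ?thesis by (intro no_eigenvector[OF canon_br_closed, of _ _ "2 + 3 * m"]) simp_all
qed

lemma canon_br_V_V: "canon_br n V V = bvec 2"
proof
  fix j
  have "j = 1 \<or> j = 2 \<or> j = 3 \<or> 4 \<le> j \<and> j \<le> n \<or> j = 0 \<or> n < j" by presburger
  then consider "j = 1" | "j = 2" | "j = 3" | "4 \<le> j" "j \<le> n" | "j = 0 \<or> n < j" by blast
  then show "canon_br n V V j = bvec 2 j"
  proof cases
    case 5
    then show ?thesis using coord_spaceD[OF canon_br_closed, of j V V] n by (auto simp: bvec_apply)
  qed (use V n in \<open>simp_all add: canon_br_coord_space bvec_apply\<close>)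
qed

text \<open>The only symmetric term of the bracket on \<open>coord_space n\<close> is the product of
  the coordinates 3, and that coordinate of \<open>W\<close> is zero.\<close>

lemma canon_br_W_left:
  assumes "x \<in> coord_space n"
  shows "canon_br n W x = - canon_br n x W"
proof
  fix j
  have "j = 1 \<or> j = 2 \<or> j = 3 \<or> 4 \<le> j \<and> j \<le> n \<or> j = 0 \<or> n < j" by presburger
  then consider "j = 1" | "j = 2" | "j = 3" | "4 \<le> j" "j \<le> n" | "j = 0 \<or> n < j" by blast
  then show "canon_br n W x j = (- canon_br n x W) j"
  proof cases
    case 5
    then show ?thesis using coord_spaceD[OF canon_br_closed, of j] n by auto
  qed (use W assms n in \<open>simp_all add: canon_br_coord_space\<close>)
qed

lemma canon_br_W_W: "canon_br n W W = 0"
proof -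
  have "2 \<cdot> canon_br n W W = 0" using canon_br_W_left[OF W(1)] by (auto simp: fun_eq_iff)
  then show ?thesis by simp
qed

lemma canon_br_bvec_2:
  assumes "x \<in> coord_space n"
  shows "canon_br n (bvec 2) x = 0" "canon_br n x (bvec 2) = 0"
  using assms n by (auto simp: canon_br_def bvec_apply fun_eq_iff coord_spaceD)

definition Bv where "Bv i = (if i = 1 then W else if i = 2 then bvec 2 else F i)"

lemma Bv_closed: "i \<in> {1..n} \<Longrightarrow> Bv i \<in> coord_space n"
  using W bvec_mem F_closed[of i] by (cases "3 \<le> i") (auto simp: Bv_def)

text \<open>After subtraction of the right multiple of \<open>V\<close> the vector lies in
  \<open>flag n 1\<close>, where 1 is no longer a weight.\<close>

lemma eigenvector_1:
  assumes "x \<in> coord_space n" "act t x = x"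
  shows "x = x 3 \<cdot> V"
proof -
  have c: "x - x 3 \<cdot> V \<in> coord_space n" using assms V by (intro coord_space_diff coord_space_cscale)
  have "x - x 3 \<cdot> V = 0"
  proof (rule T.eigenvector_in_flag[of _ 1 1])
    show "x - x 3 \<cdot> V \<in> flag n 1" using c V by (intro in_flag_1) simp_all
    show "act t (x - x 3 \<cdot> V) = 1 \<cdot> (x - x 3 \<cdot> V)"
      using assms V by (simp add: T.D_diff T.D_scale coord_space_cscale)
  qed (use n flag_weight_neq_1 in auto)
  then show ?thesis by simp
qed

lemma eigenvector_3:
  assumes "x \<in> coord_space n" "act t x = 3 \<cdot> x"
  shows "x = x 1 \<cdot> W"
proof -
  have c: "x - x 1 \<cdot> W \<in> coord_space n" using assms W by (intro coord_space_diff coord_space_cscale)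
  have "x 3 = 0" using T.D_coord_3[OF assms(1)] assms(2) t by simp
  have "x - x 1 \<cdot> W = 0"
  proof (rule T.eigenvector_in_flag[of _ 2 3])
    show "x - x 1 \<cdot> W \<in> flag n 2" using c W \<open>x 3 = 0\<close> by (intro in_flag_2) simp_all
    show "act t (x - x 1 \<cdot> W) = 3 \<cdot> (x - x 1 \<cdot> W)"
      using assms W by (simp add: T.D_diff T.D_scale coord_space_cscale cs.scale_right_diff_distrib mult.commute)
  qed (use n flag_weight_neq_3 in auto)
  then show ?thesis by simp
qed

section \<open>The centralizer of \<open>t\<close> and its two-sided action\<close>

definition C where "C = {h \<in> carr A. t \<bullet> h = 0}"

text \<open>As 0 is not a weight of \<open>t\<close> on the nilradical, \<open>t \<bullet> a\<close>
  is also \<open>t \<bullet> \<phi> u\<close> for some \<open>u\<close>. Subtracting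
  \<open>\<phi> u\<close> does not change the weights, so the centralizer maps onto
  \<open>A / N\<close>.\<close>

lemma centralizer_ex:
  assumes a: "a \<in> carr A"
  shows "\<exists>h\<in>C. L h = L a \<and> M h = M a"
proof -
  obtain r where r: "r \<in> coord_space n" "t \<bullet> a = \<phi> r" using bracket_in_N[OF t(1) a] by auto
  have "flag_weight n (act t) j \<noteq> 0" for j using flag_weight_t_neq[of 0 j] by simp
  then obtain u where u: "u \<in> coord_space n" "act t u = r"
    using T.solve_in_flag[of r 0 0] r n by (auto simp: T.flag_0)
  have "t \<bullet> (a - \<phi> u) = 0" using u r a t phi_act[OF t(1) u(1)] by (simp add: bracket_diff_right phi_carr)
  moreover have "L (a - \<phi> u) = L a" "M (a - \<phi> u) = M a"
    using a u phi_carr weights_N[OF phi_N[OF u(1)]] by (simp_all add: weights_diff)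
  ultimately show ?thesis using a u phi_carr carr_diff unfolding C_def by blast
qed

lemma C_carr: "h \<in> C \<Longrightarrow> h \<in> carr A" and C_t: "h \<in> C \<Longrightarrow> t \<bullet> h = 0"
  by (simp_all add: C_def)

text \<open>The product lies in \<open>N\<close> and is annihilated by \<open>t\<close> through the
  Leibniz identity, while 0 is not an eigenvalue there.\<close>

lemma C_abelian:
  assumes h: "h \<in> C" "h' \<in> C"
  shows "h \<bullet> h' = 0"
proof -
  obtain r where r: "r \<in> coord_space n" "h \<bullet> h' = \<phi> r" using bracket_in_N[of h h'] h C_carr by auto
  have "t \<bullet> (h \<bullet> h') = 0"
    using left_leibniz[of t h h'] h t by (simp add: C_carr C_t bracket_zero_left bracket_zero_right)
  then have "\<phi> (act t r) = \<phi> 0" using r t by (simp add: phi_act phi_zero)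
  then have "act t r = of_nat 0 \<cdot> r" using r act_closed t coord_space_zero phi_eqD by simp
  then have "r = 0" using r by (intro no_eigenvector) auto
  then show ?thesis using r phi_zero by simp
qed

lemma act_C_commute:
  assumes "h \<in> C" "x \<in> coord_space n"
  shows "act t (act h x) = act h (act t x)"
proof -
  have "act 0 x = 0" using act_smul[OF carr_zero assms(2), of 0] by simp
  then show ?thesis using act_bracket[OF t(1) C_carr[OF assms(1)] assms(2)] C_t[OF assms(1)] by simp
qed

text \<open>Left multiplication by \<open>h\<close> commutes with that of \<open>t\<close> and so
  preserves the eigenlines of \<open>V\<close> and \<open>W\<close>; the eigenvalues appear in the
  leading coordinates.\<close>

lemma act_C:
  assumes h: "h \<in> C"
  shows "act h V = L h \<cdot> V" "act h W = M h \<cdot> W"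
    "3 \<le> k \<Longrightarrow> act h (F k) = (L h + of_nat (k - 3) * M h) \<cdot> F k"
    "act h (bvec 2) = (2 * L h) \<cdot> bvec 2"
proof -
  have hc: "h \<in> carr A" using h by (rule C_carr)
  interpret h: coord_derivation n "act h" using hc by (rule act_derivation)
  have "act h V = act h V 3 \<cdot> V"
    using V act_closed[OF hc] by (intro eigenvector_1) (simp_all add: act_C_commute[OF h])
  then show 1: "act h V = L h \<cdot> V" using h.D_coord_3[OF V(1)] V by simp
  have "act h W = act h W 1 \<cdot> W"
    using W act_closed[OF hc] by (intro eigenvector_3) (simp_all add: act_C_commute[OF h] h.D_scale)
  then show 2: "act h W = M h \<cdot> W" using h.D_coord_1[OF W(1)] W by simp
  show "3 \<le> k \<Longrightarrow> act h (F k) = (L h + of_nat (k - 3) * M h) \<cdot> F k" using hc 1 2 by (rule act_F)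
  show "act h (bvec 2) = (2 * L h) \<cdot> bvec 2" by (rule h.D_bvec_2)
qed

text \<open>The sum of the Leibniz identities for \<open>a, c\<close> and \<open>c, a\<close>. It is
  the substitute for antisymmetry that determines right multiplications.\<close>

lemma bracket_sym_left_zero:
  assumes "a \<in> carr A" "c \<in> carr A" "y \<in> carr A"
  shows "(a \<bullet> c + c \<bullet> a) \<bullet> y = 0"
  using left_leibniz[of a c y] left_leibniz[of c a y] assms by (simp add: bracket_add_left bracket_closed)

text \<open>Right multiplication by \<open>h\<close> is not a derivation, but since
  \<open>t \<bullet> h = 0\<close> the Leibniz identity makes it commute with left multiplication by
  \<open>t\<close>, so it preserves weights.\<close>

lemma right_C_eigen:
  assumes h: "h \<in> C" and x: "x \<in> coord_space n" "act t x = \<mu> \<cdot> x"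
  obtains r where "r \<in> coord_space n" "\<phi> x \<bullet> h = \<phi> r" "act t r = \<mu> \<cdot> r"
proof -
  have hc: "h \<in> carr A" using h by (rule C_carr)
  obtain r where r: "r \<in> coord_space n" "\<phi> x \<bullet> h = \<phi> r" using bracket_in_N[of "\<phi> x" h] phi_carr x hc by auto
  have "(t \<bullet> \<phi> x) \<bullet> h = t \<bullet> (\<phi> x \<bullet> h) - \<phi> x \<bullet> (t \<bullet> h)"
    using left_leibniz t phi_carr x hc by simp
  then have "\<phi> (\<mu> \<cdot> x) \<bullet> h = t \<bullet> \<phi> r"
    using C_t[OF h] phi_act[OF t(1) x(1)] x r by (simp add: bracket_zero_right phi_carr)
  then have "\<phi> (\<mu> \<cdot> r) = \<phi> (act t r)"
    using r x hc t by (simp add: phi_smul bracket_smul_left phi_carr phi_act)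
  then have "act t r = \<mu> \<cdot> r"
    using phi_eqD r act_closed t coord_space_cscale by simp
  then show ?thesis using r that by blast
qed

text \<open>On \<open>V\<close> and \<open>W\<close> the right action is a scalar. Its sum with the
  left action gives a multiple of the same vector that annihilates \<open>V\<close> from the left,
  yet \<open>[V, V] = z\<close> and \<open>[W, V] = - F 4\<close> are not zero; so the scalars are
  opposite. The chain follows from the Leibniz identity, and \<open>z\<close>, being a square, is
  annihilated.\<close>

lemma right_C:
  assumes h: "h \<in> C"
  shows "\<phi> V \<bullet> h = \<phi> ((- L h) \<cdot> V)" "\<phi> W \<bullet> h = \<phi> ((- M h) \<cdot> W)"
    "3 \<le> k \<Longrightarrow> \<phi> (F k) \<bullet> h = \<phi> ((- (L h + of_nat (k - 3) * M h)) \<cdot> F k)"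
    "\<phi> (bvec 2) \<bullet> h = 0"
proof -
  have hc: "h \<in> carr A" using h by (rule C_carr)
  obtain r where r: "r \<in> coord_space n" "\<phi> V \<bullet> h = \<phi> r" "act t r = 1 \<cdot> r"
    using right_C_eigen[OF h V(1), of 1] V by auto
  have rV: "r = r 3 \<cdot> V" using r by (intro eigenvector_1) simp_all
  have "\<phi> V \<bullet> h + h \<bullet> \<phi> V = \<phi> ((r 3 + L h) \<cdot> V)"
    using r(2) rV V phi_act[OF hc V(1)] act_C(1)[OF h]
    by (metis cs.scale_left_distrib phi_add coord_space_cscale)
  then have "\<phi> ((r 3 + L h) \<cdot> V) \<bullet> \<phi> V = 0"
    using bracket_sym_left_zero[of "\<phi> V" h "\<phi> V"] hc V phi_carr by simp
  then have "\<phi> ((r 3 + L h) \<cdot> bvec 2) = \<phi> 0"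
    using V bvec_mem by (simp add: phi_smul bracket_smul_left phi_carr phi_canon_br[symmetric] canon_br_V_V phi_zero)
  then have "(r 3 + L h) \<cdot> bvec 2 = 0"
    by (rule phi_eqD) (use bvec_mem coord_space_cscale coord_space_zero in auto)
  then have "r 3 = - L h" using fun_cong[of "(r 3 + L h) \<cdot> bvec 2" 0 2] by (simp add: bvec_apply add_eq_0_iff2)
  then show 1: "\<phi> V \<bullet> h = \<phi> ((- L h) \<cdot> V)" using r(2) rV by simp
  obtain q where q: "q \<in> coord_space n" "\<phi> W \<bullet> h = \<phi> q" "act t q = 3 \<cdot> q"
    using right_C_eigen[OF h W(1,2)] .
  have qW: "q = q 1 \<cdot> W" using q by (intro eigenvector_3)
  have "\<phi> W \<bullet> h + h \<bullet> \<phi> W = \<phi> ((q 1 + M h) \<cdot> W)"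
    using q(2) qW W phi_act[OF hc W(1)] act_C(2)[OF h]
    by (metis cs.scale_left_distrib phi_add coord_space_cscale)
  then have "\<phi> ((q 1 + M h) \<cdot> W) \<bullet> \<phi> V = 0"
    using bracket_sym_left_zero[of "\<phi> W" h "\<phi> V"] hc V W phi_carr by simp
  moreover have "canon_br n W V = - F 4" using canon_br_W_left[OF V(1)] F_Suc[of 3] by (simp add: F_3)
  ultimately have "\<phi> ((q 1 + M h) \<cdot> (- F 4)) = \<phi> 0"
    using V W F_closed[of 4]
    by (simp add: phi_smul bracket_smul_left phi_carr phi_canon_br[symmetric] phi_zero coord_space_uminus del: cs.scale_minus_right)
  then have "(q 1 + M h) \<cdot> (- F 4) = 0"
    by (rule phi_eqD) (use F_closed[of 4] coord_space_cscale coord_space_uminus coord_space_zero in auto)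
  then have "q 1 + M h = 0"
    using fun_cong[of "(q 1 + M h) \<cdot> (- F 4)" 0 4] F_coord[of 4] n by auto
  then have "q 1 = - M h" by (simp only: eq_neg_iff_add_eq_0)
  then show 2: "\<phi> W \<bullet> h = \<phi> ((- M h) \<cdot> W)" using q(2) qW by simp
  show "\<phi> (F k) \<bullet> h = \<phi> ((- (L h + of_nat (k - 3) * M h)) \<cdot> F k)" if "3 \<le> k"
    using that
  proof (induction k rule: dec_induct)
    case base
    show ?case using 1 by (simp only: F_3 diff_self_eq_0 of_nat_0 mult_zero_left add_0_right)
  next
    case (step k)
    let ?w = "L h + of_nat (k - 3) * M h"
    have Fk: "F k \<in> coord_space n" "F (Suc k) \<in> coord_space n" using step F_closed by simp_all
    have "\<phi> (F (Suc k)) \<bullet> h = (\<phi> (F k) \<bullet> \<phi> W) \<bullet> h" using step Fk W by (simp add: F_Suc phi_canon_br)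
    also have "\<dots> = \<phi> (F k) \<bullet> (\<phi> W \<bullet> h) - \<phi> W \<bullet> (\<phi> (F k) \<bullet> h)"
      using Fk W hc phi_carr by (intro left_leibniz) auto
    also have "\<dots> = \<phi> (canon_br n (F k) ((- M h) \<cdot> W)) - \<phi> (canon_br n W ((- ?w) \<cdot> F k))"
      unfolding 2 step.IH using Fk W by (simp add: phi_canon_br coord_space_cscale del: cs.scale_minus_left)
    also have "\<dots> = \<phi> (canon_br n (F k) ((- M h) \<cdot> W) - canon_br n W ((- ?w) \<cdot> F k))"
      by (intro phi_diff[symmetric] canon_br_closed)
    also have "canon_br n (F k) ((- M h) \<cdot> W) - canon_br n W ((- ?w) \<cdot> F k) = (- (L h + of_nat (Suc k - 3) * M h)) \<cdot> F (Suc k)"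
      unfolding canon_br_bilinear canon_br_W_left[OF Fk(1)] using step
      by (subst Suc_diff_le) (simp_all add: F_Suc[symmetric] fun_eq_iff algebra_simps)
    finally show ?case .
  qed
  have "\<phi> (bvec 2) \<bullet> h = (\<phi> V \<bullet> \<phi> V) \<bullet> h" using V by (simp add: phi_canon_br[symmetric] canon_br_V_V)
  also have "\<dots> = 0" using left_bracket_square V hc phi_carr by simp
  finally show "\<phi> (bvec 2) \<bullet> h = 0" .
qed

section \<open>The eigenvectors form a basis of the nilradical\<close>

definition S :: "(nat \<Rightarrow> complex) \<Rightarrow> nat \<Rightarrow> complex" where
  "S c = (\<Sum>i=1..n. c i \<cdot> Bv i)"

lemma S_closed: "S c \<in> coord_space n"
  unfolding S_def by (intro cs.subspace_sum[OF subspace_coord_space] coord_space_cscale Bv_closed)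

lemma S_linear: "S (x + y) = S x + S y" "S (a \<cdot> x) = a \<cdot> S x"
  by (simp_all add: S_def cs.scale_left_distrib sum.distrib cs.scale_sum_right)

lemma S_bvec:
  assumes "i \<in> {1..n}"
  shows "S (bvec i) = Bv i"
proof -
  have "S (bvec i) = (\<Sum>k=1..n. if k = i then Bv i else 0)"
    unfolding S_def by (rule sum.cong) (auto simp: bvec_apply)
  then show ?thesis using assms by simp
qed

lemma S_bvec_outside: "n < i \<Longrightarrow> S (bvec i) = 0"
  unfolding S_def by (rule sum.neutral) (auto simp: bvec_apply)

lemma S_coord_single:
  assumes "m \<in> {1..n}" "\<And>k. k \<in> {1..n} \<Longrightarrow> k \<noteq> m \<Longrightarrow> c k * Bv k j = 0"
  shows "S c j = c m * Bv m j"
proof -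
  have "S c j = (\<Sum>k=1..n. if k = m then c m * Bv m j else 0)"
    unfolding S_def sum_fun_apply cscale_apply using assms(2) by (intro sum.cong) auto
  then show ?thesis using assms(1) by simp
qed

lemma index_cases:
  assumes "k \<in> {1..n}"
  obtains "k = 1" | "k = 2" | "k = 3" | "4 \<le> k" "k \<le> n"
proof -
  have "k = 1 \<or> k = 2 \<or> k = 3 \<or> 4 \<le> k \<and> k \<le> n"
    using assms unfolding atLeastAtMost_iff by presburger
  then show ?thesis using that by blast
qed

text \<open>Triangular elimination in the order 3, 1, 4, ..., n, 2: each coordinate of
  \<open>S c\<close> isolates one coefficient once the earlier ones are zero.\<close>

lemma S_injective:
  assumes c: "c \<in> coord_space n" and 0: "S c = 0"
  shows "c = 0"
proof -
  have "S c 3 = c 3 * Bv 3 3"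
  proof (rule S_coord_single)
    fix k assume "k \<in> {1..n}" "k \<noteq> 3"
    then show "c k * Bv k 3 = 0"
      by (elim index_cases) (use W F_coord[of k] in \<open>simp_all add: Bv_def bvec_apply\<close>)
  qed (use n in simp)
  then have c3: "c 3 = 0" using 0 V by (simp add: Bv_def F_3)
  have "S c 1 = c 1 * Bv 1 1"
  proof (rule S_coord_single)
    fix k assume "k \<in> {1..n}" "k \<noteq> 1"
    then show "c k * Bv k 1 = 0"
      by (elim index_cases) (use c3 F_coord[of k] in \<open>simp_all add: Bv_def bvec_apply\<close>)
  qed (use n in simp)
  then have c1: "c 1 = 0" using 0 W by (simp add: Bv_def)
  have ck: "c k = 0" if "4 \<le> k" "k \<le> n" for k
    using that
  proof (induction k rule: less_induct)
    case (less k)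
    have "S c k = c k * Bv k k"
    proof (rule S_coord_single)
      fix l assume l: "l \<in> {1..n}" "l \<noteq> k"
      from l(1) show "c l * Bv l k = 0"
      proof (rule index_cases)
        assume "4 \<le> l" "l \<le> n"
        then show ?thesis using less F_coord[of l] l(2) by (cases "l < k") (simp_all add: Bv_def)
      qed (use c1 c3 less.prems in \<open>simp_all add: Bv_def bvec_apply\<close>)
    qed (use less.prems in simp)
    then show ?case using 0 F_coord[of k] less.prems by (simp add: Bv_def)
  qed
  have "S c 2 = c 2 * Bv 2 2"
  proof (rule S_coord_single)
    fix k assume "k \<in> {1..n}" "k \<noteq> 2"
    then show "c k * Bv k 2 = 0"
      by (elim index_cases) (use c1 c3 ck[of k] in simp_all)
  qed (use n in simp)
  then have c2: "c 2 = 0" using 0 by (simp add: Bv_def bvec_apply)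
  have "c k = 0" for k
  proof (cases "k \<in> {1..n}")
    case True
    then show ?thesis by (rule index_cases) (use c1 c2 c3 ck in auto)
  qed (use c coord_spaceD[of c n k] in auto)
  then show ?thesis by auto
qed

lemma Bv_flag:
  assumes "i < n"
  shows "Bv (flag_index n i) \<in> flag n i" "Bv (flag_index n i) (flag_index n i) = 1" "flag_index n i \<in> {1..n}"
proof -
  have "i = 0 \<or> i = 1 \<or> i = n - 1 \<and> 2 \<le> i \<or> 2 \<le> i \<and> i + 2 \<le> n" using assms by linarith
  then consider "i = 0" | "i = 1" | "i = n - 1" "2 \<le> i" | "2 \<le> i" "i + 2 \<le> n" "i \<noteq> n - 1" by fastforce
  then have "Bv (flag_index n i) \<in> flag n i \<and> Bv (flag_index n i) (flag_index n i) = 1 \<and> flag_index n i \<in> {1..n}"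
  proof cases
    case 1
    then show ?thesis using n V by (simp add: flag_index_def Bv_def F_3 T.flag_0)
  next
    case 2
    then show ?thesis using n W in_flag_1 by (simp add: flag_index_def Bv_def)
  next
    case 3
    then have "flag_index n i = 2" using n by (simp add: flag_index_def)
    then show ?thesis using 3 n bvec_mem by (auto simp: Bv_def flag_def bvec_apply)
  next
    case 4
    then have "flag_index n i = i + 2" by (simp add: flag_index_def)
    then show ?thesis using 4 F_coord[of "i + 2"] F_closed[of "i + 2"] n by (auto simp: Bv_def flag_def)
  qed
  then show "Bv (flag_index n i) \<in> flag n i" "Bv (flag_index n i) (flag_index n i) = 1" "flag_index n i \<in> {1..n}" by blast+
qed

text \<open>Downward induction along the flag: by \<open>Bv_flag\<close>, every step has a basis
  vector with leading coefficient 1 at the coordinate to be removed.\<close>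

lemma S_surjective:
  assumes "x \<in> coord_space n"
  shows "\<exists>c\<in>coord_space n. x = S c"
proof -
  have "\<exists>c\<in>coord_space n. x = S c" if "x \<in> flag n i" "i \<le> n" for x i
    using that(2,1)
  proof (induction i arbitrary: x rule: inc_induct)
    case base
    then have "x = 0" by (simp add: T.flag_n)
    moreover have "S 0 = 0" by (simp add: S_def)
    ultimately have "x = S 0" by (simp only:)
    then show ?case using coord_space_zero by blast
  next
    case (step i)
    let ?p = "flag_index n i"
    have "x - x ?p \<cdot> Bv ?p \<in> flag n (Suc i)"
      using step.prems step.hyps Bv_flag[of i] T.subspace_flag[of i]
      by (intro T.flag_SucI cs.subspace_diff cs.subspace_scale) simp_all
    then obtain c where c: "c \<in> coord_space n" "x - x ?p \<cdot> Bv ?p = S c" using step.IH by blast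
    have "x = S c + x ?p \<cdot> Bv ?p" using c(2) by (metis diff_add_cancel)
    also have "\<dots> = S (c + x ?p \<cdot> bvec ?p)"
      using Bv_flag(3)[of i] step.hyps by (simp add: S_linear S_bvec)
    finally have "x = S (c + x ?p \<cdot> bvec ?p)" .
    moreover have "c + x ?p \<cdot> bvec ?p \<in> coord_space n"
      by (intro coord_space_add coord_space_cscale bvec_in_coord_space c(1) Bv_flag(3) step.hyps(2))
    ultimately show ?case by blast
  qed
  from this[of x 0] show ?thesis using assms by (simp add: T.flag_0)
qed

section \<open>Assembling the isomorphism with the canonical algebra\<close>

lemma bracket_F_W: "3 \<le> k \<Longrightarrow> \<phi> (F k) \<bullet> \<phi> W = \<phi> (F (Suc k))" "3 \<le> k \<Longrightarrow> \<phi> W \<bullet> \<phi> (F k) = - \<phi> (F (Suc k))"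
  using F_closed[of k] F_closed[of "Suc k"] W by (simp_all add: phi_canon_br[symmetric] F_Suc canon_br_W_left phi_uminus)

lemma bracket_F_F: "3 \<le> j \<Longrightarrow> 3 \<le> k \<Longrightarrow> \<phi> (F j) \<bullet> \<phi> (F k) = (if j = 3 \<and> k = 3 then \<phi> (bvec 2) else 0)"
  using F_closed[of j] F_closed[of k] canon_br_F_F[of j k] canon_br_V_V
  by (auto simp: phi_canon_br[symmetric] F_3 phi_zero)

lemma isomorphic_canon_ext: "canon_ext n \<cong>\<^sub>L A"
proof -
  \<comment> \<open>The weights (0, 1) and (1, 0) are those of the last two basis vectors of the
    canonical algebra, which \<open>X\<close> and \<open>Y\<close> are to match.\<close>
  obtain X where X: "X \<in> C" "L X = 0" "M X = 1"
    using weights_surj[of 0 1] centralizer_ex by metis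
  obtain Y where Y: "Y \<in> C" "L Y = 1" "M Y = 0"
    using weights_surj[of 1 0] centralizer_ex by metis
  have XY: "X \<in> carr A" "Y \<in> carr A" using X Y C_carr by auto
  define G where "G c = \<phi> (S c) + smul A (c (n + 1)) X + smul A (c (n + 2)) Y" for c
  have G_add: "G (x + y) = G x + G y" for x y
    by (simp add: G_def S_linear phi_add S_closed scale_left_distrib)
  have G_scale: "G (a \<cdot> x) = smul A a (G x)" for a x
    by (simp add: G_def S_linear phi_smul S_closed scale_right_distrib)
  have G_closed: "G x \<in> carr A" for x
    unfolding G_def by (intro carr_add carr_smul phi_carr S_closed XY)
  have G_uminus: "G (- x) = - G x" for x using G_scale[of "-1" x] by simp
  have G_zero: "G 0 = 0" using G_scale[of 0 0] by simp
  have G1: "G (bvec 1) = \<phi> W" "G (bvec (Suc 0)) = \<phi> W"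
    using n S_bvec[of 1] by (simp_all add: G_def Bv_def bvec_apply)
  have G2: "G (bvec 2) = \<phi> (bvec 2)"
    using n S_bvec[of 2] by (simp add: G_def Bv_def bvec_apply)
  have Gk: "G (bvec k) = \<phi> (F k)" if "3 \<le> k" "k \<le> n" for k
    using that S_bvec[of k] by (simp add: G_def Bv_def bvec_apply)
  have GX: "G (bvec (Suc n)) = X" by (simp add: G_def S_bvec_outside phi_zero bvec_apply)
  have GY: "G (bvec (Suc (Suc n))) = Y" by (simp add: G_def S_bvec_outside phi_zero bvec_apply)
  have left: "h \<bullet> \<phi> W = smul A (M h) (\<phi> W)" "h \<bullet> \<phi> (bvec 2) = smul A (2 * L h) (\<phi> (bvec 2))"
    "3 \<le> k \<Longrightarrow> h \<bullet> \<phi> (F k) = smul A (L h + of_nat (k - 3) * M h) (\<phi> (F k))" if h: "h \<in> C" for h k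
    using C_carr[OF h] act_C[OF h] W bvec_mem F_closed by (simp_all add: phi_act[symmetric] phi_smul)
  have right: "\<phi> W \<bullet> h = smul A (- M h) (\<phi> W)" "\<phi> (bvec 2) \<bullet> h = 0"
    "3 \<le> k \<Longrightarrow> \<phi> (F k) \<bullet> h = smul A (- (L h + of_nat (k - 3) * M h)) (\<phi> (F k))" if h: "h \<in> C" for h k
    using right_C[OF h] W F_closed by (simp_all add: phi_smul del: scale_minus_left cs.scale_minus_left)
  have WW: "\<phi> W \<bullet> \<phi> W = 0" using W by (simp add: phi_canon_br[symmetric] canon_br_W_W phi_zero)
  have Z: "\<phi> (bvec 2) \<bullet> \<phi> x = 0" "\<phi> x \<bullet> \<phi> (bvec 2) = 0" if "x \<in> coord_space n" for x
    using that bvec_mem by (simp_all add: phi_canon_br[symmetric] canon_br_bvec_2 phi_zero)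
  have cases: "i = 1 \<or> i = 2 \<or> i = 3 \<or> 4 \<le> i \<and> i < n \<or> 4 \<le> i \<and> i = n \<or> i = Suc n \<or> i = Suc (Suc n)" if "i \<in> {1..n+2}" for i
    using that n unfolding atLeastAtMost_iff by presburger
  have basis: "G (canon_br n (bvec i) (bvec j)) = G (bvec i) \<bullet> G (bvec j)"
    if ij: "i \<in> {1..n+2}" "j \<in> {1..n+2}" for i j
    using cases[OF ij(1)] cases[OF ij(2)] n unfolding canon_br_bvec[OF n ij]
    by (elim disjE)
      (simp_all add: G1 G2 Gk GX GY G_zero G_uminus G_scale left right X Y WW Z W F_closed bvec_mem bracket_F_W
        bracket_F_F F_Suc_n phi_zero C_abelian scale_left_diff_distrib)
  have inj: "x = 0" if x: "x \<in> coord_space (n + 2)" "G x = 0" for x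
  proof -
    \<comment> \<open>Weights vanish on the part in \<open>N\<close>, so they detect exactly the
      last two coordinates.\<close>
    have "L (G x) = x (n + 2)" "M (G x) = x (n + 1)"
      unfolding G_def using XY X Y S_closed phi_carr weights_N[OF phi_N[OF S_closed]]
      by (simp_all add: weights_linear carr_add carr_smul)
    moreover have "L 0 = 0" "M 0 = 0" using weights_N[OF subspace_0[OF subspace_N]] by auto
    ultimately have 0: "x (n + 1) = 0" "x (n + 2) = 0" using x(2) by simp_all
    then have "x \<in> coord_space n" using x(1) by (rule coord_space_trunc)
    moreover have "\<phi> (S x) = \<phi> 0" using x(2) 0 by (simp add: G_def phi_zero)
    then have "S x = 0" using S_closed coord_space_zero by (rule phi_eqD)
    ultimately show ?thesis by (rule S_injective)
  qed
  have "inj_on G (coord_space (n + 2))"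
  proof (rule inj_onI)
    fix x y assume xy: "x \<in> coord_space (n + 2)" "y \<in> coord_space (n + 2)" "G x = G y"
    have "G (x - y) = 0" using G_add[of "x - y" y] xy(3) by simp
    then have "x - y = 0" using inj coord_space_diff xy by blast
    then show "x = y" by simp
  qed
  moreover have "a \<in> G ` coord_space (n + 2)" if a: "a \<in> carr A" for a
  proof -
    \<comment> \<open>Removing both weights leaves an element of \<open>N\<close>, which the
      eigenvectors span.\<close>
    let ?a = "a - smul A (M a) X - smul A (L a) Y"
    have "?a \<in> N"
      using a XY X Y by (intro N_eq_weights_zero) (simp_all add: weights_diff weights_linear carr_diff carr_smul)
    then obtain c where c: "c \<in> coord_space n" "?a = \<phi> (S c)" using S_surjective by blast
    define d where "d = c + (M a \<cdot> bvec (n + 1) + L a \<cdot> bvec (n + 2))"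
    have "S (bvec (n + 1)) = 0" "S (bvec (n + 2)) = 0" by (simp_all add: S_bvec_outside)
    then have "S d = S c" by (simp add: d_def S_linear)
    moreover have "d (n + 1) = M a" "d (n + 2) = L a"
      using coord_spaceD[OF c(1)] by (simp_all add: d_def bvec_apply)
    ultimately have "G d = ?a + smul A (M a) X + smul A (L a) Y" unfolding G_def using c by simp
    then have "G d = a" by simp
    moreover have "c \<in> coord_space (n + 2)" using c(1) coord_space_mono[of n "n + 2"] by auto
    then have "d \<in> coord_space (n + 2)" unfolding d_def
      by (intro coord_space_add coord_space_cscale bvec_in_coord_space) simp_all
    ultimately show ?thesis by blast
  qed
  ultimately have "bij_betw G (coord_space (n + 2)) (carr A)"
    using G_closed unfolding bij_betw_def by blast
  then show ?thesis
    using basis G_add G_scale n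
    by (intro isomorphic_from_basis[where g = G and m = "n + 2"] fd_algebra_canon_ext fd_algebra_axioms) simp_all
qed

end

lemma (in L4_extension) isomorphic_canon_ext: "canon_ext n \<cong>\<^sub>L A"
proof -
  obtain t where t: "t \<in> carr A" "L t = 1" "M t = 3" using weights_surj by blast
  interpret L4_extension_torus A n \<phi> t
    by (rule L4_extension_torus.intro[OF L4_extension_axioms]) (rule L4_extension_torus_axioms.intro[OF t])
  show ?thesis by (rule isomorphic_canon_ext)
qed

text \<open>The given identification of the nilradical with \<open>L4 n\<close> is composed with
  that of the canonical nilradical, so that \<phi> starts from the coordinates in which derivations
  are triangular.\<close>

lemma solvable_extension_isomorphic_canon_ext:
  assumes n: "4 \<le> n" and A: "solvable_extension_of_L4 n A"
  shows "A \<cong>\<^sub>L canon_ext n"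
proof -
  have LA: "left_leibniz_algebra A" and A': "solvable_algebra A" "alg_dim A = n + 2"
    using A by (simp_all add: solvable_extension_of_L4_def)
  interpret left_leibniz_algebra A by fact
  obtain N where N: "is_nilradical A N" "restrict_alg A N \<cong>\<^sub>L L4 n"
    using A unfolding solvable_extension_of_L4_def by blast
  then have mN: "maximal_nilpotent_ideal A N" by (simp add: is_nilradical_def)
  then have iN: "ideal A N" by (simp add: maximal_nilpotent_ideal_def nilpotent_ideal_def)
  have K: "fd_algebra (canon_ext n)" using n by (intro fd_algebra_canon_ext) simp
  have "L4 n \<cong>\<^sub>L restrict_alg A N"
    using ideal_fd_algebra[OF iN] fd_algebra_L4[OF n] N(2) by (rule isomorphic_sym)
  then have "restrict_alg (canon_ext n) (coord_space n) \<cong>\<^sub>L restrict_alg A N"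
    by (rule isomorphic_trans[OF restrict_canon_ext_isomorphic_L4[OF n]])
  then obtain \<phi> where "alg_iso \<phi> (restrict_alg (canon_ext n) (coord_space n)) (restrict_alg A N)"
    using isomorphic_iff_alg_iso by blast
  then have \<phi>: "inj_on \<phi> (coord_space n)" "\<phi> ` coord_space n = N"
    "\<And>x y. x \<in> coord_space n \<Longrightarrow> y \<in> coord_space n \<Longrightarrow> \<phi> (x + y) = \<phi> x + \<phi> y"
    "\<And>c x. x \<in> coord_space n \<Longrightarrow> \<phi> (c \<cdot> x) = smul A c (\<phi> x)"
    "\<And>x y. x \<in> coord_space n \<Longrightarrow> y \<in> coord_space n \<Longrightarrow> \<phi> (canon_br n x y) = bracket A (\<phi> x) (\<phi> y)"
    by (simp_all add: alg_iso_def bij_betw_def)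
  interpret L4_extension A n \<phi>
    by unfold_locales (use n \<phi> mN A' in simp_all)
  show ?thesis using K fd_algebra_axioms isomorphic_canon_ext by (rule isomorphic_sym)
qed

theorem theorem5p2p4:
  fixes n :: nat and A :: "'a::ab_group_add calgebra"
  assumes "4 \<le> n"
  shows "(5 \<le> n \<longrightarrow> solvable_extension_of_L4 n (l1 n)) \<and>
    (n = 4 \<longrightarrow>
       (\<forall>b. l2_admissible b \<longrightarrow> solvable_extension_of_L4 n (l2 b)) \<and>
       (\<forall>c. l3_admissible c \<longrightarrow> solvable_extension_of_L4 n (l3 c)) \<and>
       (\<forall>b. l4_admissible b \<longrightarrow> solvable_extension_of_L4 n (l4 b))) \<and>
    (solvable_extension_of_L4 n A \<longrightarrow>
       (5 \<le> n \<longrightarrow> A \<cong>\<^sub>L l1 n) \<and>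
       (n = 4 \<longrightarrow>
          (\<exists>b. l2_admissible b \<and> A \<cong>\<^sub>L l2 b) \<or>
          (\<exists>c. l3_admissible c \<and> A \<cong>\<^sub>L l3 c) \<or>
          (\<exists>b. l4_admissible b \<and> A \<cong>\<^sub>L l4 b)))"
proof -
  have K: "fd_algebra (canon_ext n)" "solvable_extension_of_L4 n (canon_ext n)"
    using assms by (auto intro: fd_algebra_canon_ext solvable_extension_canon_ext restrict_canon_ext_isomorphic_L4)
  have ext: "solvable_extension_of_L4 n B" if "fd_algebra B" "B \<cong>\<^sub>L canon_ext n" for B :: "(nat \<Rightarrow> complex) calgebra"
    using solvable_extension_transfer[OF K(2) that(1) fd_algebra_L4[OF assms] isomorphic_sym[OF that(1) K(1) that(2)]] .
  have cls: "A \<cong>\<^sub>L B" if "solvable_extension_of_L4 n A" "fd_algebra B" "B \<cong>\<^sub>L canon_ext n" for B :: "(nat \<Rightarrow> complex) calgebra"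
    using solvable_extension_isomorphic_canon_ext[OF assms that(1)] isomorphic_sym[OF that(2) K(1) that(3)]
    by (rule isomorphic_trans)
  have "solvable_extension_of_L4 n (l1 n)" using l1_isomorphic_canon_ext[OF assms] by (rule ext)
  moreover have "solvable_extension_of_L4 n (l2 b)" if "n = 4" "l2_admissible b" for b
    using that l2_isomorphic_canon_ext[of b] by (intro ext) (simp_all add: l2_admissible_def)
  moreover have "solvable_extension_of_L4 n (l3 c)" if "n = 4" "l3_admissible c" for c
    using that(1) l3_isomorphic_canon_ext[OF l3_admissible_imp[OF that(2)]] by (intro ext) simp_all
  moreover have "solvable_extension_of_L4 n (l4 b)" if "n = 4" "l4_admissible b" for b
    using that(1) l4_isomorphic_canon_ext[OF l4_admissible_imp[OF that(2)]] by (intro ext) simp_all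
  moreover have "A \<cong>\<^sub>L l1 n" if "solvable_extension_of_L4 n A"
    using that l1_isomorphic_canon_ext[OF assms] by (rule cls)
  \<comment> \<open>All admissible algebras are isomorphic when \<open>n = 4\<close>, so one
    admissible representative settles the disjunction.\<close>
  moreover have "A \<cong>\<^sub>L l2 0" if "solvable_extension_of_L4 n A" "n = 4"
    using that l2_isomorphic_canon_ext[of 0] by (intro cls) simp_all
  ultimately show ?thesis using l2_0_admissible by blast
qed

end
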